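(* The parabolic v-grim reapers of $\mathbb{H}^2\times\mathbb{R}$ are parametrized by $\Psi(s,t)=(t,y(s),z(s))$, $s\in I\subset\mathbb{R}$, $t\in\mathbb{R}$, where the generating curve $\alpha(s)=(y(s),z(s))$ is given by: (1) $$\alpha(s)=(y(s),z(s))=\left(e^{\frac{s}{\sqrt5}},\ \frac{-2s}{\sqrt5}\right).$$ The generating curve $\alpha(s)$ is an embedded vertical graph whose height function is unbounded and has a contact point with the ideal boundary $\mathbb{H}^2_\infty\times\mathbb{R}$ as $s\to-\infty$. (2) $$y(s)=\left(\frac{10}{\sqrt5\sinh(\sqrt5 s)+5\cosh(\sqrt5 s)}\right)^{1/5}\exp\left\{\frac45\tan^{-1}\!\left(\frac12\Big(1+\sqrt5\tanh\frac{\sqrt5 s}{2}\Big)\right)\right\},$$ $$z(s)=\frac25\left(\tan^{-1}\!\left(\frac12\Big(1+\sqrt5\tanh\frac{\sqrt5 s}{2}\Big)\right)+\log\left(\frac{5\cosh(\sqrt5 s)+\sqrt5\sinh(\sqrt5 s)}{10}\right)\right).$$ The generating curve $\alpha(s)$ is an embedded vertical bi-graph whose height function $z(s)$ attains a global minimum and $y(s)$ a global maximum. Moreover, the surface has two contact points with the ideal boundary $\mathbb{H}^2_\infty\times\mathbb{R}$ as $|s|\to\infty$.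
   Context: $\mathbb{H}^2\times\mathbb{R}$ is $\{(x,y,z)\in\mathbb{R}^3: y>0\}$ with metric $\frac{dx^2+dy^2}{y^2}+dz^2$; here $\mathbb{H}^2$ is the upper half-plane $\{(x,y):y>0\}$, its ideal boundary $\mathbb{H}^2_\infty$ is the one-point compactification of the line $y=0$, and the ideal boundary of $\mathbb{H}^2\times\mathbb{R}$ is $\mathbb{H}^2_\infty\times\mathbb{R}$. For an orientable immersed surface $\Sigma$ with unit normal $N$, $H$ denotes the mean curvature with respect to $N$, i.e. half the trace of the second fundamental form $\langle N,\overline\nabla_{\cdot}\,\cdot\rangle$, where $\overline\nabla$ is the Levi-Civita connection. $\Sigma$ is a v-translator if $H=\langle N,\partial_z\rangle$. A parabolic v-grim reaper is a v-translator invariant by the one-parameter group of parabolic translations $(x,y,z)\mapsto(x+t,y,z)$, $t\in\mathbb{R}$. The height function is the $z$-coordinate. A vertical graph is a graph on the $xy$-plane (for a curve in the $yz$-plane: $z$ is a function of $y$), and a vertical bi-graph is a union of two vertical graphs.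
   Formalization: The parametrization is up to the isometries (x,y,z)->(lx,ly,z+c), since translates of grim reapers are grim reapers; contact with the ideal boundary means only that the horizontal projection converges, as z tends to infinity there; both ends in (2) lie over the same ideal point. *)

theory Defs
  imports "HOL-Analysis.Analysis"
begin

primrec Ck_on :: "nat \<Rightarrow> 'a::real_normed_vector set \<Rightarrow> ('a \<Rightarrow> 'b::real_normed_vector) \<Rightarrow> bool" where
  "Ck_on 0 U f \<longleftrightarrow> continuous_on U f"
| "Ck_on (Suc k) U f \<longleftrightarrow>
     (\<forall>p\<in>U. f differentiable (at p)) \<and>
     (\<forall>v. Ck_on k U (\<lambda>p. frechet_derivative f (at p) v))"

text \<open>Only used for open sets \<open>U\<close>.\<close>

definition smooth_on :: "'a::real_normed_vector set \<Rightarrow> ('a \<Rightarrow> 'b::real_normed_vector) \<Rightarrow> bool" where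
  "smooth_on U f \<longleftrightarrow> (\<forall>k. Ck_on k U f)"

text \<open>Coordinates are \<open>x = p $ 1\<close>, \<open>y = p $ 2\<close>, \<open>z = p $ 3\<close>.\<close>

definition H2R :: "(real^3) set" where
  "H2R = {p. 0 < p $ 2}"

definition metric :: "real^3 \<Rightarrow> real^3^3" where
  "metric p = (\<chi> i j. if i \<noteq> j then 0 else if i = 3 then 1 else 1 / (p $ 2)\<^sup>2)"

definition metric_inner :: "real^3 \<Rightarrow> real^3 \<Rightarrow> real^3 \<Rightarrow> real" where
  "metric_inner p v w = (\<Sum>i\<in>UNIV. \<Sum>j\<in>UNIV. metric p $ i $ j * v $ i * w $ j)"

definition metric_deriv :: "real^3 \<Rightarrow> 3 \<Rightarrow> 3 \<Rightarrow> 3 \<Rightarrow> real" where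
  "metric_deriv p k i j = frechet_derivative (\<lambda>q. metric q $ i $ j) (at p) (axis k 1)"

text \<open>\<open>christoffel p k i j\<close> is the symbol of the Levi-Civita connection with upper index \<open>k\<close>
  and lower indices \<open>i\<close>, \<open>j\<close>.\<close>

definition christoffel :: "real^3 \<Rightarrow> 3 \<Rightarrow> 3 \<Rightarrow> 3 \<Rightarrow> real" where
  "christoffel p k i j =
     1/2 * (\<Sum>l\<in>UNIV. matrix_inv (metric p) $ k $ l *
              (metric_deriv p i j l + metric_deriv p j i l - metric_deriv p l i j))"

text \<open>For a local parametrization \<open>X\<close> and parameter directions \<open>a\<close>, \<open>b\<close>, this is the covariant
  derivative of the field \<open>dX(b)\<close> along \<open>X\<close> in the direction \<open>dX(a)\<close>.\<close>

definition covariant_deriv ::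
    "(real \<times> real \<Rightarrow> real^3) \<Rightarrow> real \<times> real \<Rightarrow> real \<times> real \<Rightarrow> real \<times> real \<Rightarrow> real^3" where
  "covariant_deriv X p a b =
     frechet_derivative (\<lambda>q. frechet_derivative X (at q) b) (at p) a +
     (\<chi> k. \<Sum>i\<in>UNIV. \<Sum>j\<in>UNIV. christoffel (X p) k i j *
             frechet_derivative X (at p) a $ i * frechet_derivative X (at p) b $ j)"

definition first_form ::
    "(real \<times> real \<Rightarrow> real^3) \<Rightarrow> real \<times> real \<Rightarrow> real \<times> real \<Rightarrow> real \<times> real \<Rightarrow> real" where
  "first_form X p a b =
     metric_inner (X p) (frechet_derivative X (at p) a) (frechet_derivative X (at p) b)"

definition second_form ::
    "(real \<times> real \<Rightarrow> real^3) \<Rightarrow> real^3 \<Rightarrow> real \<times> real \<Rightarrow> real \<times> real \<Rightarrow> real \<times> real \<Rightarrow> real" where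
  "second_form X n p a b = metric_inner (X p) n (covariant_deriv X p a b)"

text \<open>Half the trace of the second fundamental form with respect to the first one, i.e.
  $\frac12 \mathrm{tr}(I^{-1} II)$ written out in the coordinate basis.\<close>

definition mean_curvature ::
    "(real \<times> real \<Rightarrow> real^3) \<Rightarrow> real^3 \<Rightarrow> real \<times> real \<Rightarrow> real" where
  "mean_curvature X n p =
     (let e1 = (1, 0); e2 = (0, 1);
          I = first_form X p; II = second_form X n p
      in (I e2 e2 * II e1 e1 - I e1 e2 * (II e1 e2 + II e2 e1) + I e1 e1 * II e2 e2)
           / (2 * (I e1 e1 * I e2 e2 - (I e1 e2)\<^sup>2)))"

text \<open>A connected immersed surface: a 2-manifold \<open>M\<close> with an atlas \<open>A\<close> of local
  parametrizations \<open>(U, \<phi>)\<close> and a map \<open>F\<close> that is a smooth immersion in each of them.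
  Smooth compatibility of the charts need not be required: immersions have smooth local left
  inverses on their images, so that continuous coordinate changes are automatically smooth.\<close>

definition local_param ::
    "'a topology \<Rightarrow> ('a \<Rightarrow> real^3) \<Rightarrow> (real \<times> real) set \<Rightarrow> (real \<times> real \<Rightarrow> 'a) \<Rightarrow> bool" where
  "local_param M F U \<phi> \<longleftrightarrow>
     open U \<and> openin M (\<phi> ` U) \<and>
     homeomorphic_map (top_of_set U) (subtopology M (\<phi> ` U)) \<phi> \<and>
     smooth_on U (F \<circ> \<phi>) \<and>
     (\<forall>p\<in>U. inj (frechet_derivative (F \<circ> \<phi>) (at p)))"

definition immersed_surface ::
    "'a topology \<Rightarrow> ((real \<times> real) set \<times> (real \<times> real \<Rightarrow> 'a)) set \<Rightarrow> ('a \<Rightarrow> real^3) \<Rightarrow> bool" where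
  "immersed_surface M A F \<longleftrightarrow>
     Hausdorff_space M \<and> second_countable M \<and> connected_space M \<and> topspace M \<noteq> {} \<and>
     F ` topspace M \<subseteq> H2R \<and>
     (\<forall>(U, \<phi>)\<in>A. local_param M F U \<phi>) \<and>
     topspace M = (\<Union>(U, \<phi>)\<in>A. \<phi> ` U)"

definition unit_normal ::
    "((real \<times> real) set \<times> (real \<times> real \<Rightarrow> 'a)) set \<Rightarrow> ('a \<Rightarrow> real^3) \<Rightarrow> ('a \<Rightarrow> real^3) \<Rightarrow> bool" where
  "unit_normal A F N \<longleftrightarrow>
     (\<forall>(U, \<phi>)\<in>A. smooth_on U (N \<circ> \<phi>) \<and>
        (\<forall>p\<in>U. metric_inner (F (\<phi> p)) (N (\<phi> p)) (N (\<phi> p)) = 1 \<and>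
           (\<forall>v. metric_inner (F (\<phi> p)) (N (\<phi> p))
                  (frechet_derivative (F \<circ> \<phi>) (at p) v) = 0)))"

definition v_translator ::
    "'a topology \<Rightarrow> ((real \<times> real) set \<times> (real \<times> real \<Rightarrow> 'a)) set \<Rightarrow>
     ('a \<Rightarrow> real^3) \<Rightarrow> ('a \<Rightarrow> real^3) \<Rightarrow> bool" where
  "v_translator M A F N \<longleftrightarrow>
     immersed_surface M A F \<and> unit_normal A F N \<and>
     (\<forall>(U, \<phi>)\<in>A. \<forall>p\<in>U.
        mean_curvature (F \<circ> \<phi>) (N (\<phi> p)) p = metric_inner (F (\<phi> p)) (N (\<phi> p)) (axis 3 1))"

definition parabolic_translation :: "real \<Rightarrow> real^3 \<Rightarrow> real^3" where
  "parabolic_translation t p = vector [p $ 1 + t, p $ 2, p $ 3]"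

text \<open>An immersed surface is invariant under a one-parameter group if the group acts
  continuously on \<open>M\<close> so that \<open>F\<close> is equivariant.  For an embedded surface (\<open>F\<close> the inclusion)
  this says that the set is mapped to itself by every element of the group.\<close>

definition parabolic_invariant :: "'a topology \<Rightarrow> ('a \<Rightarrow> real^3) \<Rightarrow> bool" where
  "parabolic_invariant M F \<longleftrightarrow>
     (\<exists>\<Phi>. continuous_map (prod_topology euclideanreal M) M (\<lambda>(t, m). \<Phi> t m) \<and>
          (\<forall>m\<in>topspace M. \<Phi> 0 m = m \<and> (\<forall>s t. \<Phi> (s + t) m = \<Phi> s (\<Phi> t m)) \<and>
             (\<forall>t. F (\<Phi> t m) = parabolic_translation t (F m))))"

definition parabolic_v_grim_reaper ::
    "'a topology \<Rightarrow> ((real \<times> real) set \<times> (real \<times> real \<Rightarrow> 'a)) set \<Rightarrow> ('a \<Rightarrow> real^3) \<Rightarrow> bool" where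
  "parabolic_v_grim_reaper M A F \<longleftrightarrow>
     (\<exists>N. v_translator M A F N) \<and> parabolic_invariant M F"

definition param :: "(real \<Rightarrow> real \<times> real) \<Rightarrow> real \<times> real \<Rightarrow> real^3" where
  "param \<alpha> = (\<lambda>(s, t). vector [t, fst (\<alpha> s), snd (\<alpha> s)])"

definition \<alpha>1 :: "real \<Rightarrow> real \<times> real" where
  "\<alpha>1 s = (exp (s / sqrt 5), - 2 * s / sqrt 5)"

definition y2 :: "real \<Rightarrow> real" where
  "y2 s = (10 / (sqrt 5 * sinh (sqrt 5 * s) + 5 * cosh (sqrt 5 * s))) powr (1/5) *
          exp (4/5 * arctan (1/2 * (1 + sqrt 5 * tanh (sqrt 5 * s / 2))))"

definition z2 :: "real \<Rightarrow> real" where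
  "z2 s = 2/5 * (arctan (1/2 * (1 + sqrt 5 * tanh (sqrt 5 * s / 2))) +
                 ln ((5 * cosh (sqrt 5 * s) + sqrt 5 * sinh (sqrt 5 * s)) / 10))"

definition \<alpha>2 :: "real \<Rightarrow> real \<times> real" where
  "\<alpha>2 s = (y2 s, z2 s)"

text \<open>The isometries \<open>(x, y, z) \<mapsto> (l x, l y, z + c)\<close> for \<open>l > 0\<close>.  They preserve
  \<open>\<partial>\<^sub>z\<close>, hence v-translators, and normalize the parabolic group; they account for the two
  constants of integration in \<open>y\<close> and \<open>z\<close>.\<close>

definition dilate_shift :: "real \<Rightarrow> real \<Rightarrow> real^3 \<Rightarrow> real^3" where
  "dilate_shift l c p = vector [l * p $ 1, l * p $ 2, p $ 3 + c]"

definition embedded_curve :: "(real \<Rightarrow> real \<times> real) \<Rightarrow> bool" where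
  "embedded_curve \<alpha> \<longleftrightarrow>
     smooth_on UNIV \<alpha> \<and> (\<forall>s. vector_derivative \<alpha> (at s) \<noteq> 0) \<and>
     (\<exists>g. homeomorphism UNIV (range \<alpha>) \<alpha> g)"

text \<open>Vertical graphs are connected and continuous; otherwise every set of points \<open>(y, z)\<close>
  meeting each vertical line at most twice would be a vertical bi-graph.\<close>

definition vertical_graph :: "(real \<times> real) set \<Rightarrow> bool" where
  "vertical_graph C \<longleftrightarrow>
     (\<exists>D f. is_interval D \<and> D \<noteq> {} \<and> D \<subseteq> {0<..} \<and> continuous_on D f \<and> C = (\<lambda>y. (y, f y)) ` D)"

definition vertical_bigraph :: "(real \<times> real) set \<Rightarrow> bool" where
  "vertical_bigraph C \<longleftrightarrow> (\<exists>C1 C2. vertical_graph C1 \<and> vertical_graph C2 \<and> C = C1 \<union> C2)"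

text \<open>The ideal boundary of the half-plane: the line \<open>y = 0\<close> and its point at infinity.\<close>

datatype ideal_point = Line real | Infinity_point

text \<open>A curve in \<open>H2R\<close> has a contact point with the ideal boundary, over the given ideal point
  of the half-plane, along a filter if its horizontal projection converges to that ideal point.
  No condition is put on the height, which tends to infinity in the cases at hand.\<close>

fun ideal_contact :: "(real \<Rightarrow> real^3) \<Rightarrow> real filter \<Rightarrow> ideal_point \<Rightarrow> bool" where
  "ideal_contact \<gamma> G (Line a) \<longleftrightarrow> ((\<lambda>s. (\<gamma> s $ 1, \<gamma> s $ 2)) \<longlongrightarrow> (a, 0)) G"
| "ideal_contact \<gamma> G Infinity_point \<longleftrightarrow> filterlim (\<lambda>s. (\<gamma> s $ 1, \<gamma> s $ 2)) at_infinity G"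

end

theory Submission
  imports Defs
begin

text \<open>
  Write \<open>u = ln y\<close>, so that the metric of the half-plane is \<open>exp (- 2 u) dx\<^sup>2 + du\<^sup>2\<close> and the
  metric induced on the plane \<open>x = 0\<close> is the flat metric \<open>du\<^sup>2 + dz\<^sup>2\<close>.  The tangent planes of an invariant
  surface contain \<open>\<partial>\<^sub>x\<close>, hence its unit normal is \<open>N = (0, - y S, C)\<close> with
  \<open>C\<^sup>2 + S\<^sup>2 = 1\<close>, where \<open>C\<close> and \<open>S\<close> are the cosine and the sine of the angle \<open>\<theta>\<close> that the
  profile curve makes with the \<open>u\<close>-axis.  The principal curvatures are \<open>\<theta>'\<close> (the curvature of the profile in the flat
  plane) and \<open>- sin \<theta>\<close> (the horocycle direction), and \<open>N\<close> has inner product \<open>cos \<theta>\<close> with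
  \<open>\<partial>\<^sub>z\<close>.  So the surface is a v-translator iff \<open>\<theta>' = \<kappa>\<close> with
  \<open>\<kappa> = 2 cos \<theta> + sin \<theta>\<close>.  In a chart, where no arc length is at hand, this is the system
  \<open>dC = - \<kappa> dz\<close>, \<open>dS = \<kappa> du\<close> of \<open>translator_angle_system\<close>.

  \<^bold>\<open>Integration.\<close>  By the system, \<open>\<kappa> exp (2 z - u)\<close> is locally constant
  (\<open>angle_speed_first_integral\<close>).  On a connected surface \<open>\<kappa>\<close> therefore vanishes identically or
  has a fixed sign, which is positive after a change of \<open>N\<close> to \<open>- N\<close>.  If \<open>\<kappa> = 0\<close>, the angle is
  constant with slope \<open>tan \<theta> = - 2\<close>, and the profile is \<open>\<alpha>1\<close>.  If \<open>\<kappa> > 0\<close>, the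
  half-angle tangent \<open>w = S / (1 + C)\<close> satisfies \<open>w' = 1 + w - w\<^sup>2\<close> along the profile and lies
  between the two roots of the right-hand side.  Its solution is increasing, so the arc length \<open>\<sigma>\<close> can be read off from
  the normal at a point; it is a globally defined function on the surface.  Comparison with \<open>\<alpha>2\<close> at the parameter \<open>\<sigma>\<close>
  shows that \<open>ln y - ln (y2 \<sigma>)\<close> and \<open>z - z2 \<sigma>\<close> have zero differential.  Their two constant
  values are the logarithm of the dilation factor and the vertical shift.

  \<^bold>\<open>From local to global.\<close>  In both cases \<open>P = (\<sigma>, x / l)\<close> is a local homeomorphism from the
  surface to the plane which carries the group action to the translation of the second coordinate.  Such a map is injective,
  and its image is the product of an open interval with the line (\<open>equivariant_local_homeomorphism\<close>); its inverse is
  the parametrization that is asked for (\<open>grim_reaper_from_arc_length\<close>).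

  \<^bold>\<open>The two profiles.\<close>  Both curves solve \<open>y' = C y\<close>, \<open>z' = S\<close>, \<open>C' = - \<kappa> S\<close>,
  \<open>S' = \<kappa> C\<close>, with \<open>y > 0\<close> and \<open>C\<^sup>2 + S\<^sup>2 = 1\<close>, and
  this makes the surfaces over them smooth and v-translators (the locale
  \<open>translator_profile\<close>).  For \<open>\<alpha>2\<close> the explicit formulas say
  \<open>y2 = \<kappa> powr (1/5) * exp (2/5 * \<theta>)\<close> and \<open>z2 = \<theta> / 5 - 2/5 * ln \<kappa>\<close>.  Hence
  \<open>2 ln y2 + z2 = \<theta>\<close>, which recovers the parameter from the point and gives the embedding; the signs of
  \<open>cos \<theta>\<close> and \<open>sin \<theta>\<close> give the two graphs, the maximum of \<open>y2\<close> and the minimum of \<open>z2\<close>; and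
  \<open>y2\<close> tends to 0 because \<open>\<kappa>\<close> decays like \<open>exp (- sqrt 5 * \<bar>s\<bar>)\<close>.
\<close>

section \<open>Symmetry of second derivatives\<close>

lemma second_difference_mean_value:
  fixes f :: "'a::real_normed_vector \<Rightarrow> real"
  assumes f: "\<And>q. q \<in> U \<Longrightarrow> (f has_derivative f' q) (at q)"
    and fv: "\<And>q. q \<in> U \<Longrightarrow> ((\<lambda>q. f' q v) has_derivative fv' q) (at q)"
    and U: "\<And>r s. \<lbrakk>0 \<le> r; r \<le> h; 0 \<le> s; s \<le> h\<rbrakk> \<Longrightarrow> p + r *\<^sub>R v + s *\<^sub>R w \<in> U"
    and h: "0 < h"
  obtains r s where "0 < r" "r < h" "0 < s" "s < h"
    "f (p + h *\<^sub>R v + h *\<^sub>R w) - f (p + h *\<^sub>R v) - f (p + h *\<^sub>R w) + f p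
       = h * h * fv' (p + r *\<^sub>R v + s *\<^sub>R w) w"
proof -
  have lin: "linear (f' q)" if "q \<in> U" for q
    using f[OF that] by (rule has_derivative_linear)
  have lin': "linear (fv' q)" if "q \<in> U" for q
    using fv[OF that] by (rule has_derivative_linear)
  let ?g = "\<lambda>r. f (p + r *\<^sub>R v + h *\<^sub>R w) - f (p + r *\<^sub>R v)"
  have U0: "p + r *\<^sub>R v \<in> U" if "0 \<le> r" "r \<le> h" for r
    using U[of r 0] that h by simp
  have g: "(?g has_real_derivative f' (p + r *\<^sub>R v + h *\<^sub>R w) v - f' (p + r *\<^sub>R v) v) (at r)"
    if r: "0 \<le> r" "r \<le> h" for r
  proof -
    have a: "((\<lambda>r. f (p + r *\<^sub>R v + h *\<^sub>R w)) has_derivative (\<lambda>t. f' (p + r *\<^sub>R v + h *\<^sub>R w) (t *\<^sub>R v))) (at r)"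
      by (rule has_derivative_compose[of "\<lambda>r. p + r *\<^sub>R v + h *\<^sub>R w", OF _ f])
        (use U[of r h] r h in \<open>auto intro!: derivative_eq_intros\<close>)
    have b: "((\<lambda>r. f (p + r *\<^sub>R v)) has_derivative (\<lambda>t. f' (p + r *\<^sub>R v) (t *\<^sub>R v))) (at r)"
      by (rule has_derivative_compose[of "\<lambda>r. p + r *\<^sub>R v", OF _ f])
        (use U0[of r] r h in \<open>auto intro!: derivative_eq_intros\<close>)
    show ?thesis
      unfolding has_field_derivative_def
      by (rule has_derivative_eq_rhs[OF has_derivative_diff[OF a b]])
        (use U[of r h] U0[of r] r h in \<open>simp add: fun_eq_iff linear_cmul[OF lin] algebra_simps\<close>)
  qed
  obtain r where r: "0 < r" "r < h"
    and gr: "?g h - ?g 0 = (h - 0) * (f' (p + r *\<^sub>R v + h *\<^sub>R w) v - f' (p + r *\<^sub>R v) v)"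
    using MVT2[OF h g] by blast
  let ?k = "\<lambda>s. f' (p + r *\<^sub>R v + s *\<^sub>R w) v"
  have k: "(?k has_real_derivative fv' (p + r *\<^sub>R v + s *\<^sub>R w) w) (at s)"
    if s: "0 \<le> s" "s \<le> h" for s
  proof -
    have a: "(?k has_derivative (\<lambda>t. fv' (p + r *\<^sub>R v + s *\<^sub>R w) (t *\<^sub>R w))) (at s)"
      by (rule has_derivative_compose[of "\<lambda>s. p + r *\<^sub>R v + s *\<^sub>R w", OF _ fv])
        (use U[of r s] r s in \<open>auto intro!: derivative_eq_intros\<close>)
    show ?thesis
      unfolding has_field_derivative_def
      by (rule has_derivative_eq_rhs[OF a])
        (use U[of r s] r s in \<open>simp add: fun_eq_iff linear_cmul[OF lin'] algebra_simps\<close>)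
  qed
  obtain s where s: "0 < s" "s < h"
    and ks: "?k h - ?k 0 = (h - 0) * fv' (p + r *\<^sub>R v + s *\<^sub>R w) w"
    using MVT2[OF h k] by blast
  show thesis
    by (rule that[OF r s]) (use gr ks in \<open>simp add: algebra_simps\<close>)
qed

text \<open>The second difference over a small square is symmetric in the two directions; the mean value theorem, applied twice,
  equates it with the mixed derivative in either order at some point of the square.\<close>

lemma mixed_derivatives_commute:
  fixes f :: "'a::real_normed_vector \<Rightarrow> real"
  assumes U: "open U" "p \<in> U"
    and f: "\<And>q. q \<in> U \<Longrightarrow> (f has_derivative f' q) (at q)"
    and f'': "\<And>q v. q \<in> U \<Longrightarrow> ((\<lambda>q. f' q v) has_derivative f'' v q) (at q)"
    and cont: "\<And>v w. continuous_on U (\<lambda>q. f'' v q w)"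
  shows "f'' v p w = f'' w p v"
proof (rule ccontr)
  assume ne: "f'' v p w \<noteq> f'' w p v"
  define e where "e = \<bar>f'' v p w - f'' w p v\<bar> / 2"
  have e: "e > 0" using ne by (simp add: e_def)
  have "isCont (\<lambda>q. f'' v q w) p" "isCont (\<lambda>q. f'' w q v) p"
    using cont U by (auto simp: continuous_on_eq_continuous_at)
  then have near: "\<exists>d>0. \<forall>q. dist q p < d \<longrightarrow> dist (f'' v q w) (f'' v p w) < e"
      "\<exists>d>0. \<forall>q. dist q p < d \<longrightarrow> dist (f'' w q v) (f'' w p v) < e"
    using e unfolding continuous_at_eps_delta by simp_all
  obtain d1 where d: "d1 > 0"
    and d1: "\<And>q. dist q p < d1 \<Longrightarrow> dist (f'' v q w) (f'' v p w) < e"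
    using near(1) by blast
  obtain d2 where d': "d2 > 0"
    and d2: "\<And>q. dist q p < d2 \<Longrightarrow> dist (f'' w q v) (f'' w p v) < e"
    using near(2) by blast
  obtain d3 where d3: "d3 > 0" "ball p d3 \<subseteq> U"
    using U openE by blast
  define d where "d = min d1 (min d2 d3)"
  have d0: "d > 0" using d d' d3 by (simp add: d_def)
  \<comment> \<open>The term 1 keeps the denominator positive when both directions vanish.\<close>
  define h where "h = d / (2 * (norm v + norm w + 1))"
  have h: "h > 0" using d0 by (simp add: h_def add_nonneg_pos)
  have near: "dist (p + r *\<^sub>R v + s *\<^sub>R w) p < d" if "0 \<le> r" "r \<le> h" "0 \<le> s" "s \<le> h" for r s
  proof -
    have "dist (p + r *\<^sub>R v + s *\<^sub>R w) p \<le> r * norm v + s * norm w"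
      using that norm_triangle_ineq[of "r *\<^sub>R v" "s *\<^sub>R w"] by (simp add: dist_norm add.assoc)
    also have "\<dots> \<le> h * norm v + h * norm w"
      using that by (intro add_mono mult_right_mono) auto
    also have "\<dots> \<le> h * (norm v + norm w + 1)" using h by (simp add: algebra_simps)
    also have "\<dots> = d / 2"
    proof -
      have "h * (2 * c) = d" if "c > 0" "h = d / (2 * c)" for c
        using that by simp
      moreover have "norm v + norm w + 1 > 0" by (simp add: add_nonneg_pos)
      ultimately have "h * (2 * (norm v + norm w + 1)) = d" using h_def by blast
      then show ?thesis by (simp only: mult.left_commute[of h 2])
    qed
    also have "\<dots> < d" using d0 by simp
    finally show ?thesis .
  qed
  have inU: "p + r *\<^sub>R v + s *\<^sub>R w \<in> U" if "0 \<le> r" "r \<le> h" "0 \<le> s" "s \<le> h" for r s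
    using near[OF that] d3 by (auto simp: d_def subset_iff dist_commute)
  obtain r s where rs: "0 < r" "r < h" "0 < s" "s < h"
    "f (p + h *\<^sub>R v + h *\<^sub>R w) - f (p + h *\<^sub>R v) - f (p + h *\<^sub>R w) + f p
       = h * h * f'' v (p + r *\<^sub>R v + s *\<^sub>R w) w"
    by (rule second_difference_mean_value[of U f f' v "f'' v" h p w]) (use f f'' inU h in auto)
  have inU': "p + r *\<^sub>R w + s *\<^sub>R v \<in> U" if "0 \<le> r" "r \<le> h" "0 \<le> s" "s \<le> h" for r s
    using inU[of s r] that by (simp add: algebra_simps)
  obtain r' s' where rs': "0 < r'" "r' < h" "0 < s'" "s' < h"
    "f (p + h *\<^sub>R w + h *\<^sub>R v) - f (p + h *\<^sub>R w) - f (p + h *\<^sub>R v) + f p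
       = h * h * f'' w (p + r' *\<^sub>R w + s' *\<^sub>R v) v"
    by (rule second_difference_mean_value[of U f f' w "f'' w" h p v]) (use f f'' inU' h in auto)
  have "f'' v (p + r *\<^sub>R v + s *\<^sub>R w) w = f'' w (p + s' *\<^sub>R v + r' *\<^sub>R w) v"
    using rs(5) rs'(5) h by (simp add: algebra_simps)
  moreover have "dist (f'' v (p + r *\<^sub>R v + s *\<^sub>R w) w) (f'' v p w) < e"
    using near[of r s] rs by (intro d1) (auto simp: d_def)
  moreover have "dist (f'' w (p + s' *\<^sub>R v + r' *\<^sub>R w) v) (f'' w p v) < e"
    using near[of s' r'] rs' by (intro d2) (auto simp: d_def)
  ultimately show False
    by (simp add: e_def dist_real_def) (smt (verit) field_sum_of_halves)
qed

section \<open>The ambient metric and its connection\<close>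

lemma metric_inner_eq:
  "metric_inner p v w = (v $ 1 * w $ 1 + v $ 2 * w $ 2) / (p $ 2)\<^sup>2 + v $ 3 * w $ 3"
  by (simp add: metric_inner_def metric_def sum_3 add_divide_distrib)

lemma matrix_inv_metric:
  assumes "p \<in> H2R"
  shows "matrix_inv (metric p) = (\<chi> i j. if i \<noteq> j then 0 else if i = 3 then 1 else (p $ 2)\<^sup>2)"
    (is "_ = ?B")
proof -
  have "p $ 2 \<noteq> 0" using assms by (simp add: H2R_def)
  then have inv: "metric p ** ?B = mat 1" "?B ** metric p = mat 1"
    by (simp_all add: metric_def matrix_matrix_mult_def mat_def vec_eq_iff sum_3 forall_3)
  have "matrix_inv (metric p) ** metric p = mat 1"
    unfolding matrix_inv_def by (rule someI2[of _ ?B]) (use inv in auto)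
  moreover have "matrix_inv (metric p) = matrix_inv (metric p) ** (metric p ** ?B)"
    using inv by simp
  ultimately show ?thesis by (simp only: matrix_mul_assoc matrix_mul_lid)
qed

lemma metric_deriv_eq:
  assumes "p \<in> H2R"
  shows "metric_deriv p k i j = (if i = j \<and> i \<noteq> 3 \<and> k = 2 then - 2 / (p $ 2)^3 else 0)"
proof (cases "i = j \<and> i \<noteq> 3")
  case False
  then have "(\<lambda>q. metric q $ i $ j) = (\<lambda>q. if i = j then 1 else 0)"
    by (auto simp: metric_def)
  then show ?thesis using False unfolding metric_deriv_def by auto
next
  case True
  have nz: "p $ 2 \<noteq> 0" using assms by (simp add: H2R_def)
  have eq: "(\<lambda>q. metric q $ i $ j) = (\<lambda>q. 1 / (q $ 2)\<^sup>2)"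
    using True by (auto simp: metric_def)
  have "((\<lambda>q::real^3. 1 / (q $ 2)\<^sup>2) has_derivative (\<lambda>h. - 2 * h $ 2 / (p $ 2)^3)) (at p)"
    using nz by (auto intro!: derivative_eq_intros bounded_linear.has_derivative[OF bounded_linear_vec_nth] simp: fun_eq_iff field_simps power2_eq_square power3_eq_cube)
  then have "frechet_derivative (\<lambda>q::real^3. 1 / (q $ 2)\<^sup>2) (at p) = (\<lambda>h. - 2 * h $ 2 / (p $ 2)^3)"
    by (rule frechet_derivative_at[symmetric])
  then show ?thesis using True unfolding metric_deriv_def eq by (auto simp: axis_def)
qed

text \<open>The nonzero Christoffel symbols are those of the hyperbolic plane; the \<open>z\<close>-direction is a flat factor.\<close>

lemma christoffel_contraction:
  assumes p: "p \<in> H2R"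
  shows "(\<chi> k. \<Sum>i\<in>UNIV. \<Sum>j\<in>UNIV. christoffel p k i j * v $ i * w $ j) =
    vector [- (v $ 1 * w $ 2 + v $ 2 * w $ 1) / p $ 2, (v $ 1 * w $ 1 - v $ 2 * w $ 2) / p $ 2, 0]"
proof -
  have nz: "p $ 2 \<noteq> 0" using p by (simp add: H2R_def)
  show ?thesis
    unfolding christoffel_def matrix_inv_metric[OF p] metric_deriv_eq[OF p]
    using nz by (simp add: vec_eq_iff forall_3 sum_3 field_simps power2_eq_square power3_eq_cube)
qed

section \<open>Surfaces whose normal is orthogonal to the parabolic direction\<close>

lemma frechet_derivative_eqI: "(f has_derivative f') (at x) \<Longrightarrow> frechet_derivative f (at x) = f'"
  by (rule frechet_derivative_at[symmetric])

lemma has_derivative_vec_nth [derivative_intros]: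
  "(f has_derivative f') F \<Longrightarrow> ((\<lambda>x. f x $ i) has_derivative (\<lambda>h. f' h $ i)) F"
  by (rule bounded_linear.has_derivative[OF bounded_linear_vec_nth])

text \<open>The vectors \<open>y \<partial>\<^sub>x\<close> and \<open>(0, y C, S)\<close> form an orthonormal frame of the tangent plane when the
  normal is \<open>(0, - y S, C)\<close>; \<open>\<xi>\<close> and \<open>a\<close> are the dual coframe.  The first two conclusions say that
  \<open>du\<close> and \<open>dz\<close> are the multiples of \<open>a\<close> by \<open>C\<close> and \<open>S\<close>.\<close>

lemma first_form_parabolic:
  fixes X :: "real \<times> real \<Rightarrow> real^3"
  assumes X: "(X has_derivative X') (at p)"
    and pos: "X p $ 2 > 0"
    and norm: "C\<^sup>2 + S\<^sup>2 = 1"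
    and orth: "\<And>v. S * X' v $ 2 = C * X' v $ 3 * X p $ 2"
  defines "a \<equiv> \<lambda>v. C * X' v $ 2 / X p $ 2 + S * X' v $ 3"
  defines "\<xi> \<equiv> \<lambda>v. X' v $ 1 / X p $ 2"
  shows "X' v $ 2 / X p $ 2 = C * a v" "X' v $ 3 = S * a v"
    "first_form X p v w = \<xi> v * \<xi> w + a v * a w"
proof -
  have z: "S * (X' v $ 2 / X p $ 2) = C * X' v $ 3" for v
    using orth[of v] pos by (simp add: field_simps)
  have y': "X' v $ 2 / X p $ 2 = C * a v" for v
  proof -
    have "C * a v = C\<^sup>2 * (X' v $ 2 / X p $ 2) + S * (C * X' v $ 3)"
      by (simp add: a_def power2_eq_square algebra_simps)
    also have "\<dots> = (C\<^sup>2 + S\<^sup>2) * (X' v $ 2 / X p $ 2)"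
      unfolding z[symmetric] by (simp add: power2_eq_square add_divide_distrib algebra_simps)
    finally show ?thesis using norm by simp
  qed
  have z': "X' v $ 3 = S * a v" for v
  proof -
    have "S * a v = C * (S * (X' v $ 2 / X p $ 2)) + S\<^sup>2 * X' v $ 3"
      by (simp add: a_def power2_eq_square algebra_simps)
    also have "\<dots> = (C\<^sup>2 + S\<^sup>2) * X' v $ 3"
      unfolding z by (simp add: power2_eq_square algebra_simps)
    finally show ?thesis using norm by simp
  qed
  show "X' v $ 2 / X p $ 2 = C * a v" "X' v $ 3 = S * a v" by (fact y' z')+
  have "first_form X p v w = \<xi> v * \<xi> w + (X' v $ 2 / X p $ 2) * (X' w $ 2 / X p $ 2) + X' v $ 3 * X' w $ 3"
    by (simp add: first_form_def metric_inner_eq frechet_derivative_eqI[OF X] \<xi>_def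
        power2_eq_square add_divide_distrib)
  also have "\<dots> = \<xi> v * \<xi> w + (C\<^sup>2 + S\<^sup>2) * (a v * a w)"
    unfolding y' z' by (simp add: power2_eq_square algebra_simps)
  finally show "first_form X p v w = \<xi> v * \<xi> w + a v * a w" using norm by simp
qed

text \<open>The term with the second derivatives of \<open>X\<close> is eliminated by differentiation of the orthogonality relation, as in
  the Weingarten equation.  With \<open>\<theta>\<close> the angle of \<open>(C, S)\<close> and the coframe of \<open>first_form_parabolic\<close>,
  the right-hand side is \<open>d\<theta>(v) a(w) - S \<xi>(v) \<xi>(w)\<close>: the last term is the curvature of the horocycles.\<close>

lemma second_form_parabolic:
  fixes X :: "real \<times> real \<Rightarrow> real^3"
  assumes U: "open U" "p \<in> U"
    and X: "\<And>q. q \<in> U \<Longrightarrow> (X has_derivative X' q) (at q)"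
    and X'': "\<And>v. ((\<lambda>q. X' q v) has_derivative X'' v) (at p)"
    and pos: "\<And>q. q \<in> U \<Longrightarrow> X q $ 2 > 0"
    and orth: "\<And>q v. q \<in> U \<Longrightarrow> S q * X' q v $ 2 = C q * X' q v $ 3 * X q $ 2"
    and C: "(C has_derivative C') (at p)"
    and S: "(S has_derivative S') (at p)"
  shows "second_form X (vector [0, - X p $ 2 * S p, C p]) p v w =
    S' v * (X' p w $ 2 / X p $ 2) - C' v * X' p w $ 3
      - S p * (X' p v $ 1 / X p $ 2) * (X' p w $ 1 / X p $ 2)"
proof -
  let ?y = "X p $ 2"
  have y: "?y > 0" using pos U by simp
  have l: "((\<lambda>q. S q * X' q w $ 2) has_derivative (\<lambda>v. S p * X'' w v $ 2 + S' v * X' p w $ 2)) (at p)"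
    by (auto intro!: derivative_eq_intros S X'')
  have r: "((\<lambda>q. C q * X' q w $ 3 * X q $ 2) has_derivative
      (\<lambda>v. C p * X' p w $ 3 * X' p v $ 2 + (C p * X'' w v $ 3 + C' v * X' p w $ 3) * ?y)) (at p)"
    by (auto intro!: derivative_eq_intros C X'' X U)
  have r': "((\<lambda>q. S q * X' q w $ 2) has_derivative
      (\<lambda>v. C p * X' p w $ 3 * X' p v $ 2 + (C p * X'' w v $ 3 + C' v * X' p w $ 3) * ?y)) (at p)"
    by (rule has_derivative_transform_within_open[OF r U]) (use orth in auto)
  have "(\<lambda>v. S p * X'' w v $ 2 + S' v * X' p w $ 2) =
      (\<lambda>v. C p * X' p w $ 3 * X' p v $ 2 + (C p * X'' w v $ 3 + C' v * X' p w $ 3) * ?y)"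
    by (rule has_derivative_unique[OF l r'])
  then have d: "S p * X'' w v $ 2 + S' v * X' p w $ 2 =
      C p * X' p w $ 3 * X' p v $ 2 + (C p * X'' w v $ 3 + C' v * X' p w $ 3) * ?y"
    by meson
  have o: "S p * X' p w $ 2 = C p * X' p w $ 3 * ?y"
    using orth U by simp
  have "((\<lambda>q. frechet_derivative X (at q) w) has_derivative X'' w) (at p)"
    by (rule has_derivative_transform_within_open[OF X''[of w] U])
      (simp add: frechet_derivative_eqI[OF X])
  then have cov: "covariant_deriv X p v w = X'' w v +
      vector [- (X' p v $ 1 * X' p w $ 2 + X' p v $ 2 * X' p w $ 1) / ?y,
              (X' p v $ 1 * X' p w $ 1 - X' p v $ 2 * X' p w $ 2) / ?y, 0]"
    unfolding covariant_deriv_def using y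
    by (simp add: frechet_derivative_eqI[OF X[OF U(2)]] frechet_derivative_eqI
        christoffel_contraction H2R_def)
  have "second_form X (vector [0, - ?y * S p, C p]) p v w =
      - ?y * S p * (X'' w v $ 2 + (X' p v $ 1 * X' p w $ 1 - X' p v $ 2 * X' p w $ 2) / ?y) / ?y\<^sup>2
      + C p * X'' w v $ 3"
    unfolding second_form_def cov by (simp add: metric_inner_eq)
  also have "\<dots> = (C p * X'' w v $ 3 * ?y - S p * X'' w v $ 2) / ?y
      + (S p * X' p w $ 2) * X' p v $ 2 / ?y\<^sup>2 - S p * (X' p v $ 1 / ?y) * (X' p w $ 1 / ?y)"
    using y by (simp add: field_simps power2_eq_square)
  also have "C p * X'' w v $ 3 * ?y - S p * X'' w v $ 2 =
      S' v * X' p w $ 2 - C p * X' p w $ 3 * X' p v $ 2 - C' v * X' p w $ 3 * ?y"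
    using d by (simp add: algebra_simps)
  also have "(S' v * X' p w $ 2 - C p * X' p w $ 3 * X' p v $ 2 - C' v * X' p w $ 3 * ?y) / ?y
      + (S p * X' p w $ 2) * X' p v $ 2 / ?y\<^sup>2 - S p * (X' p v $ 1 / ?y) * (X' p w $ 1 / ?y)
    = S' v * (X' p w $ 2 / ?y) - C' v * X' p w $ 3 - S p * (X' p v $ 1 / ?y) * (X' p w $ 1 / ?y)"
    unfolding o using y by (simp add: field_simps power2_eq_square)
  finally show ?thesis .
qed

text \<open>Half the trace of \<open>\<theta> \<otimes> a - S \<xi> \<otimes> \<xi>\<close> with respect to the orthonormal coframe
  \<open>(\<xi>, a)\<close>: the first term contributes the \<open>a\<close>-component of \<open>\<theta>\<close>, which Cramer's rule writes as a
  quotient of two determinants, and the second term contributes \<open>- S\<close>.\<close>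

lemma mean_curvature_rank_two:
  fixes \<xi> a \<theta> :: "real \<times> real \<Rightarrow> real" and S :: real
  assumes I: "\<And>v w. first_form X p v w = \<xi> v * \<xi> w + a v * a w"
    and II: "\<And>v w. second_form X n p v w = \<theta> v * a w - S * \<xi> v * \<xi> w"
  defines "D \<equiv> \<xi> (1, 0) * a (0, 1) - \<xi> (0, 1) * a (1, 0)"
  assumes D: "D \<noteq> 0"
  shows "mean_curvature X n p = ((\<xi> (1, 0) * \<theta> (0, 1) - \<xi> (0, 1) * \<theta> (1, 0)) / D - S) / 2"
proof -
  define x1 x2 a1 a2 t1 t2 where defs: "x1 = \<xi> (1, 0)" "x2 = \<xi> (0, 1)" "a1 = a (1, 0)"
    "a2 = a (0, 1)" "t1 = \<theta> (1, 0)" "t2 = \<theta> (0, 1)"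
  have D_eq: "D = x1 * a2 - x2 * a1" by (simp add: D_def defs)
  have det: "(x1 * x1 + a1 * a1) * (x2 * x2 + a2 * a2) - (x1 * x2 + a1 * a2)\<^sup>2 = D * D"
    by (simp add: D_eq power2_eq_square algebra_simps)
  have num: "(x2 * x2 + a2 * a2) * (t1 * a1 - S * x1 * x1)
      - (x1 * x2 + a1 * a2) * ((t1 * a2 - S * x1 * x2) + (t2 * a1 - S * x2 * x1))
      + (x1 * x1 + a1 * a1) * (t2 * a2 - S * x2 * x2)
      = D * (x1 * t2 - x2 * t1) - S * (D * D)"
    by (simp add: D_eq algebra_simps)
  have "mean_curvature X n p = (D * (x1 * t2 - x2 * t1) - S * (D * D)) / (2 * (D * D))"
    unfolding mean_curvature_def Let_def I II
    by (simp only: defs[symmetric] num det)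
  also have "\<dots> = ((x1 * t2 - x2 * t1) / D - S) / 2"
    using D by (simp add: field_simps)
  finally show ?thesis by (simp only: defs)
qed

lemma linear_real_pair:
  fixes f :: "real \<times> real \<Rightarrow> real"
  assumes "linear f"
  shows "f v = fst v * f (1, 0) + snd v * f (0, 1)"
proof -
  have "f v = f (fst v *\<^sub>R (1, 0) + snd v *\<^sub>R (0, 1))" by simp
  then show ?thesis by (simp only: linear_add[OF assms] linear_cmul[OF assms]) simp
qed

text \<open>The curvature equation determines only the \<open>a\<close>-component of \<open>d\<theta>\<close>.  That the \<open>\<xi>\<close>-component vanishes,
  i.e. that the angle is constant along the orbits, follows from the symmetry of the second fundamental form, which says that
  \<open>d\<theta>\<close> and \<open>a\<close> are proportional.\<close>

lemma translator_angle_system: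
  fixes X :: "real \<times> real \<Rightarrow> real^3"
  assumes U: "open U" "p \<in> U"
    and X: "\<And>q. q \<in> U \<Longrightarrow> (X has_derivative X' q) (at q)"
    and X'': "\<And>q v. q \<in> U \<Longrightarrow> ((\<lambda>q. X' q v) has_derivative X'' v q) (at q)"
    and cont: "\<And>v w. continuous_on U (\<lambda>q. X'' v q w)"
    and inj: "inj (X' p)"
    and pos: "\<And>q. q \<in> U \<Longrightarrow> X q $ 2 > 0"
    and norm: "\<And>q. q \<in> U \<Longrightarrow> (C q)\<^sup>2 + (S q)\<^sup>2 = 1"
    and orth: "\<And>q v. q \<in> U \<Longrightarrow> S q * X' q v $ 2 = C q * X' q v $ 3 * X q $ 2"
    and C: "(C has_derivative C') (at p)"
    and S: "(S has_derivative S') (at p)"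
    and H: "mean_curvature X (vector [0, - X p $ 2 * S p, C p]) p = C p"
  shows "C' v = - (2 * C p + S p) * X' p v $ 3"
    and "S' v = (2 * C p + S p) * (X' p v $ 2 / X p $ 2)"
proof -
  let ?y = "X p $ 2" and ?n = "vector [0, - X p $ 2 * S p, C p] :: real^3"
  define a where "a = (\<lambda>v. C p * X' p v $ 2 / ?y + S p * X' p v $ 3)"
  define \<xi> where "\<xi> = (\<lambda>v. X' p v $ 1 / ?y)"
  define \<theta> where "\<theta> = (\<lambda>v. C p * S' v - S p * C' v)"
  have y: "?y > 0" using pos U by simp
  have lX: "linear (X' p)" using X[OF U(2)] by (rule has_derivative_linear)
  have lC: "linear C'" "linear S'" using C S has_derivative_linear by blast+
  have ff: "X' p v $ 2 / ?y = C p * a v" "X' p v $ 3 = S p * a v"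
    "first_form X p v w = \<xi> v * \<xi> w + a v * a w" for v w
    unfolding a_def \<xi>_def
    by (rule first_form_parabolic[OF X[OF U(2)] y norm[OF U(2)] orth[OF U(2)]])+
  have "((\<lambda>q. (C q)\<^sup>2 + (S q)\<^sup>2) has_derivative (\<lambda>v. 2 * C p * C' v + 2 * S p * S' v)) (at p)"
    by (auto intro!: derivative_eq_intros C S)
  moreover have "((\<lambda>q. (C q)\<^sup>2 + (S q)\<^sup>2) has_derivative (\<lambda>v. 0)) (at p)"
    by (rule has_derivative_transform_within_open[OF has_derivative_const U]) (use norm in auto)
  ultimately have rot2: "(\<lambda>v. 2 * C p * C' v + 2 * S p * S' v) = (\<lambda>v. 0)"
    by (rule has_derivative_unique)
  have rot: "C p * C' v + S p * S' v = 0" for v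
    using fun_cong[OF rot2, of v] by simp
  have C'\<theta>: "C' v = - S p * \<theta> v" and S'\<theta>: "S' v = C p * \<theta> v" for v
  proof -
    have n: "C p * C p + S p * S p = 1" using norm[OF U(2)] by (simp add: power2_eq_square)
    have "- S p * \<theta> v = (C p * C p + S p * S p) * C' v - C p * (C p * C' v + S p * S' v)"
      by (simp add: \<theta>_def algebra_simps)
    then show "C' v = - S p * \<theta> v" by (simp add: n rot)
    have "C p * \<theta> v = (C p * C p + S p * S p) * S' v - S p * (C p * C' v + S p * S' v)"
      by (simp add: \<theta>_def algebra_simps)
    then show "S' v = C p * \<theta> v" by (simp add: n rot)
  qed
  have II: "second_form X ?n p v w = \<theta> v * a w - S p * \<xi> v * \<xi> w" for v w
  proof -
    have "second_form X ?n p v w = S' v * (X' p w $ 2 / ?y) - C' v * X' p w $ 3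
        - S p * (X' p v $ 1 / ?y) * (X' p w $ 1 / ?y)"
      by (rule second_form_parabolic[OF U X X''[OF U(2)] pos orth C S])
    also have "\<dots> = S' v * (C p * a w) - C' v * (S p * a w) - S p * \<xi> v * \<xi> w"
      unfolding ff(1,2) by (simp only: \<xi>_def)
    also have "\<dots> = \<theta> v * a w - S p * \<xi> v * \<xi> w"
      by (simp add: \<theta>_def left_diff_distrib)
    finally show ?thesis .
  qed
  \<comment> \<open>Symmetry of the second fundamental form, from that of the second derivatives.\<close>
  have X''_sym: "X'' v p w $ i = X'' w p v $ i" for v w i
    by (rule mixed_derivatives_commute[OF U, where f = "\<lambda>q. X q $ i" and f' = "\<lambda>q v. X' q v $ i"
          and f'' = "\<lambda>v q w. X'' v q w $ i"])
      (auto intro!: derivative_intros X X'' bounded_linear.continuous_on[OF bounded_linear_vec_nth] cont)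
  have sym: "\<theta> v * a w = \<theta> w * a v" for v w
  proof -
    have *: "frechet_derivative (\<lambda>q. frechet_derivative X (at q) w) (at p) v = X'' w p v" for v w
    proof -
      have "((\<lambda>q. frechet_derivative X (at q) w) has_derivative X'' w p) (at p)"
        by (rule has_derivative_transform_within_open[OF X''[OF U(2), of w] U])
          (simp add: frechet_derivative_eqI[OF X])
      then show ?thesis by (simp add: frechet_derivative_eqI)
    qed
    have "covariant_deriv X p v w = covariant_deriv X p w v"
    proof -
      have "X p \<in> H2R" using y by (simp add: H2R_def)
      then show ?thesis
        unfolding covariant_deriv_def * christoffel_contraction[OF \<open>X p \<in> H2R\<close>]
        by (simp add: vec_eq_iff forall_3 X''_sym[of v w] algebra_simps)
    qed
    then have "second_form X ?n p v w = second_form X ?n p w v" by (simp add: second_form_def)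
    then show ?thesis unfolding II by simp
  qed
  define D where "D = \<xi> (1, 0) * a (0, 1) - \<xi> (0, 1) * a (1, 0)"
  have la: "linear a" "linear \<xi>"
    unfolding a_def \<xi>_def
    by (rule linearI; simp add: linear_add[OF lX] linear_cmul[OF lX] add_divide_distrib algebra_simps)+
  \<comment> \<open>An immersion has a nondegenerate coframe: a vector killed by \<open>\<xi>\<close> and \<open>a\<close> is killed by \<open>X'\<close>.\<close>
  have D0: "D \<noteq> 0"
  proof
    assume "D = 0"
    have ker: "v = 0" if "\<xi> v = 0" "a v = 0" for v
    proof -
      have "X' p v $ 1 = 0" "X' p v $ 2 = 0" "X' p v $ 3 = 0"
        using that ff(1)[of v] ff(2)[of v] y by (auto simp: \<xi>_def)
      then have "X' p v = 0" by (simp add: vec_eq_iff forall_3)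
      then show ?thesis using inj lX by (metis injD linear_0)
    qed
    have "\<xi> (\<xi> (0, 1), - \<xi> (1, 0)) = 0"
      by (subst linear_real_pair[OF la(2)]) simp
    moreover have "a (\<xi> (0, 1), - \<xi> (1, 0)) = 0"
      using \<open>D = 0\<close> by (subst linear_real_pair[OF la(1)]) (simp add: D_def algebra_simps)
    ultimately have "(\<xi> (0, 1), - \<xi> (1, 0)) = 0" by (rule ker)
    then have x0: "\<xi> (0, 1) = 0" "\<xi> (1, 0) = 0" by (simp_all add: zero_prod_def)
    have "a (a (0, 1), - a (1, 0)) = 0"
      by (subst linear_real_pair[OF la(1)]) simp
    moreover have "\<xi> (a (0, 1), - a (1, 0)) = 0"
      by (subst linear_real_pair[OF la(2)]) (simp add: x0)
    ultimately have "(a (0, 1), - a (1, 0)) = 0" by (intro ker)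
    then have "a (0, 1) = 0" by (simp add: zero_prod_def)
    with x0(1) have "(0, 1) = (0 :: real \<times> real)" by (rule ker)
    then show False by (simp add: zero_prod_def)
  qed
  have "((\<xi> (1, 0) * \<theta> (0, 1) - \<xi> (0, 1) * \<theta> (1, 0)) / D - S p) / 2 = C p"
    using mean_curvature_rank_two[OF ff(3) II, folded D_def] D0 H by simp
  then have key: "\<xi> (1, 0) * \<theta> (0, 1) - \<xi> (0, 1) * \<theta> (1, 0) = (2 * C p + S p) * D"
    using D0 by (simp add: field_simps)
  have "\<theta> (1, 0) * D = (2 * C p + S p) * a (1, 0) * D"
  proof -
    have "\<theta> (1, 0) * D = \<xi> (1, 0) * (\<theta> (1, 0) * a (0, 1)) - \<theta> (1, 0) * \<xi> (0, 1) * a (1, 0)"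
      by (simp add: D_def algebra_simps)
    also have "\<dots> = (\<xi> (1, 0) * \<theta> (0, 1) - \<xi> (0, 1) * \<theta> (1, 0)) * a (1, 0)"
      unfolding sym[of "(1, 0)" "(0, 1)"] by (simp add: algebra_simps)
    finally show ?thesis unfolding key by (simp add: algebra_simps)
  qed
  moreover have "\<theta> (0, 1) * D = (2 * C p + S p) * a (0, 1) * D"
  proof -
    have "\<theta> (0, 1) * D = \<xi> (1, 0) * \<theta> (0, 1) * a (0, 1) - \<xi> (0, 1) * (\<theta> (0, 1) * a (1, 0))"
      by (simp add: D_def algebra_simps)
    also have "\<dots> = (\<xi> (1, 0) * \<theta> (0, 1) - \<xi> (0, 1) * \<theta> (1, 0)) * a (0, 1)"
      unfolding sym[of "(0, 1)" "(1, 0)"] by (simp add: algebra_simps)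
    finally show ?thesis unfolding key by (simp add: algebra_simps)
  qed
  ultimately have e: "\<theta> (1, 0) = (2 * C p + S p) * a (1, 0)" "\<theta> (0, 1) = (2 * C p + S p) * a (0, 1)"
    using D0 by simp_all
  have "linear \<theta>"
    unfolding \<theta>_def
    by (rule linearI; simp add: linear_add[OF lC(1)] linear_cmul[OF lC(1)]
        linear_add[OF lC(2)] linear_cmul[OF lC(2)] algebra_simps)
  then have \<theta>a: "\<theta> v = (2 * C p + S p) * a v" for v
    using linear_real_pair[of \<theta> v] linear_real_pair[OF la(1), of v] by (simp add: e algebra_simps)
  show "C' v = - (2 * C p + S p) * X' p v $ 3" "S' v = (2 * C p + S p) * (X' p v $ 2 / X p $ 2)"
    unfolding C'\<theta> S'\<theta> \<theta>a ff(1,2) by (simp_all add: algebra_simps)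
qed

section \<open>The angle functions of a parabolic grim reaper\<close>

lemma smooth_on_derivatives:
  assumes "smooth_on U X"
  shows smooth_on_has_derivative:
      "q \<in> U \<Longrightarrow> (X has_derivative frechet_derivative X (at q)) (at q)"
    and smooth_on_has_second_derivative:
      "q \<in> U \<Longrightarrow> ((\<lambda>q. frechet_derivative X (at q) v) has_derivative
         frechet_derivative (\<lambda>q. frechet_derivative X (at q) v) (at q)) (at q)"
    and smooth_on_continuous_second_derivative:
      "continuous_on U (\<lambda>q. frechet_derivative (\<lambda>q. frechet_derivative X (at q) v) (at q) w)"
    and smooth_on_continuous_derivative: "continuous_on U (\<lambda>q. frechet_derivative X (at q) v)"
proof -
  have "Ck_on (Suc (Suc 0)) U X" "Ck_on (Suc 0) U X"
    using assms unfolding smooth_on_def by blast+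
  then show "q \<in> U \<Longrightarrow> (X has_derivative frechet_derivative X (at q)) (at q)"
      "q \<in> U \<Longrightarrow> ((\<lambda>q. frechet_derivative X (at q) v) has_derivative
         frechet_derivative (\<lambda>q. frechet_derivative X (at q) v) (at q)) (at q)"
      "continuous_on U (\<lambda>q. frechet_derivative (\<lambda>q. frechet_derivative X (at q) v) (at q) w)"
      "continuous_on U (\<lambda>q. frechet_derivative X (at q) v)"
    by (simp_all add: frechet_derivative_works)
qed

text \<open>The curve \<open>c\<close> is only assumed continuous.  Since \<open>X\<close> is an immersion, \<open>c t - p\<close> is of order
  \<open>t\<close>, so the linear approximation of \<open>X (c t)\<close> has an error of smaller order than \<open>t\<close>, and \<open>e\<close> lies in the
  (closed) image of the derivative.  This is how a merely continuous group action yields a tangent direction.\<close>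

lemma immersion_tangent_to_line:
  fixes X :: "'a::euclidean_space \<Rightarrow> 'b::euclidean_space"
  assumes X: "(X has_derivative X') (at p)" and inj: "inj X'"
    and c: "(c \<longlongrightarrow> p) (at (0::real))"
    and line: "\<forall>\<^sub>F t in at 0. X (c t) = X p + t *\<^sub>R e"
  obtains v where "X' v = e"
proof -
  have lin: "linear X'" using X by (rule has_derivative_linear)
  obtain G where G: "linear G" and GX: "G \<circ> X' = id"
    using linear_injective_left_inverse[OF lin inj] by blast
  have GX': "G (X' v) = v" for v using GX by (simp add: fun_eq_iff)
  obtain K where K: "K > 0" and normG: "norm (G x) \<le> K * norm x" for x
    using linear_bounded_pos[OF G] by metis
  obtain B where B: "B > 0" and normX: "norm (X' x) \<le> B * norm x" for x
    using linear_bounded_pos[OF lin] by metis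
  define \<eta> where "\<eta> = e - X' (G e)"
  have "\<eta> = 0"
  proof (rule ccontr)
    assume "\<eta> \<noteq> 0"
    \<comment> \<open>\<open>norm \<eta>\<close> will be at most \<open>\<epsilon> R\<close>; the first bound on \<open>\<epsilon>\<close> gives \<open>norm (c t - p) = O(t)\<close>.\<close>
    define R where "R = 2 * K * (1 + B * K) * (norm e + 1)"
    have R: "R > 0" using K B by (auto simp: R_def intro!: mult_pos_pos add_pos_pos add_nonneg_pos)
    define \<epsilon> where "\<epsilon> = min (1 / (2 * K)) (norm \<eta> / (2 * R))"
    have \<epsilon>: "\<epsilon> > 0" using K R \<open>\<eta> \<noteq> 0\<close> by (simp add: \<epsilon>_def)
    obtain d where d: "d > 0"
      and small: "\<And>q. norm (q - p) < d \<Longrightarrow> norm (X q - X p - X' (q - p)) \<le> \<epsilon> * norm (q - p)"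
      using X \<epsilon> unfolding has_derivative_at_alt by blast
    have "\<forall>\<^sub>F t in at 0. dist (c t) p < d" using c d by (rule tendstoD)
    moreover have "\<forall>\<^sub>F t in at 0. t \<noteq> (0::real)"
      by (simp add: eventually_at_filter)
    ultimately have "\<forall>\<^sub>F t in at 0. X (c t) = X p + t *\<^sub>R e \<and> dist (c t) p < d \<and> t \<noteq> 0"
      using line by eventually_elim simp
    from eventually_happens'[OF at_neq_bot this]
    obtain t where t: "X (c t) = X p + t *\<^sub>R e" "dist (c t) p < d" "t \<noteq> 0"
      by blast
    define h where "h = c t - p"
    define r where "r = t *\<^sub>R e - X' h"
    have r: "norm r \<le> \<epsilon> * norm h"
      using small[of "c t"] t by (simp add: r_def h_def dist_norm)
    have "h = t *\<^sub>R G e - G r"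
      by (simp add: r_def linear_diff[OF G] linear_cmul[OF G] GX')
    then have "norm h \<le> \<bar>t\<bar> * norm (G e) + norm (G r)"
      by (metis norm_scaleR norm_triangle_ineq4)
    also have "\<dots> \<le> \<bar>t\<bar> * (K * norm e) + K * norm r"
      using normG[of e] normG[of r] by (intro add_mono mult_left_mono) auto
    also have "\<dots> \<le> \<bar>t\<bar> * (K * norm e) + K * (\<epsilon> * norm h)"
      using r K by (intro add_mono mult_left_mono) auto
    also have "K * (\<epsilon> * norm h) \<le> norm h / 2"
    proof -
      have "K * \<epsilon> \<le> K * (1 / (2 * K))" using K by (intro mult_left_mono) (auto simp: \<epsilon>_def)
      then have "K * \<epsilon> \<le> 1 / 2" using K by simp
      then have "K * \<epsilon> * norm h \<le> 1 / 2 * norm h" by (rule mult_right_mono) simp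
      then show ?thesis by simp
    qed
    finally have h: "norm h \<le> \<bar>t\<bar> * (2 * K * norm e)" by (simp add: algebra_simps)
    have "t *\<^sub>R \<eta> = r - X' (G r)"
      by (simp add: \<eta>_def r_def linear_diff[OF G] linear_cmul[OF G] linear_diff[OF lin]
          linear_cmul[OF lin] GX' algebra_simps)
    then have "\<bar>t\<bar> * norm \<eta> \<le> norm r + norm (X' (G r))"
      by (metis norm_scaleR norm_triangle_ineq4)
    also have "norm (X' (G r)) \<le> B * (K * norm r)"
      using normX[of "G r"] normG[of r] B by (meson mult_left_mono order_trans less_imp_le)
    also have "norm r + B * (K * norm r) = (1 + B * K) * norm r" by (simp add: algebra_simps)
    also have "\<dots> \<le> (1 + B * K) * (\<epsilon> * (\<bar>t\<bar> * (2 * K * norm e)))"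
      using r h \<epsilon> B K by (intro mult_left_mono) (auto intro: order_trans mult_left_mono)
    also have "\<dots> \<le> \<bar>t\<bar> * (\<epsilon> * R)"
    proof -
      have "(1 + B * K) * (2 * K * norm e) \<le> R"
        using B K by (simp add: R_def algebra_simps)
      then have "\<bar>t\<bar> * \<epsilon> * ((1 + B * K) * (2 * K * norm e)) \<le> \<bar>t\<bar> * \<epsilon> * R"
        using \<epsilon> by (intro mult_left_mono) auto
      then show ?thesis by (simp add: algebra_simps)
    qed
    finally have "norm \<eta> \<le> \<epsilon> * R" using t(3) by simp
    also have "\<dots> \<le> norm \<eta> / (2 * R) * R" using R by (intro mult_right_mono) (auto simp: \<epsilon>_def)
    also have "\<dots> < norm \<eta>" using R \<open>\<eta> \<noteq> 0\<close> by simp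
    finally show False by simp
  qed
  then show thesis using that[of "G e"] by (simp add: \<eta>_def)
qed

lemma parabolic_translation_eq: "parabolic_translation t q = q + t *\<^sub>R axis 1 1"
  by (simp add: parabolic_translation_def vec_eq_iff forall_3 axis_def)

text \<open>The translator equation as a first-order system.  The pair \<open>(C, S)\<close> stands for a choice of unit normal
  \<open>(0, - y S, C)\<close>; the system is invariant under a simultaneous change of their signs, so that the orientation can be
  chosen after the integration.\<close>

definition angle_functions ::
    "((real \<times> real) set \<times> (real \<times> real \<Rightarrow> 'a)) set \<Rightarrow> ('a \<Rightarrow> real^3) \<Rightarrow> ('a \<Rightarrow> real) \<Rightarrow> ('a \<Rightarrow> real) \<Rightarrow> bool" where
  "angle_functions A F C S \<longleftrightarrow>
     (\<forall>(U, \<phi>)\<in>A. \<forall>p\<in>U.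
        (C (\<phi> p))\<^sup>2 + (S (\<phi> p))\<^sup>2 = 1 \<and>
        (\<forall>v. S (\<phi> p) * frechet_derivative (F \<circ> \<phi>) (at p) v $ 2 =
              C (\<phi> p) * frechet_derivative (F \<circ> \<phi>) (at p) v $ 3 * F (\<phi> p) $ 2) \<and>
        ((C \<circ> \<phi>) has_derivative (\<lambda>v. - (2 * C (\<phi> p) + S (\<phi> p)) *
              frechet_derivative (F \<circ> \<phi>) (at p) v $ 3)) (at p) \<and>
        ((S \<circ> \<phi>) has_derivative (\<lambda>v. (2 * C (\<phi> p) + S (\<phi> p)) *
              (frechet_derivative (F \<circ> \<phi>) (at p) v $ 2 / F (\<phi> p) $ 2))) (at p))"

lemma angle_functionsD:
  assumes "angle_functions A F C S" "(U, \<phi>) \<in> A" "p \<in> U"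
  shows "(C (\<phi> p))\<^sup>2 + (S (\<phi> p))\<^sup>2 = 1"
    and "S (\<phi> p) * frechet_derivative (F \<circ> \<phi>) (at p) v $ 2 =
              C (\<phi> p) * frechet_derivative (F \<circ> \<phi>) (at p) v $ 3 * F (\<phi> p) $ 2"
    and "((C \<circ> \<phi>) has_derivative (\<lambda>v. - (2 * C (\<phi> p) + S (\<phi> p)) *
              frechet_derivative (F \<circ> \<phi>) (at p) v $ 3)) (at p)"
    and "((S \<circ> \<phi>) has_derivative (\<lambda>v. (2 * C (\<phi> p) + S (\<phi> p)) *
              (frechet_derivative (F \<circ> \<phi>) (at p) v $ 2 / F (\<phi> p) $ 2))) (at p)"
  using bspec[OF assms(1)[unfolded angle_functions_def] assms(2)] assms(3)
  unfolding prod.case by blast+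

lemma angle_functionsI:
  assumes "\<And>U \<phi> p. (U, \<phi>) \<in> A \<Longrightarrow> p \<in> U \<Longrightarrow> (C (\<phi> p))\<^sup>2 + (S (\<phi> p))\<^sup>2 = 1"
    and "\<And>U \<phi> p v. (U, \<phi>) \<in> A \<Longrightarrow> p \<in> U \<Longrightarrow>
          S (\<phi> p) * frechet_derivative (F \<circ> \<phi>) (at p) v $ 2 =
          C (\<phi> p) * frechet_derivative (F \<circ> \<phi>) (at p) v $ 3 * F (\<phi> p) $ 2"
    and "\<And>U \<phi> p. (U, \<phi>) \<in> A \<Longrightarrow> p \<in> U \<Longrightarrow>
          ((C \<circ> \<phi>) has_derivative (\<lambda>v. - (2 * C (\<phi> p) + S (\<phi> p)) *
              frechet_derivative (F \<circ> \<phi>) (at p) v $ 3)) (at p)"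
    and "\<And>U \<phi> p. (U, \<phi>) \<in> A \<Longrightarrow> p \<in> U \<Longrightarrow>
          ((S \<circ> \<phi>) has_derivative (\<lambda>v. (2 * C (\<phi> p) + S (\<phi> p)) *
              (frechet_derivative (F \<circ> \<phi>) (at p) v $ 2 / F (\<phi> p) $ 2))) (at p)"
  shows "angle_functions A F C S"
  unfolding angle_functions_def
proof
  fix x assume x: "x \<in> A"
  obtain U \<phi> where "x = (U, \<phi>)" by (cases x)
  with x assms show "case x of (U, \<phi>) \<Rightarrow> \<forall>p\<in>U.
        (C (\<phi> p))\<^sup>2 + (S (\<phi> p))\<^sup>2 = 1 \<and>
        (\<forall>v. S (\<phi> p) * frechet_derivative (F \<circ> \<phi>) (at p) v $ 2 =
              C (\<phi> p) * frechet_derivative (F \<circ> \<phi>) (at p) v $ 3 * F (\<phi> p) $ 2) \<and>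
        ((C \<circ> \<phi>) has_derivative (\<lambda>v. - (2 * C (\<phi> p) + S (\<phi> p)) *
              frechet_derivative (F \<circ> \<phi>) (at p) v $ 3)) (at p) \<and>
        ((S \<circ> \<phi>) has_derivative (\<lambda>v. (2 * C (\<phi> p) + S (\<phi> p)) *
              (frechet_derivative (F \<circ> \<phi>) (at p) v $ 2 / F (\<phi> p) $ 2))) (at p)"
    unfolding \<open>x = (U, \<phi>)\<close> prod.case by blast
qed

text \<open>The opposite normal.\<close>

lemma angle_functions_uminus:
  assumes "angle_functions A F C S"
  shows "angle_functions A F (\<lambda>m. - C m) (\<lambda>m. - S m)"
proof -
  have "((\<lambda>m. - C m) \<circ> \<phi> has_derivative (\<lambda>v. - (2 * - C (\<phi> p) + - S (\<phi> p)) *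
              frechet_derivative (F \<circ> \<phi>) (at p) v $ 3)) (at p)"
    "((\<lambda>m. - S m) \<circ> \<phi> has_derivative (\<lambda>v. (2 * - C (\<phi> p) + - S (\<phi> p)) *
              (frechet_derivative (F \<circ> \<phi>) (at p) v $ 2 / F (\<phi> p) $ 2))) (at p)"
    if "(U, \<phi>) \<in> A" "p \<in> U" for U \<phi> p
    using has_derivative_eq_rhs[OF has_derivative_minus[OF angle_functionsD(3)[OF assms that]]]
      has_derivative_eq_rhs[OF has_derivative_minus[OF angle_functionsD(4)[OF assms that]]]
    by (simp_all add: o_def fun_eq_iff algebra_simps diff_divide_distrib add_divide_distrib)
  then show ?thesis
    by (intro angle_functionsI) (simp_all only: angle_functionsD(1,2)[OF assms] power2_minus mult_minus_left)
qed

lemma immersed_surface_chart: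
  assumes "immersed_surface M A F" "(U, \<phi>) \<in> A"
  shows chart_open: "open U"
    and chart_image_open: "openin M (\<phi> ` U)"
    and chart_homeomorphic: "homeomorphic_map (top_of_set U) (subtopology M (\<phi> ` U)) \<phi>"
    and chart_smooth: "smooth_on U (F \<circ> \<phi>)"
    and chart_immersion: "p \<in> U \<Longrightarrow> inj (frechet_derivative (F \<circ> \<phi>) (at p))"
    and chart_in_topspace: "p \<in> U \<Longrightarrow> \<phi> p \<in> topspace M"
    and chart_in_H2R: "p \<in> U \<Longrightarrow> F (\<phi> p) $ 2 > 0"
proof -
  have "local_param M F U \<phi>" and F: "F ` topspace M \<subseteq> H2R"
    using assms unfolding immersed_surface_def by blast+
  then show "open U" "openin M (\<phi> ` U)" "homeomorphic_map (top_of_set U) (subtopology M (\<phi> ` U)) \<phi>"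
    "smooth_on U (F \<circ> \<phi>)" "p \<in> U \<Longrightarrow> inj (frechet_derivative (F \<circ> \<phi>) (at p))"
    by (auto simp: local_param_def)
  then have "\<phi> ` U \<subseteq> topspace M" by (simp add: openin_subset)
  moreover from this have "F ` \<phi> ` U \<subseteq> H2R" using F by blast
  ultimately show "p \<in> U \<Longrightarrow> \<phi> p \<in> topspace M" "p \<in> U \<Longrightarrow> F (\<phi> p) $ 2 > 0"
    by (auto simp: H2R_def)
qed

lemma immersed_surface_covered:
  assumes "immersed_surface M A F" "m \<in> topspace M"
  obtains U \<phi> p where "(U, \<phi>) \<in> A" "p \<in> U" "m = \<phi> p"
  using assms by (auto simp: immersed_surface_def)

lemma chart_open_image:
  assumes "immersed_surface M A F" "(U, \<phi>) \<in> A" "open B" "B \<subseteq> U"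
  shows "openin M (\<phi> ` B)"
proof -
  have "open_map (top_of_set U) (subtopology M (\<phi> ` U)) \<phi>"
    using chart_homeomorphic[OF assms(1,2)] homeomorphic_imp_open_map by blast
  moreover have "openin (top_of_set U) B"
    using assms(3,4) by (simp add: openin_open_eq chart_open[OF assms(1,2)])
  ultimately have "openin (subtopology M (\<phi> ` U)) (\<phi> ` B)"
    by (simp add: open_map_def)
  then show ?thesis
    using chart_image_open[OF assms(1,2)] by (simp add: openin_open_subtopology)
qed

text \<open>By continuity of the action a short orbit stays in the chart domain; its coordinates form the curve to which
  \<open>immersion_tangent_to_line\<close> is applied.\<close>

lemma chart_orbit:
  assumes surf: "immersed_surface M A F" and ch: "(U, \<phi>) \<in> A" and p: "p \<in> U"
    and \<Phi>: "continuous_map (prod_topology euclideanreal M) M (\<lambda>(t, m). \<Phi> t m)"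
    and \<Phi>0: "\<Phi> 0 (\<phi> p) = \<phi> p"
  obtains c where "(c \<longlongrightarrow> p) (at (0::real))" "\<forall>\<^sub>F t in at 0. \<phi> (c t) = \<Phi> t (\<phi> p)"
proof -
  have m: "\<phi> p \<in> topspace M" using chart_in_topspace[OF surf ch p] .
  obtain \<psi> where \<psi>: "homeomorphic_maps (top_of_set U) (subtopology M (\<phi> ` U)) \<phi> \<psi>"
    using chart_homeomorphic[OF surf ch] by (auto simp: homeomorphic_map_maps)
  have orb: "continuous_map euclideanreal M (\<lambda>t. \<Phi> t (\<phi> p))"
  proof -
    have "continuous_map euclideanreal (prod_topology euclideanreal M) (\<lambda>t. (t, \<phi> p))"
      using m by (simp add: continuous_map_pairwise o_def)
    from continuous_map_compose[OF this \<Phi>] show ?thesis by (simp add: o_def)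
  qed
  define T where "T = {t. \<Phi> t (\<phi> p) \<in> \<phi> ` U}"
  have "openin euclideanreal {t \<in> topspace euclideanreal. \<Phi> t (\<phi> p) \<in> \<phi> ` U}"
    by (rule openin_continuous_map_preimage[OF orb chart_image_open[OF surf ch]])
  then have T: "open T" by (simp add: T_def)
  have T0: "0 \<in> T" using \<Phi>0 p by (simp add: T_def)
  define c where "c = (\<lambda>t. \<psi> (\<Phi> t (\<phi> p)))"
  have "continuous_map (top_of_set T) (subtopology M (\<phi> ` U)) (\<lambda>t. \<Phi> t (\<phi> p))"
    using orb by (auto simp: continuous_map_in_subtopology T_def intro: continuous_map_from_subtopology)
  moreover have "continuous_map (subtopology M (\<phi> ` U)) (top_of_set U) \<psi>"
    using \<psi> by (simp add: homeomorphic_maps_def)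
  ultimately have "continuous_map (top_of_set T) (top_of_set U) (\<psi> \<circ> (\<lambda>t. \<Phi> t (\<phi> p)))"
    by (rule continuous_map_compose)
  then have "continuous_map (top_of_set T) euclidean c"
    unfolding c_def o_def using continuous_map_into_fulltopology by blast
  then have "continuous_on T c" by simp
  then have "isCont c 0" using T T0 by (simp add: continuous_on_eq_continuous_at)
  moreover have "c 0 = p" using \<psi> p \<Phi>0 by (simp add: c_def homeomorphic_maps_def)
  ultimately have "(c \<longlongrightarrow> p) (at 0)" by (simp add: isCont_def)
  moreover have "\<forall>\<^sub>F t in at 0. t \<in> T" using T T0 eventually_at_topological by blast
  then have "\<forall>\<^sub>F t in at 0. \<phi> (c t) = \<Phi> t (\<phi> p)"
    by eventually_elim (use \<psi> in \<open>auto simp: T_def c_def homeomorphic_maps_def\<close>)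
  ultimately show thesis using that by blast
qed

lemma grim_reaper_angle_functions:
  assumes tr: "v_translator M A F N" and inv: "parabolic_invariant M F"
  shows "angle_functions A F (\<lambda>m. N m $ 3) (\<lambda>m. - N m $ 2 / F m $ 2)"
proof -
  have surf: "immersed_surface M A F" and un: "unit_normal A F N"
    and H: "\<And>U \<phi> p. (U, \<phi>) \<in> A \<Longrightarrow> p \<in> U \<Longrightarrow>
      mean_curvature (F \<circ> \<phi>) (N (\<phi> p)) p = metric_inner (F (\<phi> p)) (N (\<phi> p)) (axis 3 1)"
    using tr by (auto simp: v_translator_def)
  obtain \<Phi> where \<Phi>: "continuous_map (prod_topology euclideanreal M) M (\<lambda>(t, m). \<Phi> t m)"
    and \<Phi>0: "\<And>m. m \<in> topspace M \<Longrightarrow> \<Phi> 0 m = m"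
    and F\<Phi>: "\<And>m t. m \<in> topspace M \<Longrightarrow> F (\<Phi> t m) = parabolic_translation t (F m)"
    using inv unfolding parabolic_invariant_def by blast
  let ?C = "\<lambda>m. N m $ 3" and ?S = "\<lambda>m. - N m $ 2 / F m $ 2"
  have N1: "N (\<phi> p) $ 1 = 0"
    and unit: "(?C (\<phi> p))\<^sup>2 + (?S (\<phi> p))\<^sup>2 = 1"
    and orth: "?S (\<phi> p) * frechet_derivative (F \<circ> \<phi>) (at p) v $ 2 =
              ?C (\<phi> p) * frechet_derivative (F \<circ> \<phi>) (at p) v $ 3 * (F \<circ> \<phi>) p $ 2"
    if ch: "(U, \<phi>) \<in> A" and p: "p \<in> U" for U \<phi> p v
  proof -
    let ?X' = "frechet_derivative (F \<circ> \<phi>) (at p)"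
    have y: "F (\<phi> p) $ 2 > 0" by (rule chart_in_H2R[OF surf ch p])
    have m: "\<phi> p \<in> topspace M" by (rule chart_in_topspace[OF surf ch p])
    have un1: "metric_inner (F (\<phi> p)) (N (\<phi> p)) (N (\<phi> p)) = 1"
      and un2: "\<And>v. metric_inner (F (\<phi> p)) (N (\<phi> p)) (?X' v) = 0"
      using un ch p unfolding unit_normal_def by blast+
    obtain c where c: "(c \<longlongrightarrow> p) (at 0)" "\<forall>\<^sub>F t in at 0. \<phi> (c t) = \<Phi> t (\<phi> p)"
      using chart_orbit[OF surf ch p \<Phi> \<Phi>0[OF m]] .
    have line: "\<forall>\<^sub>F t in at 0. (F \<circ> \<phi>) (c t) = (F \<circ> \<phi>) p + t *\<^sub>R axis 1 1"
      using c(2) by eventually_elim (simp add: F\<Phi>[OF m] parabolic_translation_eq)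
    obtain v1 where v1: "?X' v1 = axis 1 1"
      using immersion_tangent_to_line[OF smooth_on_has_derivative[OF chart_smooth[OF surf ch] p]
          chart_immersion[OF surf ch p] c(1) line] .
    show N1: "N (\<phi> p) $ 1 = 0"
      using un2[of v1] y by (simp add: v1 metric_inner_eq axis_def)
    show "(?C (\<phi> p))\<^sup>2 + (?S (\<phi> p))\<^sup>2 = 1"
      using un1 by (simp add: metric_inner_eq N1 power_divide) (simp add: power2_eq_square)
    show "?S (\<phi> p) * ?X' v $ 2 = ?C (\<phi> p) * ?X' v $ 3 * (F \<circ> \<phi>) p $ 2"
      using un2[of v] y by (simp add: metric_inner_eq N1 power2_eq_square field_simps)
  qed
  have "(?C \<circ> \<phi> has_derivative (\<lambda>v. - (2 * ?C (\<phi> p) + ?S (\<phi> p)) *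
              frechet_derivative (F \<circ> \<phi>) (at p) v $ 3)) (at p) \<and>
        (?S \<circ> \<phi> has_derivative (\<lambda>v. (2 * ?C (\<phi> p) + ?S (\<phi> p)) *
              (frechet_derivative (F \<circ> \<phi>) (at p) v $ 2 / F (\<phi> p) $ 2))) (at p)"
    if ch: "(U, \<phi>) \<in> A" and p: "p \<in> U" for U \<phi> p
  proof -
    let ?X = "F \<circ> \<phi>"
    note sm = chart_smooth[OF surf ch]
    have y: "?X q $ 2 > 0" if "q \<in> U" for q using chart_in_H2R[OF surf ch that] by simp
    have "smooth_on U (N \<circ> \<phi>)" using un ch by (auto simp: unit_normal_def)
    from smooth_on_has_derivative[OF this p] obtain N' where
      N': "(N \<circ> \<phi> has_derivative N') (at p)" by blast
    have C: "(?C \<circ> \<phi> has_derivative (\<lambda>v. N' v $ 3)) (at p)"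
      using has_derivative_vec_nth[OF N', of 3] by (simp add: o_def)
    have "\<exists>S'. ((\<lambda>q. - (N \<circ> \<phi>) q $ 2 / ?X q $ 2) has_derivative S') (at p)"
      using y[OF p] by (intro exI) (rule derivative_eq_intros N' smooth_on_has_derivative[OF sm p] refl | simp)+
    then obtain S' where S: "(?S \<circ> \<phi> has_derivative S') (at p)" by (auto simp: o_def)
    have n: "vector [0, - ?X p $ 2 * (?S \<circ> \<phi>) p, (?C \<circ> \<phi>) p] = N (\<phi> p)"
      using y[OF p] N1[OF ch p] by (simp add: vec_eq_iff forall_3)
    have "metric_inner (F (\<phi> p)) (N (\<phi> p)) (axis 3 1) = (?C \<circ> \<phi>) p"
      by (simp add: metric_inner_eq axis_def)
    then have H': "mean_curvature ?X (vector [0, - ?X p $ 2 * (?S \<circ> \<phi>) p, (?C \<circ> \<phi>) p]) p = (?C \<circ> \<phi>) p"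
      unfolding n H[OF ch p] .
    have unit': "((?C \<circ> \<phi>) q)\<^sup>2 + ((?S \<circ> \<phi>) q)\<^sup>2 = 1"
      and orth': "(?S \<circ> \<phi>) q * frechet_derivative ?X (at q) v $ 2 =
        (?C \<circ> \<phi>) q * frechet_derivative ?X (at q) v $ 3 * ?X q $ 2" if "q \<in> U" for q v
      using unit[OF ch that] orth[OF ch that] by (simp_all only: o_apply)
    note system = translator_angle_system[OF chart_open[OF surf ch] p smooth_on_has_derivative[OF sm]
          smooth_on_has_second_derivative[OF sm] smooth_on_continuous_second_derivative[OF sm]
          chart_immersion[OF surf ch p] y unit' orth' C S H']
    have eqs: "N' v $ 3 = - (2 * (?C \<circ> \<phi>) p + (?S \<circ> \<phi>) p) * frechet_derivative ?X (at p) v $ 3"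
      "S' v = (2 * (?C \<circ> \<phi>) p + (?S \<circ> \<phi>) p) * (frechet_derivative ?X (at p) v $ 2 / ?X p $ 2)" for v
      using system by blast+
    show ?thesis using C S unfolding eqs by simp
  qed
  then show ?thesis
    by (intro angle_functionsI) (use unit orth in \<open>auto simp only: o_apply\<close>)
qed

section \<open>Equivariant local homeomorphisms to the plane\<close>

text \<open>A set on which \<open>P\<close> is a homeomorphism onto a vertical strip, when \<open>P\<close> is continuous and open.\<close>

definition strip :: "'a topology \<Rightarrow> ('a \<Rightarrow> real \<times> real) \<Rightarrow> 'a set \<Rightarrow> bool" where
  "strip M P V \<longleftrightarrow> openin M V \<and> inj_on P V \<and> (\<exists>I. is_interval I \<and> P ` V = I \<times> UNIV)"

text \<open>Over the overlap \<open>R\<close> of the two image strips, the points where the two local inverses of \<open>P\<close> agree form the open set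
  \<open>Z\<close>.  The points where they differ lie in the open set \<open>Y\<close>, since a Hausdorff space separates the two
  preimages, and injectivity makes \<open>Y\<close> disjoint from \<open>Z\<close>.  As \<open>R\<close> is connected and \<open>Z\<close> is not empty, the inverses
  agree on all of \<open>R\<close>.\<close>

lemma strip_Un:
  assumes Haus: "Hausdorff_space M" and opn: "open_map M euclidean P"
    and V1: "strip M P V1" and V2: "strip M P V2" and meet: "V1 \<inter> V2 \<noteq> {}"
  shows "strip M P (V1 \<union> V2)"
proof -
  obtain I1 where o1: "openin M V1" "inj_on P V1" "is_interval I1" "P ` V1 = I1 \<times> UNIV"
    using V1 by (auto simp: strip_def)
  obtain I2 where o2: "openin M V2" "inj_on P V2" "is_interval I2" "P ` V2 = I2 \<times> UNIV"
    using V2 by (auto simp: strip_def)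
  define R where "R = (I1 \<inter> I2) \<times> (UNIV :: real set)"
  define Z where "Z = P ` (V1 \<inter> V2)"
  define Y where "Y = (\<Union>(A, B) \<in> {(A, B). openin M A \<and> openin M B \<and> A \<subseteq> V1 \<and> B \<subseteq> V2 \<and> A \<inter> B = {}}.
    P ` A \<inter> P ` B)"
  have openP: "open (P ` A)" if "openin M A" for A
    using opn that by (simp add: open_map_def)
  have "is_interval (I1 \<inter> I2)" using o1(3) o2(3) by (rule is_interval_Int)
  then have "connected R"
    unfolding R_def by (intro connected_Times) (auto intro: is_interval_connected)
  moreover have "open Z" unfolding Z_def by (intro openP openin_Int o1 o2)
  moreover have "open Y" unfolding Y_def by (intro open_UN) (auto intro!: openP)
  moreover have YZ: "Z \<inter> Y \<inter> R = {}"
  proof -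
    have False if c: "c \<in> V1 \<inter> V2" and A: "A \<subseteq> V1" "a \<in> A" "P c = P a"
      and B: "B \<subseteq> V2" "b \<in> B" "P c = P b" and "A \<inter> B = {}" for c A B a b
    proof -
      have "c = a" using o1(2) c A by (auto dest: inj_onD)
      moreover have "c = b" using o2(2) c B by (auto dest: inj_onD)
      ultimately show False using that by blast
    qed
    then show ?thesis unfolding Z_def Y_def by fastforce
  qed
  moreover have cover: "P a \<in> Y" if "a \<in> V1" "b \<in> V2" "P a = P b" "a \<noteq> b" for a b
  proof -
    have "a \<in> topspace M" "b \<in> topspace M"
      using that o1(1) o2(1) openin_subset by blast+
    then obtain A B where AB: "openin M A" "openin M B" "a \<in> A" "b \<in> B" "disjnt A B"
      using Haus[unfolded Hausdorff_space_def, rule_format, of a b] \<open>a \<noteq> b\<close> by blast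
    have "openin M (A \<inter> V1)" "openin M (B \<inter> V2)" "(A \<inter> V1) \<inter> (B \<inter> V2) = {}"
      using AB o1 o2 by (auto simp: disjnt_def)
    moreover have "P a \<in> P ` (A \<inter> V1) \<inter> P ` (B \<inter> V2)"
      using that AB imageI[of a "A \<inter> V1" P] imageI[of b "B \<inter> V2" P] by simp
    ultimately show ?thesis unfolding Y_def by blast
  qed
  have "R \<subseteq> Z \<union> Y"
  proof
    fix r assume "r \<in> R"
    then have "r \<in> P ` V1" "r \<in> P ` V2" by (auto simp: R_def o1 o2)
    then obtain a b where "a \<in> V1" "b \<in> V2" "r = P a" "r = P b" by blast
    then show "r \<in> Z \<union> Y" using cover[of a b] by (cases "a = b") (auto simp: Z_def)
  qed
  ultimately have "Z \<inter> R = {} \<or> Y \<inter> R = {}"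
    by (intro connectedD)
  moreover have "Z \<subseteq> R"
  proof -
    have "Z \<subseteq> P ` V1 \<inter> P ` V2" by (auto simp: Z_def)
    then show ?thesis by (auto simp: o1 o2 R_def)
  qed
  moreover have "Z \<noteq> {}" using meet by (simp add: Z_def)
  ultimately have YR: "Y \<inter> R = {}" by blast
  have cross: "a = b" if "a \<in> V1" "b \<in> V2" "P a = P b" for a b
  proof (rule ccontr)
    assume "a \<noteq> b"
    moreover have "P a \<in> P ` V1" "P a \<in> P ` V2" using that imageI[of a V1 P] imageI[of b V2 P] by simp_all
    then have "P a \<in> R" by (auto simp: o1 o2 R_def)
    ultimately show False using cover[OF that] YR by blast
  qed
  have "inj_on P (V1 \<union> V2)"
  proof (rule inj_onI)
    fix a b assume "a \<in> V1 \<union> V2" "b \<in> V1 \<union> V2" "P a = P b"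
    then show "a = b"
      using cross[of a b] cross[of b a] inj_onD[OF o1(2), of a b] inj_onD[OF o2(2), of a b] by auto
  qed
  moreover have "is_interval (I1 \<union> I2)"
  proof -
    have "I1 \<inter> I2 \<noteq> {}" using \<open>Z \<subseteq> R\<close> \<open>Z \<noteq> {}\<close> by (auto simp: R_def)
    then have "connected (I1 \<union> I2)"
      using o1 o2 by (intro connected_Un) (auto intro: is_interval_connected)
    then show ?thesis by (simp add: is_interval_connected_1)
  qed
  moreover have "P ` (V1 \<union> V2) = (I1 \<union> I2) \<times> UNIV"
    by (simp add: image_Un o1 o2 Sigma_Un_distrib1)
  ultimately show ?thesis using o1(1) o2(1) unfolding strip_def by blast
qed

text \<open>The flow moves each point to the level of \<open>m\<close>; this is the map \<open>\<rho>\<close>.  The preimage under \<open>\<rho>\<close> of a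
  neighbourhood on which \<open>P\<close> is injective is invariant, and \<open>P\<close> is still injective there because a point is recovered
  from its value under \<open>\<rho>\<close> and its level.\<close>

lemma strip_exists:
  fixes P :: "'a \<Rightarrow> real \<times> real"
  assumes cont: "continuous_map M euclidean P" and opn: "open_map M euclidean P"
    and V0: "openin M V0" "m \<in> V0" "inj_on P V0"
    and \<Phi>: "continuous_map (prod_topology euclideanreal M) M (\<lambda>(t, m). \<Phi> t m)"
    and \<Phi>0: "\<And>m. m \<in> topspace M \<Longrightarrow> \<Phi> 0 m = m"
    and \<Phi>add: "\<And>m s t. m \<in> topspace M \<Longrightarrow> \<Phi> (s + t) m = \<Phi> s (\<Phi> t m)"
    and P\<Phi>: "\<And>m t. m \<in> topspace M \<Longrightarrow> P (\<Phi> t m) = P m + (0, t)"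
  obtains V where "m \<in> V" "strip M P V"
proof -
  have V0M: "V0 \<subseteq> topspace M" using V0 by (simp add: openin_subset)
  have \<Phi>M: "\<Phi> t n \<in> topspace M" if "n \<in> topspace M" for t n
    using continuous_map_image_subset_topspace[OF \<Phi>] that by fastforce
  have "open (P ` V0)" using opn V0 by (simp add: open_map_def)
  moreover have "P m \<in> P ` V0" using V0 by blast
  ultimately obtain A B where AB: "open A" "open B" "P m \<in> A \<times> B" "A \<times> B \<subseteq> P ` V0"
    by (rule open_prod_elim)
  define x0 where "x0 = snd (P m)"
  have "fst (P m) \<in> A" using AB(3) by (auto simp: mem_Times_iff)
  then obtain e where e: "e > 0" "ball (fst (P m)) e \<subseteq> A" using AB(1) openE by blast
  define I where "I = ball (fst (P m)) e"
  have I: "open I" "is_interval I" "fst (P m) \<in> I"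
    using e by (auto simp: I_def is_interval_ball_real)
  have IV0: "(s, x0) \<in> P ` V0" if "s \<in> I" for s
    using AB(3,4) that e by (auto simp: I_def x0_def mem_Times_iff subset_iff)
  define \<rho> where "\<rho> = (\<lambda>n. \<Phi> (x0 - snd (P n)) n)"
  have \<rho>: "continuous_map M M \<rho>"
  proof -
    have "continuous_map M euclidean (snd \<circ> P)"
      by (rule continuous_map_compose[OF cont]) (auto intro: continuous_intros)
    then have "continuous_map M euclideanreal (\<lambda>n. x0 - snd (P n))"
      by (intro continuous_intros) (simp add: o_def)
    then have "continuous_map M (prod_topology euclideanreal M) (\<lambda>n. (x0 - snd (P n), n))"
      by (simp add: continuous_map_pairwise o_def)
    from continuous_map_compose[OF this \<Phi>] show ?thesis by (simp add: \<rho>_def o_def)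
  qed
  have P\<rho>: "P (\<rho> n) = (fst (P n), x0)" if "n \<in> topspace M" for n
    using that by (simp add: \<rho>_def P\<Phi> prod_eq_iff)
  have retr: "\<Phi> (snd (P n) - x0) (\<rho> n) = n" if "n \<in> topspace M" for n
    using that by (simp add: \<rho>_def \<Phi>add[symmetric] \<Phi>0)
  define V where "V = {n \<in> topspace M. \<rho> n \<in> V0} \<inter> {n \<in> topspace M. (fst \<circ> P) n \<in> I}"
  have "openin M V"
  proof -
    have "continuous_map M euclidean (fst \<circ> P)"
      by (rule continuous_map_compose[OF cont]) (auto intro: continuous_intros)
    then have "openin M {n \<in> topspace M. (fst \<circ> P) n \<in> I}"
      by (rule openin_continuous_map_preimage) (use I(1) in simp)
    then show ?thesis
      unfolding V_def using openin_continuous_map_preimage[OF \<rho> V0(1)] by (rule openin_Int[rotated])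
  qed
  moreover have "inj_on P V"
  proof (rule inj_onI)
    fix a b assume ab: "a \<in> V" "b \<in> V" "P a = P b"
    then have abM: "a \<in> topspace M" "b \<in> topspace M" by (auto simp: V_def)
    have "\<rho> a = \<rho> b"
    proof (rule inj_onD[OF V0(3)])
      show "P (\<rho> a) = P (\<rho> b)" using P\<rho>[OF abM(1)] P\<rho>[OF abM(2)] ab(3) by simp
    qed (use ab in \<open>auto simp: V_def\<close>)
    then show "a = b" using retr[OF abM(1)] retr[OF abM(2)] ab(3) by metis
  qed
  moreover have "P ` V = I \<times> UNIV"
  proof
    show "P ` V \<subseteq> I \<times> UNIV" by (rule image_subsetI) (simp add: V_def mem_Times_iff)
    show "I \<times> UNIV \<subseteq> P ` V"
    proof
      fix r assume r: "r \<in> I \<times> (UNIV :: real set)"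
      then have "(fst r, x0) \<in> P ` V0" by (intro IV0) auto
      then obtain a where a: "a \<in> V0" "P a = (fst r, x0)" by fastforce
      define n where "n = \<Phi> (snd r - x0) a"
      have aM: "a \<in> topspace M" using a V0M by blast
      have Pn: "P n = r" using aM a by (simp add: n_def P\<Phi> prod_eq_iff)
      have "\<rho> n = \<Phi> (x0 - snd r) n" by (simp only: \<rho>_def Pn)
      also have "\<dots> = a" using aM by (simp add: n_def \<Phi>add[symmetric] \<Phi>0)
      finally have "\<rho> n = a" .
      moreover have "n \<in> topspace M" unfolding n_def by (rule \<Phi>M[OF aM])
      moreover have "fst (P n) \<in> I" using r Pn by auto
      ultimately have "n \<in> V" using a(1) by (simp add: V_def)
      then show "r \<in> P ` V" using Pn by blast
    qed
  qed
  moreover have "m \<in> V"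
    using V0M V0 I(3) by (auto simp: V_def \<rho>_def x0_def \<Phi>0)
  ultimately show thesis using that I(2) unfolding strip_def by blast
qed

text \<open>The strips through a fixed point form a directed family by \<open>strip_Un\<close>, so \<open>P\<close> is injective on their union \<open>W\<close>.  A
  strip that meets \<open>W\<close> is contained in it, so \<open>W\<close> is closed as well as open, and is the whole space.\<close>

lemma equivariant_local_homeomorphism:
  fixes P :: "'a \<Rightarrow> real \<times> real"
  assumes Haus: "Hausdorff_space M" and conn: "connected_space M" and ne: "topspace M \<noteq> {}"
    and cont: "continuous_map M euclidean P" and opn: "open_map M euclidean P"
    and locinj: "\<And>m. m \<in> topspace M \<Longrightarrow> \<exists>V. openin M V \<and> m \<in> V \<and> inj_on P V"
    and \<Phi>: "continuous_map (prod_topology euclideanreal M) M (\<lambda>(t, m). \<Phi> t m)"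
    and \<Phi>0: "\<And>m. m \<in> topspace M \<Longrightarrow> \<Phi> 0 m = m"
    and \<Phi>add: "\<And>m s t. m \<in> topspace M \<Longrightarrow> \<Phi> (s + t) m = \<Phi> s (\<Phi> t m)"
    and P\<Phi>: "\<And>m t. m \<in> topspace M \<Longrightarrow> P (\<Phi> t m) = P m + (0, t)"
  obtains J h where "open J" "is_interval J" "J \<noteq> {}"
    "homeomorphic_map (top_of_set (J \<times> UNIV)) M h" "\<And>s t. s \<in> J \<Longrightarrow> P (h (s, t)) = (s, t)"
proof -
  have strips: "\<exists>V. m \<in> V \<and> strip M P V" if "m \<in> topspace M" for m
    using locinj[OF that] strip_exists[OF cont opn _ _ _ \<Phi> \<Phi>0 \<Phi>add P\<Phi>] by metis
  obtain m0 where m0: "m0 \<in> topspace M" using ne by blast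
  define W where "W = \<Union>{V. m0 \<in> V \<and> strip M P V}"
  have "openin M W" unfolding W_def by (rule openin_Union) (auto simp: strip_def)
  moreover have "closedin M W"
  proof -
    have "openin M (topspace M - W)"
    proof (subst openin_subopen, intro ballI)
      fix q assume q: "q \<in> topspace M - W"
      then obtain V where V: "q \<in> V" "strip M P V" using strips by blast
      have "V \<inter> W = {}"
      proof (rule ccontr)
        assume "V \<inter> W \<noteq> {}"
        then obtain V' where V': "m0 \<in> V'" "strip M P V'" "V' \<inter> V \<noteq> {}" by (auto simp: W_def)
        then have "strip M P (V' \<union> V)" using strip_Un[OF Haus opn V'(2) V(2)] by blast
        then have "q \<in> W" using V V' by (auto simp: W_def)
        then show False using q by blast
      qed
      moreover have "openin M V" using V by (simp add: strip_def)
      ultimately show "\<exists>T. openin M T \<and> q \<in> T \<and> T \<subseteq> topspace M - W"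
        using V openin_subset[of M V] by blast
    qed
    then show ?thesis using \<open>openin M W\<close> openin_subset by (auto simp: closedin_def)
  qed
  moreover have "W \<noteq> {}" using strips[OF m0] by (auto simp: W_def)
  ultimately have W: "W = topspace M" using conn by (auto simp: connected_space_clopen_in)
  have inj: "inj_on P (topspace M)"
  proof (rule inj_onI)
    fix a b assume "a \<in> topspace M" "b \<in> topspace M" and P: "P a = P b"
    then obtain V V' where V: "m0 \<in> V" "strip M P V" "a \<in> V" and V': "m0 \<in> V'" "strip M P V'" "b \<in> V'"
      unfolding W[symmetric] W_def by blast
    then have "strip M P (V \<union> V')" by (intro strip_Un[OF Haus opn]) auto
    then show "a = b" using V V' P by (auto simp: strip_def dest: inj_onD)
  qed
  define J where "J = fst ` P ` topspace M"
  have PM: "P ` topspace M = J \<times> UNIV"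
  proof
    show "P ` topspace M \<subseteq> J \<times> UNIV" by (rule image_subsetI) (simp add: J_def mem_Times_iff)
    show "J \<times> UNIV \<subseteq> P ` topspace M"
    proof
      fix r assume "r \<in> J \<times> (UNIV :: real set)"
      then obtain m where m: "m \<in> topspace M" "fst r = fst (P m)" by (auto simp: J_def)
      then have "P (\<Phi> (snd r - snd (P m)) m) = r" by (simp add: P\<Phi> prod_eq_iff)
      moreover have "\<Phi> (snd r - snd (P m)) m \<in> topspace M"
        using continuous_map_image_subset_topspace[OF \<Phi>] m by fastforce
      ultimately show "r \<in> P ` topspace M" by (metis imageI)
    qed
  qed
  have openPM: "open (P ` topspace M)"
    using opn openin_topspace unfolding open_map_def by (metis open_openin)
  have "connectedin M (topspace M)" using conn by (simp add: connectedin_topspace)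
  from connectedin_continuous_map_image[OF cont this]
  have "connected (P ` topspace M)" by simp
  then have "connected J"
    unfolding J_def by (intro connected_continuous_image continuous_intros)
  then have J: "open J" "is_interval J" "J \<noteq> {}"
    using open_image_fst[OF openPM] ne
    by (auto simp: is_interval_connected_1 J_def)
  have "homeomorphic_map M (top_of_set (P ` topspace M)) P"
  proof (rule bijective_open_imp_homeomorphic_map)
    show "continuous_map M (top_of_set (P ` topspace M)) P"
      using cont by (auto simp: continuous_map_in_subtopology)
    show "open_map M (top_of_set (P ` topspace M)) P"
      using opn by (intro open_map_into_subtopology) auto
  qed (use inj in auto)
  then obtain h where h: "homeomorphic_maps M (top_of_set (J \<times> UNIV)) P h"
    unfolding PM homeomorphic_map_maps by blast
  show thesis
  proof (rule that[OF J])
    show "homeomorphic_map (top_of_set (J \<times> UNIV)) M h"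
      using h homeomorphic_maps_sym homeomorphic_maps_map by blast
    show "P (h (s, t)) = (s, t)" if "s \<in> J" for s t
      using h that by (simp add: homeomorphic_maps_def)
  qed
qed

section \<open>Surfaces over a solution of the profile equations\<close>

text \<open>Smoothness is obtained algebraically: if the generators have derivatives in the ring that they generate, the ring is
  closed under differentiation.\<close>

inductive_set polynomials_in :: "(real \<Rightarrow> real) set \<Rightarrow> (real \<Rightarrow> real) set" for G where
  poly_gen: "g \<in> G \<Longrightarrow> g \<in> polynomials_in G"
| poly_const: "(\<lambda>s. c) \<in> polynomials_in G"
| poly_add: "f \<in> polynomials_in G \<Longrightarrow> g \<in> polynomials_in G \<Longrightarrow> (\<lambda>s. f s + g s) \<in> polynomials_in G"
| poly_mult: "f \<in> polynomials_in G \<Longrightarrow> g \<in> polynomials_in G \<Longrightarrow> (\<lambda>s. f s * g s) \<in> polynomials_in G"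

lemma polynomials_in_derivative:
  assumes G: "\<And>g. g \<in> G \<Longrightarrow> \<exists>g'\<in>polynomials_in G. \<forall>s. (g has_real_derivative g' s) (at s)"
    and f: "f \<in> polynomials_in G"
  shows "\<exists>f'\<in>polynomials_in G. \<forall>s. (f has_real_derivative f' s) (at s)"
  using f
proof induction
  case (poly_gen g)
  then show ?case by (rule G)
next
  case (poly_const c)
  then show ?case by (intro bexI[OF _ polynomials_in.poly_const[of 0]]) auto
next
  case (poly_add f g)
  then obtain f' g' where "f' \<in> polynomials_in G" "\<forall>s. (f has_real_derivative f' s) (at s)"
    "g' \<in> polynomials_in G" "\<forall>s. (g has_real_derivative g' s) (at s)" by blast
  then show ?case
    by (intro bexI[of _ "\<lambda>s. f' s + g' s"] polynomials_in.poly_add) (auto intro: DERIV_add)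
next
  case (poly_mult f g)
  then obtain f' g' where fg: "f' \<in> polynomials_in G" "\<forall>s. (f has_real_derivative f' s) (at s)"
    "g' \<in> polynomials_in G" "\<forall>s. (g has_real_derivative g' s) (at s)" by blast
  then have "((\<lambda>s. f s * g s) has_real_derivative f' s * g s + g' s * f s) (at s)" for s
    by (intro DERIV_mult) auto
  then show ?case
    using fg poly_mult.hyps
    by (intro bexI[of _ "\<lambda>s. f' s * g s + g' s * f s"] polynomials_in.poly_add polynomials_in.poly_mult) auto
qed

text \<open>Smoothness is a coinductive property: it holds for the members of any class of differentiable functions that is closed under
  directional derivatives.\<close>

lemma smooth_on_UNIV_coinduct:
  assumes "f \<in> \<S>"
    and diff: "\<And>g p. g \<in> \<S> \<Longrightarrow> g differentiable (at p)"
    and closed: "\<And>g v. g \<in> \<S> \<Longrightarrow> (\<lambda>p. frechet_derivative g (at p) v) \<in> \<S>"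
  shows "smooth_on UNIV f"
proof -
  have "Ck_on k UNIV g" if "g \<in> \<S>" for k g
    using that
  proof (induction k arbitrary: g)
    case 0
    then show ?case
      using diff by (auto intro!: differentiable_imp_continuous_on simp: differentiable_on_def intro: differentiable_at_withinI)
  qed (auto intro: diff closed)
  then show ?thesis using assms(1) by (auto simp: smooth_on_def)
qed

lemma has_derivative_vector_3:
  assumes "(a has_derivative a') (at q)" "(b has_derivative b') (at q)" "(c has_derivative c') (at q)"
  shows "((\<lambda>p. vector [a p, b p, c p] :: real^3) has_derivative (\<lambda>v. vector [a' v, b' v, c' v])) (at q)"
proof (subst has_derivative_componentwise_within, intro ballI)
  fix i :: "real^3" assume "i \<in> Basis"
  then obtain k where "i = axis k 1" by (auto simp: Basis_vec_def)
  then show "((\<lambda>p. (vector [a p, b p, c p] :: real^3) \<bullet> i) has_derivative (\<lambda>v. (vector [a' v, b' v, c' v] :: real^3) \<bullet> i)) (at q)"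
    using assms exhaust_3[of k] by (auto simp: inner_axis)
qed

lemma has_derivative_comp_fst:
  assumes "(h has_real_derivative h') (at (fst p))"
  shows "((\<lambda>p. h (fst p)) has_derivative (\<lambda>v. h' * fst v)) (at p)"
  using has_derivative_compose[of fst fst p UNIV h "(*) h'"] assms
  by (simp add: has_field_derivative_def has_derivative_fst[OF has_derivative_ident])

text \<open>The equations of the profile with arc length as parameter; \<open>C\<close> and \<open>S\<close> are the cosine and the sine of its
  angle in the flat plane with coordinates \<open>ln y\<close> and \<open>z\<close>.\<close>

locale translator_profile =
  fixes y z C S :: "real \<Rightarrow> real"
  assumes y_pos: "y s > 0"
    and y': "(y has_real_derivative C s * y s) (at s)"
    and z': "(z has_real_derivative S s) (at s)"
    and C': "(C has_real_derivative - (2 * C s + S s) * S s) (at s)"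
    and S': "(S has_real_derivative (2 * C s + S s) * C s) (at s)"
    and unit: "(C s)\<^sup>2 + (S s)\<^sup>2 = 1"
begin

abbreviation "R \<equiv> polynomials_in {y, z, C, S}"

lemma R_derivative: "f \<in> R \<Longrightarrow> \<exists>f'\<in>R. \<forall>s. (f has_real_derivative f' s) (at s)"
proof (rule polynomials_in_derivative)
  have yzCS: "y \<in> R" "z \<in> R" "C \<in> R" "S \<in> R" by (auto intro: poly_gen)
  have k: "(\<lambda>s. 2 * C s + S s) \<in> R" by (intro poly_add poly_mult poly_const yzCS)
  have k': "(\<lambda>s. - 1 * (2 * C s + S s)) \<in> R" by (intro poly_mult poly_const k)
  have e: "- (2 * C s + S s) = - 1 * (2 * C s + S s)" for s by simp
  fix g assume "g \<in> {y, z, C, S}"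
  then consider "g = y" | "g = z" | "g = C" | "g = S" by blast
  then show "\<exists>g'\<in>R. \<forall>s. (g has_real_derivative g' s) (at s)"
  proof cases
    case 1
    show ?thesis using y' poly_mult[OF yzCS(3,1)] unfolding 1 by (intro bexI) auto
  next
    case 2
    show ?thesis using z' yzCS(4) unfolding 2 by (intro bexI) auto
  next
    case 3
    show ?thesis using C'[unfolded e] poly_mult[OF k' yzCS(4)] unfolding 3 by (intro bexI allI)
  next
    case 4
    show ?thesis using S' poly_mult[OF k yzCS(3)] unfolding 4 by (intro bexI allI)
  qed
qed

text \<open>The shape of the maps is chosen to be stable under directional derivatives; it covers both the parametrization and the
  normal.\<close>

lemma smooth_invariant_map:
  assumes "f \<in> R" "g \<in> R"
  shows "smooth_on UNIV (\<lambda>p :: real \<times> real. vector [a + b * snd p, f (fst p), g (fst p)] :: real^3)"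
proof (rule smooth_on_UNIV_coinduct)
  let ?\<S> = "{\<lambda>p :: real \<times> real. vector [a + b * snd p, f (fst p), g (fst p)] :: real^3 | a b f g. f \<in> R \<and> g \<in> R}"
  show "(\<lambda>p. vector [a + b * snd p, f (fst p), g (fst p)]) \<in> ?\<S>" using assms by blast
  have main: "X differentiable at p \<and> (\<lambda>p. frechet_derivative X (at p) v) \<in> ?\<S>" if mem: "X \<in> ?\<S>" for X p v
  proof -
    obtain a b f g where X: "X = (\<lambda>p. vector [a + b * snd p, f (fst p), g (fst p)])"
      and "f \<in> R" "g \<in> R" using mem by blast
    then obtain f' g' where f': "f' \<in> R" "\<And>s. (f has_real_derivative f' s) (at s)"
      and g': "g' \<in> R" "\<And>s. (g has_real_derivative g' s) (at s)" using R_derivative by meson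
    have "((\<lambda>p. a + b * snd p) has_derivative (\<lambda>v. b * snd v)) (at p)" for p
      by (auto intro!: derivative_eq_intros)
    then have D: "(X has_derivative (\<lambda>v. vector [b * snd v, f' (fst p) * fst v, g' (fst p) * fst v])) (at p)" for p
      unfolding X by (intro has_derivative_vector_3 has_derivative_comp_fst f' g')
    have "(\<lambda>p. frechet_derivative X (at p) v) =
      (\<lambda>p. vector [b * snd v + 0 * snd p, (\<lambda>s. f' s * fst v) (fst p), (\<lambda>s. g' s * fst v) (fst p)])"
      by (simp add: frechet_derivative_eqI[OF D])
    moreover have "(\<lambda>s. f' s * fst v) \<in> R" "(\<lambda>s. g' s * fst v) \<in> R"
      by (intro poly_mult poly_const f' g')+
    ultimately have "(\<lambda>p. frechet_derivative X (at p) v) \<in> ?\<S>"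
      by (intro CollectI exI[of _ "b * snd v"] exI[of _ 0]
          exI[of _ "\<lambda>s. f' s * fst v"] exI[of _ "\<lambda>s. g' s * fst v"] conjI) simp_all
    then show ?thesis using D[of p] unfolding differentiable_def by blast
  qed
  show "\<And>g p. g \<in> ?\<S> \<Longrightarrow> g differentiable at p" "\<And>g v. g \<in> ?\<S> \<Longrightarrow> (\<lambda>p. frechet_derivative g (at p) v) \<in> ?\<S>"
    using main by blast+
qed

lemma smooth_profile_curve:
  assumes "f \<in> R" "g \<in> R"
  shows "smooth_on UNIV (\<lambda>s. (f s, g s))"
proof (rule smooth_on_UNIV_coinduct)
  let ?\<S> = "{\<lambda>s. (f s, g s) | f g. f \<in> R \<and> g \<in> R}"
  show "(\<lambda>s. (f s, g s)) \<in> ?\<S>" using assms by blast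
  have main: "X differentiable at p \<and> (\<lambda>p. frechet_derivative X (at p) v) \<in> ?\<S>" if mem: "X \<in> ?\<S>" for X p v
  proof -
    obtain f g where X: "X = (\<lambda>s. (f s, g s))" and "f \<in> R" "g \<in> R" using mem by blast
    then obtain f' g' where f': "f' \<in> R" "\<And>s. (f has_real_derivative f' s) (at s)"
      and g': "g' \<in> R" "\<And>s. (g has_real_derivative g' s) (at s)" using R_derivative by meson
    have D: "(X has_derivative (\<lambda>v. (f' p * v, g' p * v))) (at p)" for p
      unfolding X using f'(2) g'(2) by (intro has_derivative_Pair) (auto simp: has_field_derivative_def)
    have "(\<lambda>p. frechet_derivative X (at p) v) = (\<lambda>p. ((\<lambda>s. f' s * v) p, (\<lambda>s. g' s * v) p))"
      by (simp add: frechet_derivative_eqI[OF D])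
    moreover have "(\<lambda>s. f' s * v) \<in> R" "(\<lambda>s. g' s * v) \<in> R"
      by (intro poly_mult poly_const f' g')+
    ultimately show ?thesis using D by (auto simp: differentiable_def)
  qed
  show "\<And>g p. g \<in> ?\<S> \<Longrightarrow> g differentiable at p" "\<And>g v. g \<in> ?\<S> \<Longrightarrow> (\<lambda>p. frechet_derivative g (at p) v) \<in> ?\<S>"
    using main by blast+
qed

abbreviation "curve \<equiv> \<lambda>s. (y s, z s)"

lemma param_curve: "param curve = (\<lambda>p. vector [0 + 1 * snd p, y (fst p), z (fst p)])"
  by (auto simp: param_def)

lemma smooth_param: "smooth_on UNIV (param curve)"
  unfolding param_curve by (rule smooth_invariant_map) (auto intro: poly_gen)

lemma has_derivative_param:
  "(param curve has_derivative (\<lambda>v. vector [snd v, C (fst p) * y (fst p) * fst v, S (fst p) * fst v])) (at p)"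
proof -
  show ?thesis
    unfolding param_curve
    by (intro has_derivative_vector_3 has_derivative_comp_fst y' z') (auto intro!: derivative_eq_intros)
qed

lemma inj_param_derivative:
  "inj (\<lambda>v. vector [snd v, C s * y s * fst v, S s * fst v] :: real^3)"
proof (rule injI)
  fix v w :: "real \<times> real"
  assume eq: "vector [snd v, C s * y s * fst v, S s * fst v] =
    (vector [snd w, C s * y s * fst w, S s * fst w] :: real^3)"
  then have "snd v = snd w" "C s * y s * fst v = C s * y s * fst w"
      "S s * fst v = S s * fst w"
    by (simp_all add: vec_eq_iff forall_3)
  moreover have "C s \<noteq> 0 \<or> S s \<noteq> 0" using unit[of s] by auto
  ultimately show "v = w" using y_pos[of s] by (auto simp: prod_eq_iff)
qed

lemma immersed_surface_param:
  "immersed_surface euclidean {(UNIV, id)} (param curve)"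
proof -
  have "second_countable (euclidean :: (real \<times> real) topology)"
  proof -
    obtain B :: "(real \<times> real) set set" where B: "countable B" "topological_basis B"
      using ex_countable_basis by blast
    have "\<exists>V\<in>B. x \<in> V \<and> V \<subseteq> U" if "open U" "x \<in> U" for U and x :: "real \<times> real"
      by (rule topological_basisE[OF B(2) that]) blast
    then show ?thesis
      unfolding second_countable_def
      using B(1) topological_basis_open[OF B(2)] by (intro exI[of _ B] conjI) simp_all
  qed
  moreover have "local_param euclidean (param curve) UNIV id"
    using smooth_param inj_param_derivative
    by (simp add: local_param_def frechet_derivative_eqI[OF has_derivative_param] homeomorphic_map_id)
  moreover have "connected_space (euclidean :: (real \<times> real) topology)"
    by (metis connected_UNIV connectedin_iff_connected connectedin_topspace topspace_euclidean)
  ultimately show ?thesis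
    using y_pos by (auto simp: immersed_surface_def Hausdorff_space_euclidean param_def H2R_def)
qed

definition normal :: "real \<times> real \<Rightarrow> real^3" where
  "normal p = vector [0, - y (fst p) * S (fst p), C (fst p)]"

lemma smooth_normal: "smooth_on UNIV normal"
proof -
  have yCS: "y \<in> R" "C \<in> R" "S \<in> R" by (auto intro: poly_gen)
  have "(\<lambda>s. - 1 * (y s * S s)) \<in> R" by (intro poly_mult poly_const yCS)
  from smooth_invariant_map[OF this yCS(2), of 0 0] show ?thesis
    by (simp add: normal_def[abs_def])
qed

text \<open>In the coordinates \<open>(s, t)\<close> the angle form is \<open>\<kappa> ds\<close>, so that the mean curvature is
  \<open>(\<kappa> - S) / 2 = C\<close>.\<close>

lemma mean_curvature_param: "mean_curvature (param curve) (normal p) p = C (fst p)"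
proof -
  let ?X = "param curve"
  let ?y = "y (fst p)"
  let ?X' = "\<lambda>q v. vector [snd v, C (fst q) * y (fst q) * fst v, S (fst q) * fst v] :: real^3"
  have D: "(?X has_derivative ?X' q) (at q)" for q by (rule has_derivative_param)
  have D2: "((\<lambda>q. ?X' q v) has_derivative frechet_derivative (\<lambda>q. ?X' q v) (at p)) (at p)" for v
    using smooth_on_has_second_derivative[OF smooth_param, of p v]
    by (simp add: frechet_derivative_eqI[OF D])
  have comp: "((h \<circ> fst) has_derivative (\<lambda>v. h' * fst v)) (at p)"
    if "(h has_real_derivative h') (at (fst p))" for h h'
    using has_derivative_comp_fst[OF that] by (simp add: o_def)
  have X2: "?X q $ 2 = y (fst q)" for q by (simp add: param_curve)
  let ?k = "2 * C (fst p) + S (fst p)"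
  have II: "second_form ?X (normal p) p v w = ?k * fst v * fst w - S (fst p) * (snd v / ?y) * (snd w / ?y)" for v w
  proof -
    have n: "normal p = vector [0, - ?X p $ 2 * (S \<circ> fst) p, (C \<circ> fst) p]"
      by (simp add: normal_def X2)
    have "second_form ?X (normal p) p v w = (?k * C (fst p) * fst v) * (?X' p w $ 2 / ?X p $ 2)
       - (- ?k * S (fst p) * fst v) * ?X' p w $ 3
       - (S \<circ> fst) p * (?X' p v $ 1 / ?X p $ 2) * (?X' p w $ 1 / ?X p $ 2)"
      unfolding n
      by (rule second_form_parabolic[OF open_UNIV UNIV_I D D2 _ _ comp[OF C'] comp[OF S']])
        (use y_pos in \<open>auto simp: X2\<close>)
    also have "\<dots> = ?k * fst v * fst w * ((C (fst p))\<^sup>2 + (S (fst p))\<^sup>2) - S (fst p) * (snd v / ?y) * (snd w / ?y)"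
      using y_pos[of "fst p"] by (simp add: X2 power2_eq_square algebra_simps)
    finally show ?thesis by (simp add: unit)
  qed
  have I: "first_form ?X p v w = (snd v / ?y) * (snd w / ?y) + fst v * fst w" for v w
  proof -
    have "first_form ?X p v w = (snd v / ?y) * (snd w / ?y) + fst v * fst w * ((C (fst p))\<^sup>2 + (S (fst p))\<^sup>2)"
      using y_pos[of "fst p"]
      by (simp add: first_form_def metric_inner_eq frechet_derivative_eqI[OF D] X2 field_simps power2_eq_square)
    then show ?thesis by (simp add: unit)
  qed
  have "mean_curvature ?X (normal p) p =
      ((0 * (?k * 0) - 1 / ?y * (?k * 1)) / (0 * 0 - 1 / ?y * 1) - S (fst p)) / 2"
    using mean_curvature_rank_two[of ?X p "\<lambda>v. snd v / ?y" fst "normal p" "\<lambda>v. ?k * fst v" "S (fst p)", OF I II]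
      y_pos[of "fst p"] by simp
  also have "\<dots> = C (fst p)" using y_pos[of "fst p"] by (simp add: field_simps)
  finally show ?thesis .
qed

lemma v_translator_param: "v_translator euclidean {(UNIV, id)} (param curve) normal"
proof -
  have X2: "param curve p $ 2 = y (fst p)" for p by (simp add: param_curve)
  have "metric_inner (param curve p) (normal p) (normal p) = (C (fst p))\<^sup>2 + (S (fst p))\<^sup>2" for p
    using y_pos[of "fst p"] by (simp add: metric_inner_eq normal_def X2 power2_eq_square)
  moreover have "metric_inner (param curve p) (normal p) (frechet_derivative (param curve) (at p) v) = 0" for p v
    using y_pos[of "fst p"]
    by (simp add: metric_inner_eq normal_def X2 frechet_derivative_eqI[OF has_derivative_param] power2_eq_square)
  moreover have "metric_inner (param curve p) (normal p) (axis 3 1) = C (fst p)" for p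
    by (simp add: metric_inner_eq normal_def axis_def)
  ultimately show ?thesis
    using immersed_surface_param smooth_normal mean_curvature_param
    by (simp add: v_translator_def unit_normal_def unit)
qed

lemma parabolic_v_grim_reaper_param: "parabolic_v_grim_reaper euclidean {(UNIV, id)} (param curve)"
proof -
  have "parabolic_invariant euclidean (param curve)"
    unfolding parabolic_invariant_def
  proof (intro exI[of _ "\<lambda>t p. (fst p, snd p + t)"] conjI)
    have "continuous_on UNIV (\<lambda>(t, p). (fst p, snd p + t) :: real \<times> real)"
      by (auto intro!: continuous_intros simp: split_beta)
    then show "continuous_map (prod_topology euclideanreal euclidean) euclidean
        (\<lambda>(t, p). (fst p, snd p + t) :: real \<times> real)"
      by simp
  qed (auto simp: param_curve parabolic_translation_def)
  then show ?thesis using v_translator_param unfolding parabolic_v_grim_reaper_def by blast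
qed

lemma embedded_curve_profile:
  assumes "\<And>s. g (y s, z s) = s" "continuous_on (range curve) g"
  shows "embedded_curve curve"
  unfolding embedded_curve_def
proof (intro conjI allI exI)
  show "smooth_on UNIV curve" by (rule smooth_profile_curve) (auto intro: poly_gen)
  show "vector_derivative curve (at s) \<noteq> 0" for s
  proof -
    have "(curve has_vector_derivative (C s * y s, S s)) (at s)"
      using y' z' by (intro has_vector_derivative_Pair)
        (simp_all add: has_real_derivative_iff_has_vector_derivative)
    then have "vector_derivative curve (at s) = (C s * y s, S s)" by (rule vector_derivative_at)
    moreover have "C s \<noteq> 0 \<or> S s \<noteq> 0" using unit[of s] by auto
    ultimately show ?thesis using y_pos[of s] by (auto simp: zero_prod_def)
  qed
  have "continuous_on UNIV y" "continuous_on UNIV z"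
    by (auto intro!: continuous_at_imp_continuous_on DERIV_isCont[OF y'] DERIV_isCont[OF z'])
  then show "homeomorphism UNIV (range curve) curve g"
    using assms by (auto simp: homeomorphism_def image_image intro!: continuous_intros)
qed

end

text \<open>An injective continuous real function on an interval is a homeomorphism onto its image.\<close>

lemma vertical_graph_image:
  assumes I: "is_interval I" "I \<noteq> {}" and pos: "\<And>s. s \<in> I \<Longrightarrow> y s > 0"
    and y: "continuous_on I y" "inj_on y I" and z: "continuous_on I z"
  shows "vertical_graph ((\<lambda>s :: real. (y s, z s)) ` I)"
proof -
  have "path_connected I" using I by (simp add: is_interval_path_connected)
  then obtain g where g: "homeomorphism I (y ` I) y g"
    using injective_into_1d_eq_homeomorphism[OF y(1)] y(2) by blast
  have "connected (y ` I)"
    using y(1) I by (intro connected_continuous_image) (auto intro: is_interval_connected)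
  then have "is_interval (y ` I)" by (simp add: is_interval_connected_1)
  moreover have "continuous_on (y ` I) (z \<circ> g)"
    using g z by (intro continuous_on_compose) (auto simp: homeomorphism_def)
  moreover have "(\<lambda>s. (y s, z s)) ` I = (\<lambda>t. (t, (z \<circ> g) t)) ` y ` I"
    using g by (auto simp: homeomorphism_def image_iff)
  ultimately show ?thesis
    unfolding vertical_graph_def using I pos by (intro exI[of _ "y ` I"] exI[of _ "z \<circ> g"]) auto
qed

section \<open>The two profile curves\<close>

lemma profile_\<alpha>1:
  "translator_profile (\<lambda>s. exp (s / sqrt 5)) (\<lambda>s. - 2 * s / sqrt 5) (\<lambda>s. 1 / sqrt 5) (\<lambda>s. - 2 / sqrt 5)"
proof
  fix s :: real
  show "((\<lambda>s. exp (s / sqrt 5)) has_real_derivative 1 / sqrt 5 * exp (s / sqrt 5)) (at s)"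
  proof -
    have "((\<lambda>s. s / sqrt 5) has_real_derivative 1 / sqrt 5) (at s)"
      by (rule DERIV_cdivide[OF DERIV_ident])
    from DERIV_chain2[of exp _ "\<lambda>s. s / sqrt 5", OF DERIV_exp this]
    show ?thesis by (simp only: mult.commute)
  qed
  show "((\<lambda>s. - 2 * s / sqrt 5) has_real_derivative - 2 / sqrt 5) (at s)"
    by (rule DERIV_cdivide) (auto intro!: derivative_eq_intros)
qed (simp_all add: power_divide)

lemma \<alpha>1_eq: "\<alpha>1 = (\<lambda>s. (exp (s / sqrt 5), - 2 * s / sqrt 5))"
  by (rule ext) (simp add: \<alpha>1_def)

text \<open>The function \<open>w = tan (\<theta> / 2)\<close>, the solution of \<open>w' = 1 + w - w\<^sup>2\<close> that runs between the roots
  \<open>(1 - sqrt 5) / 2\<close> and \<open>(1 + sqrt 5) / 2\<close>; its arctangent occurs in \<open>y2\<close> and \<open>z2\<close>.\<close>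

definition half_angle :: "real \<Rightarrow> real" where
  "half_angle s = 1/2 * (1 + sqrt 5 * tanh (sqrt 5 * s / 2))"

definition half_angle_inv :: "real \<Rightarrow> real" where
  "half_angle_inv r = 2 / sqrt 5 * artanh ((2 * r - 1) / sqrt 5)"

text \<open>The rational parametrization of the circle by the half-angle tangent.\<close>

definition cos2 :: "real \<Rightarrow> real" where "cos2 s = (1 - (half_angle s)\<^sup>2) / (1 + (half_angle s)\<^sup>2)"
definition sin2 :: "real \<Rightarrow> real" where "sin2 s = 2 * half_angle s / (1 + (half_angle s)\<^sup>2)"

lemma half_angle_quadratic:
  "1 + half_angle s - (half_angle s)\<^sup>2 = 5/4 * (1 - (tanh (sqrt 5 * s / 2))\<^sup>2)"
  "1 + (half_angle s)\<^sup>2 = 1/4 * (5 * (1 + (tanh (sqrt 5 * s / 2))\<^sup>2) + 2 * sqrt 5 * tanh (sqrt 5 * s / 2))"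
  by (simp_all add: half_angle_def power2_eq_square algebra_simps)

lemma half_angle_pos: "1 + half_angle s - (half_angle s)\<^sup>2 > 0"
proof -
  have "(tanh (sqrt 5 * s / 2))\<^sup>2 < 1"
    using tanh_real_bounds[of "sqrt 5 * s / 2"] by (simp add: abs_square_less_1 abs_less_iff)
  then show ?thesis by (simp add: half_angle_quadratic)
qed

lemma half_angle_derivative:
  "(half_angle has_real_derivative 1 + half_angle s - (half_angle s)\<^sup>2) (at s)"
proof -
  have "(half_angle has_real_derivative 1/2 * (sqrt 5 * ((1 - (tanh (sqrt 5 * s / 2))\<^sup>2) * (sqrt 5 / 2)))) (at s)"
    unfolding half_angle_def[abs_def] by (auto intro!: derivative_eq_intros)
  also have "1/2 * (sqrt 5 * ((1 - (tanh (sqrt 5 * s / 2))\<^sup>2) * (sqrt 5 / 2))) = 5/4 * (1 - (tanh (sqrt 5 * s / 2))\<^sup>2)"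
    by (simp add: algebra_simps)
  finally show ?thesis by (simp only: half_angle_quadratic)
qed

lemma half_angle_inv_half_angle: "half_angle_inv (half_angle s) = s"
proof -
  have "2 * half_angle s - 1 = sqrt 5 * tanh (sqrt 5 * s / 2)" by (simp add: half_angle_def add_divide_distrib)
  then show ?thesis by (simp add: half_angle_inv_def artanh_tanh_real)
qed

lemma quadratic_range: "1 + r - r\<^sup>2 > 0 \<longleftrightarrow> \<bar>(2 * r - 1) / sqrt 5\<bar> < 1" for r :: real
proof -
  have "\<bar>(2 * r - 1) / sqrt 5\<bar> < 1 \<longleftrightarrow> ((2 * r - 1) / sqrt 5)\<^sup>2 < 1" by (simp add: abs_square_less_1)
  also have "\<dots> \<longleftrightarrow> (2 * r - 1)\<^sup>2 < 5" by (simp add: power_divide)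
  also have "(2 * r - 1)\<^sup>2 = 4 * (r\<^sup>2 - r) + 1" by (simp add: power2_eq_square algebra_simps)
  finally show ?thesis by auto
qed

lemma half_angle_half_angle_inv:
  assumes "1 + r - r\<^sup>2 > 0"
  shows "half_angle (half_angle_inv r) = r"
proof -
  define x where "x = (2 * r - 1) / sqrt 5"
  have x: "\<bar>x\<bar> < 1" using assms unfolding quadratic_range x_def .
  have "exp (- 2 * artanh x) = (1 - x) / (1 + x)"
  proof -
    have "exp (- 2 * artanh x) = inverse (exp (ln ((1 + x) / (1 - x))))"
      by (simp add: artanh_def exp_minus)
    also have "\<dots> = (1 - x) / (1 + x)" using x by (subst exp_ln) (auto simp: field_simps)
    finally show ?thesis .
  qed
  then have "tanh (artanh x) = (1 - (1 - x) / (1 + x)) / (1 + (1 - x) / (1 + x))"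
    by (simp only: tanh_real_altdef)
  also have "\<dots> = x" using x by (simp add: field_simps)
  finally have "tanh (artanh x) = x" .
  then show ?thesis by (simp add: half_angle_def half_angle_inv_def x_def)
qed

lemma half_angle_inv_derivative:
  assumes "1 + r - r\<^sup>2 > 0"
  shows "(half_angle_inv has_real_derivative 1 / (1 + r - r\<^sup>2)) (at r)"
proof -
  have x: "\<bar>(2 * r - 1) / sqrt 5\<bar> < 1" using assms unfolding quadratic_range .
  have "(half_angle_inv has_real_derivative 2 / sqrt 5 * ((1 / (1 - ((2 * r - 1) / sqrt 5)\<^sup>2)) * (2 / sqrt 5))) (at r)"
    unfolding half_angle_inv_def[abs_def]
    by (intro DERIV_cmult DERIV_chain2[where f = artanh and g = "\<lambda>r. (2 * r - 1) / sqrt 5" and x = r, OF artanh_real_has_field_derivative[OF x]] DERIV_cdivide)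
      (auto intro!: derivative_eq_intros)
  also have "2 / sqrt 5 * ((1 / (1 - ((2 * r - 1) / sqrt 5)\<^sup>2)) * (2 / sqrt 5)) = 1 / (5/4 * (1 - ((2 * r - 1) / sqrt 5)\<^sup>2))"
  proof -
    have "2 / sqrt 5 * ((1 / d) * (2 / sqrt 5)) = 1 / (5/4 * d)" for d :: real
      by (cases "d = 0") (simp_all add: field_simps)
    then show ?thesis .
  qed
  also have "5/4 * (1 - ((2 * r - 1) / sqrt 5)\<^sup>2) = 1 + r - r\<^sup>2"
    by (simp add: power_divide) (simp add: power2_eq_square algebra_simps)
  finally show ?thesis .
qed

lemma continuous_half_angle_inv: "continuous_on {r. 1 + r - r\<^sup>2 > 0} half_angle_inv"
  using half_angle_inv_derivative by (auto intro!: continuous_at_imp_continuous_on DERIV_isCont)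

lemma angle_speed: "2 * cos2 s + sin2 s = 2 * (1 + half_angle s - (half_angle s)\<^sup>2) / (1 + (half_angle s)\<^sup>2)"
  by (simp add: cos2_def sin2_def add_divide_distrib[symmetric] algebra_simps)

lemma one_plus_square_pos: "1 + (x::real)\<^sup>2 > 0"
  by (simp add: add_pos_nonneg)

lemma angle_speed_pos: "2 * cos2 s + sin2 s > 0"
  unfolding angle_speed
  by (intro divide_pos_pos mult_pos_pos one_plus_square_pos half_angle_pos) simp

text \<open>The hyperbolic expression in the formulas for \<open>y2\<close> and \<open>z2\<close> is the angular speed \<open>\<kappa>\<close> (or its
  reciprocal), as the double-angle formulas show.\<close>

lemma angle_speed_hyperbolic:
  "2 * cos2 s + sin2 s = 10 / (sqrt 5 * sinh (sqrt 5 * s) + 5 * cosh (sqrt 5 * s))"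
proof -
  define x where "x = sqrt 5 * s / 2"
  have c: "cosh x > 0" by simp
  have D: "sqrt 5 * (2 * sinh x * cosh x) + 5 * ((cosh x)\<^sup>2 + (sinh x)\<^sup>2) = 4 * (cosh x)\<^sup>2 * (1 + (half_angle s)\<^sup>2)"
    unfolding half_angle_quadratic x_def[symmetric] tanh_def using c by (simp add: field_simps power2_eq_square)
  have "1 - (sinh x / cosh x)\<^sup>2 = 1 / (cosh x)\<^sup>2"
  proof -
    have "1 - (sinh x / cosh x)\<^sup>2 = ((cosh x)\<^sup>2 - (sinh x)\<^sup>2) / (cosh x)\<^sup>2"
      using c by (simp add: power_divide diff_divide_distrib)
    then show ?thesis by (simp add: cosh_square_eq)
  qed
  then have N: "1 + half_angle s - (half_angle s)\<^sup>2 = 5 / (4 * (cosh x)\<^sup>2)"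
    unfolding half_angle_quadratic x_def[symmetric] tanh_def by simp
  have "sqrt 5 * s = 2 * x" by (simp add: x_def)
  then have "10 / (sqrt 5 * sinh (sqrt 5 * s) + 5 * cosh (sqrt 5 * s)) = 10 / (4 * (cosh x)\<^sup>2 * (1 + (half_angle s)\<^sup>2))"
    by (simp only: sinh_double cosh_double D)
  also have "\<dots> = 2 * (1 + half_angle s - (half_angle s)\<^sup>2) / (1 + (half_angle s)\<^sup>2)"
    unfolding N by simp
  finally show ?thesis by (simp only: angle_speed)
qed

lemma y2_eq: "y2 s = exp (1/5 * ln (2 * cos2 s + sin2 s) + 4/5 * arctan (half_angle s))"
  unfolding y2_def angle_speed_hyperbolic[symmetric] half_angle_def[symmetric]
  using angle_speed_pos[of s] by (simp add: powr_def exp_add)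

lemma z2_eq: "z2 s = 2/5 * (arctan (half_angle s) - ln (2 * cos2 s + sin2 s))"
proof -
  have "ln ((5 * cosh (sqrt 5 * s) + sqrt 5 * sinh (sqrt 5 * s)) / 10) = ln (inverse (2 * cos2 s + sin2 s))"
    unfolding angle_speed_hyperbolic by (simp add: add.commute)
  then show ?thesis
    unfolding z2_def half_angle_def[symmetric] using angle_speed_pos[of s] by (simp add: ln_inverse)
qed

lemma cos2_sin2_derivative:
  shows "(cos2 has_real_derivative - (2 * cos2 s + sin2 s) * sin2 s) (at s)"
    and "(sin2 has_real_derivative (2 * cos2 s + sin2 s) * cos2 s) (at s)"
proof -
  let ?w = "half_angle s"
  have nz: "1 + ?w\<^sup>2 \<noteq> 0" using one_plus_square_pos[of ?w] by simp
  have "(cos2 has_real_derivative - 4 * ?w * (1 + ?w - ?w\<^sup>2) / (1 + ?w\<^sup>2)\<^sup>2) (at s)"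
    unfolding cos2_def[abs_def] using nz
    by (auto intro!: derivative_eq_intros half_angle_derivative simp: field_simps power2_eq_square)
  then show "(cos2 has_real_derivative - (2 * cos2 s + sin2 s) * sin2 s) (at s)"
    by (rule DERIV_cong) (simp only: angle_speed, simp add: sin2_def power2_eq_square mult_ac)
  have "(sin2 has_real_derivative 2 * (1 - ?w\<^sup>2) * (1 + ?w - ?w\<^sup>2) / (1 + ?w\<^sup>2)\<^sup>2) (at s)"
    unfolding sin2_def[abs_def] using nz
    by (auto intro!: derivative_eq_intros half_angle_derivative simp: field_simps power2_eq_square)
  then show "(sin2 has_real_derivative (2 * cos2 s + sin2 s) * cos2 s) (at s)"
    by (rule DERIV_cong) (simp only: angle_speed, simp only: cos2_def power2_eq_square times_divide_times_eq mult_ac)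
qed

text \<open>With \<open>\<kappa>'/\<kappa> = cos \<theta> - 2 sin \<theta>\<close> and \<open>\<theta>' = \<kappa>\<close>, the weights in
  \<open>y2_eq\<close> and \<open>z2_eq\<close> are those for which \<open>(\<kappa>'/\<kappa> + 2 \<theta>') / 5 = cos \<theta>\<close> and
  \<open>(\<theta>' - 2 \<kappa>'/\<kappa>) / 5 = sin \<theta>\<close>.\<close>

lemma profile_\<alpha>2: "translator_profile y2 z2 cos2 sin2"
proof
  fix s
  let ?k = "2 * cos2 s + sin2 s"
  show "y2 s > 0" by (simp add: y2_eq)
  show "(cos2 has_real_derivative - ?k * sin2 s) (at s)" "(sin2 has_real_derivative ?k * cos2 s) (at s)"
    by (rule cos2_sin2_derivative)+
  have arc: "((\<lambda>s. arctan (half_angle s)) has_real_derivative ?k / 2) (at s)"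
  proof -
    let ?w = "half_angle s"
    have "((\<lambda>s. arctan (half_angle s)) has_real_derivative inverse (1 + ?w\<^sup>2) * (1 + ?w - ?w\<^sup>2)) (at s)"
      by (rule DERIV_chain2[OF DERIV_arctan half_angle_derivative])
    moreover have "inverse d * n = 2 * n / d / 2" for d n :: real
    proof -
      have "2 * n / d / 2 = n / d" by simp
      then show ?thesis by (simp only: divide_inverse[of n d] mult.commute)
    qed
    ultimately show ?thesis by (simp only: angle_speed)
  qed
  have ln: "((\<lambda>s. ln (2 * cos2 s + sin2 s)) has_real_derivative cos2 s - 2 * sin2 s) (at s)"
    using angle_speed_pos[of s]
    by (auto intro!: derivative_eq_intros cos2_sin2_derivative simp: field_simps)
  show "(y2 has_real_derivative cos2 s * y2 s) (at s)"
  proof -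
    have "((\<lambda>s. 1/5 * ln (2 * cos2 s + sin2 s) + 4/5 * arctan (half_angle s)) has_real_derivative
        1/5 * (cos2 s - 2 * sin2 s) + 4/5 * (?k / 2)) (at s)"
      by (intro DERIV_add DERIV_cmult arc ln)
    moreover have "1/5 * (cos2 s - 2 * sin2 s) + 4/5 * (?k / 2) = cos2 s" by (simp add: field_simps)
    ultimately have "((\<lambda>s. 1/5 * ln (2 * cos2 s + sin2 s) + 4/5 * arctan (half_angle s)) has_real_derivative
        cos2 s) (at s)" by (simp only:)
    from DERIV_chain2[of exp, OF DERIV_exp this] show ?thesis
      unfolding y2_eq[abs_def] by (simp only: mult.commute)
  qed
  show "(z2 has_real_derivative sin2 s) (at s)"
  proof -
    have "(z2 has_real_derivative 2/5 * (?k / 2 - (cos2 s - 2 * sin2 s))) (at s)"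
      unfolding z2_eq[abs_def] by (intro DERIV_diff DERIV_cmult arc ln)
    then show ?thesis by (rule DERIV_cong) (simp add: field_simps)
  qed
  have "(1 - (half_angle s)\<^sup>2)\<^sup>2 + (2 * half_angle s)\<^sup>2 = (1 + (half_angle s)\<^sup>2)\<^sup>2"
    by (simp add: power2_eq_square algebra_simps)
  moreover have "1 + (half_angle s)\<^sup>2 \<noteq> 0" using one_plus_square_pos[of "half_angle s"] by simp
  ultimately show "(cos2 s)\<^sup>2 + (sin2 s)\<^sup>2 = 1"
    by (simp add: cos2_def sin2_def power_divide add_divide_distrib[symmetric])
qed

lemma \<alpha>2_eq: "\<alpha>2 = (\<lambda>s. (y2 s, z2 s))"
  by (rule ext) (simp add: \<alpha>2_def)

text \<open>The combination \<open>2 ln y + z\<close> eliminates \<open>ln \<kappa>\<close> and leaves the angle.  So the position on the curve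
  determines the parameter, continuously.\<close>

lemma \<alpha>2_angle: "half_angle s = tan ((2 * ln (y2 s) + z2 s) / 2)"
proof -
  have "(2 * ln (y2 s) + z2 s) / 2 = arctan (half_angle s)" by (simp add: y2_eq z2_eq algebra_simps)
  then show ?thesis by (simp add: tan_arctan)
qed

lemma embedded_curve_\<alpha>1: "embedded_curve \<alpha>1"
  unfolding \<alpha>1_eq
  by (rule translator_profile.embedded_curve_profile[OF profile_\<alpha>1, of "\<lambda>(y, z). sqrt 5 * ln y"])
    (auto intro!: continuous_intros simp: split_beta)

lemma embedded_curve_\<alpha>2: "embedded_curve \<alpha>2"
  unfolding \<alpha>2_eq
proof (rule translator_profile.embedded_curve_profile[OF profile_\<alpha>2])
  let ?t = "\<lambda>p :: real \<times> real. (2 * ln (fst p) + snd p) / 2"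
  show "half_angle_inv (tan (?t (y2 s, z2 s))) = s" for s
    by (simp add: \<alpha>2_angle[symmetric] half_angle_inv_half_angle)
  have "continuous_on (range (\<lambda>s. (y2 s, z2 s))) (\<lambda>p. tan (?t p))"
  proof (rule continuous_on_compose2[of "{x. cos x \<noteq> 0}" tan])
    show "continuous_on {x :: real. cos x \<noteq> 0} tan"
      by (auto intro!: continuous_at_imp_continuous_on isCont_tan)
    show "continuous_on (range (\<lambda>s. (y2 s, z2 s))) ?t"
      using translator_profile.y_pos[OF profile_\<alpha>2]
      by (auto intro!: continuous_intros simp: less_le)
    have t: "?t (y2 s, z2 s) = arctan (half_angle s)" for s
      by (simp add: y2_eq z2_eq algebra_simps)
    show "?t ` range (\<lambda>s. (y2 s, z2 s)) \<subseteq> {x. cos x \<noteq> 0}"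
      unfolding image_image t by auto
  qed
  moreover have "(\<lambda>p. tan (?t p)) ` range (\<lambda>s. (y2 s, z2 s)) \<subseteq> {r. 1 + r - r\<^sup>2 > 0}"
    using half_angle_pos by (auto simp: \<alpha>2_angle[symmetric])
  ultimately show "continuous_on (range (\<lambda>s. (y2 s, z2 s))) (\<lambda>p. half_angle_inv (tan (?t p)))"
    by (rule continuous_on_compose2[OF continuous_half_angle_inv])
qed

lemma increasing_if_derivative_pos:
  fixes f :: "real \<Rightarrow> real"
  assumes f: "\<And>s. (f has_real_derivative f' s) (at s)"
    and pos: "\<And>s. a < s \<Longrightarrow> s < b \<Longrightarrow> f' s > 0" and "a < b"
  shows "f a < f b"
proof -
  obtain s where "a < s" "s < b" "f b - f a = (b - a) * f' s"
    using MVT2[OF \<open>a < b\<close> f] by blast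
  moreover have "(b - a) * f' s > 0"
    using pos[OF \<open>a < s\<close> \<open>s < b\<close>] \<open>a < b\<close> by (intro mult_pos_pos) auto
  ultimately show ?thesis by linarith
qed

lemma half_angle_strict_mono: "strict_mono half_angle"
  by (rule strict_monoI)
    (rule increasing_if_derivative_pos[OF half_angle_derivative half_angle_pos])

lemma half_angle_gt_minus_one: "half_angle s > - 1"
  using half_angle_pos[of s] zero_le_power2[of "half_angle s"] by linarith

text \<open>The parameters with vertical and with horizontal tangent, \<open>\<theta> = pi / 2\<close> and \<open>\<theta> = 0\<close>.\<close>

definition s_right :: real where "s_right = half_angle_inv 1"
definition s_bottom :: real where "s_bottom = half_angle_inv 0"

lemma half_angle_special: "half_angle s_right = 1" "half_angle s_bottom = 0"
  by (simp_all add: s_right_def s_bottom_def half_angle_half_angle_inv)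

lemma sign_cos2: "s < s_right \<Longrightarrow> cos2 s > 0" "s > s_right \<Longrightarrow> cos2 s < 0"
proof -
  have sq: "\<bar>half_angle s\<bar> < 1" if "s < s_right"
    using strict_monoD[OF half_angle_strict_mono that] half_angle_gt_minus_one[of s]
    by (simp add: half_angle_special)
  show "s < s_right \<Longrightarrow> cos2 s > 0"
    using sq one_plus_square_pos[of "half_angle s"] by (simp add: cos2_def abs_square_less_1)
  assume "s > s_right"
  then have "half_angle s > 1"
    using strict_monoD[OF half_angle_strict_mono, of s_right s] by (simp add: half_angle_special)
  then have "(half_angle s)\<^sup>2 > 1" by (simp add: one_less_power)
  then show "cos2 s < 0"
    using one_plus_square_pos[of "half_angle s"] by (simp add: cos2_def divide_neg_pos)
qed

lemma sign_sin2: "s < s_bottom \<Longrightarrow> sin2 s < 0" "s > s_bottom \<Longrightarrow> sin2 s > 0"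
  using strict_monoD[OF half_angle_strict_mono, of s s_bottom]
    strict_monoD[OF half_angle_strict_mono, of s_bottom s] one_plus_square_pos[of "half_angle s"]
  by (simp_all add: sin2_def half_angle_special divide_neg_pos)

lemmas y2_pos = translator_profile.y_pos[OF profile_\<alpha>2]
lemmas y2_derivative = translator_profile.y'[OF profile_\<alpha>2]
lemmas z2_derivative = translator_profile.z'[OF profile_\<alpha>2]

lemma isCont_y2: "isCont y2 s" and isCont_z2: "isCont z2 s"
  by (rule DERIV_isCont[OF y2_derivative] DERIV_isCont[OF z2_derivative])+

lemma y2_increasing: "a < b \<Longrightarrow> b \<le> s_right \<Longrightarrow> y2 a < y2 b"
  by (rule increasing_if_derivative_pos[OF y2_derivative]) (simp_all add: sign_cos2(1) y2_pos)

lemma z2_increasing: "s_bottom \<le> a \<Longrightarrow> a < b \<Longrightarrow> z2 a < z2 b"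
  by (rule increasing_if_derivative_pos[OF z2_derivative]) (simp_all add: sign_sin2(2))

lemma y2_decreasing: "s_right \<le> a \<Longrightarrow> a < b \<Longrightarrow> y2 b < y2 a"
  using increasing_if_derivative_pos[OF DERIV_minus[OF y2_derivative], of a b]
  by (simp add: sign_cos2(2) y2_pos mult_neg_pos)

lemma z2_decreasing: "a < b \<Longrightarrow> b \<le> s_bottom \<Longrightarrow> z2 b < z2 a"
  using increasing_if_derivative_pos[OF DERIV_minus[OF z2_derivative], of a b]
  by (simp add: sign_sin2(1))

lemma y2_max: "y2 s \<le> y2 s_right"
  using y2_increasing[of s s_right] y2_decreasing[of s_right s]
  by (cases s s_right rule: linorder_cases) auto

lemma z2_min: "z2 s_bottom \<le> z2 s"
  using z2_decreasing[of s s_bottom] z2_increasing[of s_bottom s]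
  by (cases s s_bottom rule: linorder_cases) auto

lemma vertical_graph_\<alpha>1: "vertical_graph (range \<alpha>1)"
  unfolding \<alpha>1_eq
  by (rule vertical_graph_image) (auto intro!: continuous_intros inj_onI)

lemma vertical_bigraph_\<alpha>2: "vertical_bigraph (range \<alpha>2)"
proof -
  have "inj_on y2 {..s_right}"
    by (rule linorder_inj_onI) (use y2_increasing in \<open>force+\<close>)
  then have 1: "vertical_graph ((\<lambda>s. (y2 s, z2 s)) ` {..s_right})"
    by (intro vertical_graph_image)
      (auto intro!: continuous_at_imp_continuous_on isCont_y2 isCont_z2 simp: y2_pos is_interval_ic)
  have "inj_on y2 {s_right..}"
    by (rule linorder_inj_onI) (use y2_decreasing in \<open>force+\<close>)
  then have 2: "vertical_graph ((\<lambda>s. (y2 s, z2 s)) ` {s_right..})"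
    by (intro vertical_graph_image)
      (auto intro!: continuous_at_imp_continuous_on isCont_y2 isCont_z2 simp: y2_pos is_interval_ci)
  have "range \<alpha>2 = (\<lambda>s. (y2 s, z2 s)) ` {..s_right} \<union> (\<lambda>s. (y2 s, z2 s)) ` {s_right..}"
    unfolding \<alpha>2_eq image_Un[symmetric] by (rule arg_cong[of _ _ "image _"]) auto
  then show ?thesis using 1 2 unfolding vertical_bigraph_def by blast
qed

text \<open>The factor \<open>exp (4/5 * arctan w)\<close> is bounded, and \<open>\<kappa>\<close> is at most \<open>10 * exp (- sqrt 5 * \<bar>s\<bar>)\<close>,
  since \<open>sqrt 5 < 3\<close> bounds its denominator from below by \<open>2 cosh (sqrt 5 * s)\<close>.\<close>

lemma y2_bound: "y2 s \<le> exp (2 + 2/5 * pi) * exp (- (1 / sqrt 5) * \<bar>s\<bar>)"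
proof -
  let ?x = "sqrt 5 * s"
  have s5: "sqrt 5 < 3" by (rule real_less_lsqrt) auto
  have "\<bar>sinh ?x\<bar> \<le> cosh ?x" by (simp add: abs_le_iff sinh_le_cosh_real) (metis cosh_minus sinh_le_cosh_real sinh_minus)
  then have "sqrt 5 * \<bar>sinh ?x\<bar> \<le> 3 * cosh ?x" using s5 by (intro mult_mono) auto
  then have "- (3 * cosh ?x) \<le> sqrt 5 * sinh ?x" by (cases "sinh ?x \<ge> 0") (auto simp: abs_if intro: order_trans[of _ 0])
  then have ge: "2 * cosh ?x \<le> sqrt 5 * sinh ?x + 5 * cosh ?x" by simp
  have "exp \<bar>?x\<bar> \<le> 2 * cosh ?x"
    by (simp add: cosh_def abs_if)
  with ge have ge': "exp \<bar>?x\<bar> \<le> sqrt 5 * sinh ?x + 5 * cosh ?x" by linarith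
  have "2 * cos2 s + sin2 s \<le> 10 / exp \<bar>?x\<bar>"
    unfolding angle_speed_hyperbolic using ge' by (intro divide_left_mono) (auto intro!: mult_pos_pos intro: less_le_trans[of 0 "exp \<bar>?x\<bar>"])
  then have "ln (2 * cos2 s + sin2 s) \<le> ln (10 / exp \<bar>?x\<bar>)"
    using angle_speed_pos[of s] by (subst ln_le_cancel_iff) auto
  also have "\<dots> = ln 10 - sqrt 5 * \<bar>s\<bar>" by (simp add: ln_div abs_mult)
  also have "ln 10 \<le> (10 :: real)" using ln_le_minus_one[of 10] by simp
  finally have l: "ln (2 * cos2 s + sin2 s) \<le> 10 - sqrt 5 * \<bar>s\<bar>" by simp
  define u where "u = 1 / sqrt 5 * \<bar>s\<bar>"
  have "sqrt 5 = 5 * (1 / sqrt 5)" using real_div_sqrt[of 5] by simp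
  then have "sqrt 5 * \<bar>s\<bar> = 5 * u" unfolding u_def by (metis mult.assoc)
  moreover have "arctan (half_angle s) \<le> pi / 2" using arctan_ubound[of "half_angle s"] by simp
  ultimately have "1/5 * ln (2 * cos2 s + sin2 s) + 4/5 * arctan (half_angle s) \<le> (2 + 2/5 * pi) + - u"
    using l by simp
  then have "y2 s \<le> exp ((2 + 2/5 * pi) + - u)" by (simp only: y2_eq exp_le_cancel_iff)
  then show ?thesis by (simp only: exp_add u_def mult_minus_left)
qed

lemma y2_tendsto_0:
  assumes "filterlim (\<lambda>s::real. \<bar>s\<bar>) at_top G"
  shows "(y2 \<longlongrightarrow> 0) G"
proof (rule real_tendsto_sandwich[of "\<lambda>_. 0"])
  have "filterlim (\<lambda>s. - (1 / sqrt 5) * \<bar>s\<bar>) at_bot G"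
    by (rule filterlim_tendsto_neg_mult_at_bot[OF tendsto_const _ assms]) simp
  then have "((\<lambda>s. exp (- (1 / sqrt 5) * \<bar>s\<bar>)) \<longlongrightarrow> 0) G"
    by (rule filterlim_compose[OF exp_at_bot])
  from tendsto_mult_right_zero[OF this]
  show "((\<lambda>s. exp (2 + 2/5 * pi) * exp (- (1 / sqrt 5) * \<bar>s\<bar>)) \<longlongrightarrow> 0) G" .
  show "\<forall>\<^sub>F s in G. 0 \<le> y2 s" using y2_pos by (simp add: less_imp_le)
  show "\<forall>\<^sub>F s in G. y2 s \<le> exp (2 + 2/5 * pi) * exp (- (1 / sqrt 5) * \<bar>s\<bar>)"
    by (rule always_eventually) (intro allI y2_bound)
qed simp

lemma ideal_contact_\<alpha>2:
  "ideal_contact (\<lambda>s. param \<alpha>2 (s, t)) at_bot (Line t)"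
  "ideal_contact (\<lambda>s. param \<alpha>2 (s, t)) at_top (Line t)"
proof -
  have "filterlim (\<lambda>s::real. \<bar>s\<bar>) at_top at_bot"
    using filterlim_at_infinity_imp_norm_at_top[OF filterlim_mono[OF filterlim_ident at_bot_le_at_infinity order_refl]] by simp
  from y2_tendsto_0[OF this] y2_tendsto_0[OF filterlim_abs_real]
  show "ideal_contact (\<lambda>s. param \<alpha>2 (s, t)) at_bot (Line t)"
    "ideal_contact (\<lambda>s. param \<alpha>2 (s, t)) at_top (Line t)"
    by (auto simp: param_def \<alpha>2_def intro!: tendsto_Pair)
qed

lemma ideal_contact_\<alpha>1: "ideal_contact (\<lambda>s. param \<alpha>1 (s, 0)) at_bot (Line 0)"
proof -
  have "filterlim (\<lambda>s. 1 / sqrt 5 * s) at_bot at_bot"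
    by (rule filterlim_tendsto_pos_mult_at_bot[OF tendsto_const _ filterlim_ident]) simp
  then have "((\<lambda>s. exp (s / sqrt 5)) \<longlongrightarrow> 0) at_bot"
    using filterlim_compose[OF exp_at_bot] by fastforce
  then show ?thesis by (auto simp: param_def \<alpha>1_def intro!: tendsto_Pair)
qed

lemma unbounded_height_\<alpha>1: "\<not> bounded (range (\<lambda>s. snd (\<alpha>1 s)))"
proof -
  have "snd (\<alpha>1 (- (sqrt 5 * r / 2))) = r" for r by (simp add: \<alpha>1_def)
  then have "r \<in> range (\<lambda>s. snd (\<alpha>1 s))" for r by (rule range_eqI[OF sym])
  then have "range (\<lambda>s. snd (\<alpha>1 s)) = UNIV" by blast
  then show ?thesis by (simp add: not_bounded_UNIV)
qed

section \<open>Surfaces with a global arc length coordinate\<close>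

lemma local_diffeomorphism:
  fixes Q :: "'a::euclidean_space \<Rightarrow> 'a"
  assumes U: "open U" "p \<in> U"
    and Q: "\<And>q. q \<in> U \<Longrightarrow> (Q has_derivative Q' q) (at q)"
    and cont: "\<And>v. continuous_on U (\<lambda>q. Q' q v)"
    and inj: "inj (Q' p)"
  obtains B where "open B" "p \<in> B" "B \<subseteq> U" "inj_on Q B"
    "\<And>A. open A \<Longrightarrow> A \<subseteq> B \<Longrightarrow> open (Q ` A)"
proof -
  have bl: "bounded_linear (Q' q)" if "q \<in> U" for q
    using Q[OF that] by (rule has_derivative_bounded_linear)
  have app: "blinfun_apply (Blinfun (Q' q)) = Q' q" if "q \<in> U" for q
    using bounded_linear_Blinfun_apply[OF bl[OF that]] .
  obtain G where G: "linear G" "G \<circ> Q' p = id"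
    using linear_injective_left_inverse[OF _ inj] has_derivative_linear[OF Q[OF U(2)]] by blast
  have "blinfun_apply (Blinfun G) = G"
    using G(1) by (simp add: bounded_linear_Blinfun_apply linear_conv_bounded_linear)
  then have inv: "Blinfun G o\<^sub>L Blinfun (Q' p) = id_blinfun"
    using G(2) by (intro blinfun_eqI) (simp add: app[OF U(2)] fun_eq_iff)
  have contB: "continuous_on U (\<lambda>q. Blinfun (Q' q))"
  proof (rule continuous_on_blinfun_componentwise)
    show "continuous_on U (\<lambda>q. blinfun_apply (Blinfun (Q' q)) i)" for i
      by (rule continuous_on_eq[OF cont[of i]]) (simp add: app)
  qed
  have Q_blinfun: "(Q has_derivative blinfun_apply (Blinfun (Q' q))) (at q)" if "q \<in> U" for q
    using Q[OF that] by (simp add: app[OF that])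
  obtain B V g where B: "open B" "B \<subseteq> U" "p \<in> B" "open V" "homeomorphism B V Q g"
    by (rule inverse_function_theorem[of U Q "\<lambda>q. Blinfun (Q' q)" p "Blinfun G",
          OF U(1) Q_blinfun contB U(2) inv])
  have "inj_on Q B" using B(5) by (metis homeomorphism_def inj_on_inverseI)
  moreover have "open (Q ` A)" if "open A" "A \<subseteq> B" for A
  proof -
    have "openin (top_of_set B) A" using that by (simp add: openin_open_eq B)
    then have "openin (top_of_set V) (Q ` A)"
      using homeomorphism_imp_open_map[OF B(5)] by blast
    then show ?thesis using B(4) openin_open_trans by blast
  qed
  ultimately show thesis using that B by blast
qed

lemma (in translator_profile) dilate_shift_param:
  "dilate_shift l c (param curve p) = vector [l * snd p, l * y (fst p), z (fst p) + c]"
  by (simp add: dilate_shift_def param_curve)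

text \<open>The map \<open>P = (\<sigma>, x / l)\<close> factors \<open>F\<close> through the model surface.  Therefore its differential is injective where
  that of \<open>F\<close> is, and it is equivariant because the model is injective.  The time of the action is rescaled by \<open>l\<close>, for
  the dilation multiplies \<open>x\<close> by \<open>l\<close>.\<close>

lemma (in translator_profile) grim_reaper_from_arc_length:
  fixes M :: "'a topology"
  assumes surf: "immersed_surface M A F" and invar: "parabolic_invariant M F"
    and inj: "inj curve" and l: "l > 0"
    and F: "\<And>m. m \<in> topspace M \<Longrightarrow> F m = dilate_shift l c (param curve (\<sigma> m, F m $ 1 / l))"
    and \<sigma>: "\<And>U \<phi> p. (U, \<phi>) \<in> A \<Longrightarrow> p \<in> U \<Longrightarrow> ((\<sigma> \<circ> \<phi>) has_derivative \<sigma>' U \<phi> p) (at p)"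
    and \<sigma>'_cont: "\<And>U \<phi> v. (U, \<phi>) \<in> A \<Longrightarrow> continuous_on U (\<lambda>p. \<sigma>' U \<phi> p v)"
  shows "\<exists>J h. open J \<and> is_interval J \<and> J \<noteq> {} \<and>
      homeomorphic_map (top_of_set (J \<times> UNIV)) M h \<and>
      (\<forall>s\<in>J. \<forall>t. F (h (s, t)) = dilate_shift l c (param curve (s, t)))"
proof -
  define P where "P = (\<lambda>m. (\<sigma> m, F m $ 1 / l))"
  have FP: "F m = dilate_shift l c (param curve (P m))" if "m \<in> topspace M" for m
    using F[OF that] by (simp add: P_def)
  define P' where "P' = (\<lambda>U \<phi> p v. (\<sigma>' U \<phi> p v, frechet_derivative (F \<circ> \<phi>) (at p) v $ 1 / l))"
  have P': "((P \<circ> \<phi>) has_derivative P' U \<phi> p) (at p)" if ch: "(U, \<phi>) \<in> A" and p: "p \<in> U" for U \<phi> p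
  proof -
    have "((\<lambda>q. (F \<circ> \<phi>) q $ 1 / l) has_derivative (\<lambda>v. frechet_derivative (F \<circ> \<phi>) (at p) v $ 1 / l)) (at p)"
      using has_derivative_vec_nth[OF smooth_on_has_derivative[OF chart_smooth[OF surf ch] p], of 1]
      by (rule bounded_linear.has_derivative[OF bounded_linear_divide])
    from has_derivative_Pair[OF \<sigma>[OF ch p] this] show ?thesis
      by (simp add: P_def P'_def o_def)
  qed
  have P'_cont: "continuous_on U (\<lambda>p. P' U \<phi> p v)" if ch: "(U, \<phi>) \<in> A" for U \<phi> v
    unfolding P'_def using l
    by (intro continuous_on_Pair \<sigma>'_cont[OF ch] continuous_on_divide continuous_on_const
        bounded_linear.continuous_on[OF bounded_linear_vec_nth]
        smooth_on_continuous_derivative[OF chart_smooth[OF surf ch]]) auto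
  have P'_inj: "inj (P' U \<phi> p)" if ch: "(U, \<phi>) \<in> A" and p: "p \<in> U" for U \<phi> p
  proof -
    define E where "E = (\<lambda>q. vector [l * snd q, l * y (fst q), z (fst q) + c] :: real^3)"
    have "(E has_derivative (\<lambda>v. vector [l * snd v, l * C (fst q) * y (fst q) * fst v, S (fst q) * fst v])) (at q)" for q
      unfolding E_def
      by (intro has_derivative_vector_3)
        (auto intro!: derivative_eq_intros has_derivative_comp_fst[OF y'] has_derivative_comp_fst[OF z'] simp: mult.assoc)
    then obtain E' where E': "(E has_derivative E') (at ((P \<circ> \<phi>) p))" by blast
    have "((\<lambda>q. E ((P \<circ> \<phi>) q)) has_derivative (\<lambda>v. E' (P' U \<phi> p v))) (at p)"
      by (rule has_derivative_compose[OF P'[OF ch p] E'])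
    moreover have "E ((P \<circ> \<phi>) q) = (F \<circ> \<phi>) q" if "q \<in> U" for q
      using FP[OF chart_in_topspace[OF surf ch that]] by (simp add: E_def dilate_shift_param)
    ultimately have "((F \<circ> \<phi>) has_derivative (\<lambda>v. E' (P' U \<phi> p v))) (at p)"
      by (rule has_derivative_transform_within_open[OF _ chart_open[OF surf ch] p])
    then have "inj (\<lambda>v. E' (P' U \<phi> p v))"
      using chart_immersion[OF surf ch p] by (simp add: frechet_derivative_eqI)
    then show ?thesis by (metis injD injI)
  qed
  have local: "\<exists>B. open B \<and> p \<in> B \<and> B \<subseteq> U \<and> inj_on (P \<circ> \<phi>) B \<and> (\<forall>A. open A \<longrightarrow> A \<subseteq> B \<longrightarrow> open ((P \<circ> \<phi>) ` A))"
    if ch: "(U, \<phi>) \<in> A" and p: "p \<in> U" for U \<phi> p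
    by (rule local_diffeomorphism[OF chart_open[OF surf ch] p P'[OF ch] P'_cont[OF ch] P'_inj[OF ch p]]) blast+
  have cont: "continuous_map M euclidean P"
    unfolding continuous_map_def
  proof (intro conjI allI impI)
    fix O' :: "(real \<times> real) set" assume "openin euclidean O'"
    then have O': "open O'" by simp
    show "openin M {m \<in> topspace M. P m \<in> O'}"
    proof (subst openin_subopen, rule ballI)
      fix m assume m: "m \<in> {m \<in> topspace M. P m \<in> O'}"
      then obtain U \<phi> p where ch: "(U, \<phi>) \<in> A" and p: "p \<in> U" "m = \<phi> p"
        using immersed_surface_covered[OF surf] by blast
      have "continuous_on U (P \<circ> \<phi>)"
        using P'[OF ch] by (intro continuous_at_imp_continuous_on ballI has_derivative_continuous)
      then have "open ((P \<circ> \<phi>) -` O' \<inter> U)"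
        using O' continuous_on_open_vimage[OF chart_open[OF surf ch]] by blast
      then have "openin M (\<phi> ` ((P \<circ> \<phi>) -` O' \<inter> U))"
        by (intro chart_open_image[OF surf ch]) auto
      moreover have "m \<in> \<phi> ` ((P \<circ> \<phi>) -` O' \<inter> U)" using p m by auto
      moreover have "\<phi> ` ((P \<circ> \<phi>) -` O' \<inter> U) \<subseteq> {m \<in> topspace M. P m \<in> O'}"
        using chart_in_topspace[OF surf ch] by auto
      ultimately show "\<exists>T. openin M T \<and> m \<in> T \<and> T \<subseteq> {m \<in> topspace M. P m \<in> O'}" by blast
    qed
  qed auto
  have opn: "open_map M euclidean P"
    unfolding open_map_def
  proof (intro allI impI)
    fix W assume W: "openin M W"
    have "\<exists>T. open T \<and> r \<in> T \<and> T \<subseteq> P ` W" if r: "r \<in> P ` W" for r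
    proof -
      obtain m where m: "m \<in> W" "r = P m" using r by blast
      then have "m \<in> topspace M" using W openin_subset by blast
      then obtain U \<phi> p where ch: "(U, \<phi>) \<in> A" and p: "p \<in> U" "m = \<phi> p"
        using immersed_surface_covered[OF surf] by blast
      obtain B where B: "open B" "p \<in> B" "B \<subseteq> U" "\<And>A. open A \<Longrightarrow> A \<subseteq> B \<Longrightarrow> open ((P \<circ> \<phi>) ` A)"
        using local[OF ch p(1)] by blast
      have "continuous_map (top_of_set U) M \<phi>"
        using homeomorphic_imp_continuous_map[OF chart_homeomorphic[OF surf ch]]
        by (simp add: continuous_map_in_subtopology)
      from openin_continuous_map_preimage[OF this W]
      have "open {q \<in> U. \<phi> q \<in> W}"
        using chart_open[OF surf ch] by (simp add: openin_open_eq)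
      then have "open ({q \<in> U. \<phi> q \<in> W} \<inter> B)" using B(1) by blast
      then have "open ((P \<circ> \<phi>) ` ({q \<in> U. \<phi> q \<in> W} \<inter> B))" by (rule B(4)) blast
      moreover have "r \<in> (P \<circ> \<phi>) ` ({q \<in> U. \<phi> q \<in> W} \<inter> B)"
        using m p B by (auto intro!: image_eqI[of _ _ p])
      moreover have "(P \<circ> \<phi>) ` ({q \<in> U. \<phi> q \<in> W} \<inter> B) \<subseteq> P ` W" by auto
      ultimately show ?thesis by blast
    qed
    then show "openin euclidean (P ` W)" by (subst open_openin[symmetric], subst open_subopen) blast
  qed
  have locinj: "\<exists>V. openin M V \<and> m \<in> V \<and> inj_on P V" if m: "m \<in> topspace M" for m
  proof -
    obtain U \<phi> p where ch: "(U, \<phi>) \<in> A" and p: "p \<in> U" "m = \<phi> p"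
      using immersed_surface_covered[OF surf m] .
    obtain B where B: "open B" "p \<in> B" "B \<subseteq> U" "inj_on (P \<circ> \<phi>) B"
      using local[OF ch p(1)] by blast
    have "inj_on P (\<phi> ` B)" using B(4) by (rule inj_on_imageI)
    then show ?thesis using chart_open_image[OF surf ch B(1,3)] p B(2) by blast
  qed
  obtain \<Phi> where \<Phi>: "continuous_map (prod_topology euclideanreal M) M (\<lambda>(t, m). \<Phi> t m)"
    and \<Phi>0: "\<And>m. m \<in> topspace M \<Longrightarrow> \<Phi> 0 m = m"
    and \<Phi>add: "\<And>m s t. m \<in> topspace M \<Longrightarrow> \<Phi> (s + t) m = \<Phi> s (\<Phi> t m)"
    and F\<Phi>: "\<And>m t. m \<in> topspace M \<Longrightarrow> F (\<Phi> t m) = parabolic_translation t (F m)"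
    using invar unfolding parabolic_invariant_def by blast
  define \<Psi> where "\<Psi> = (\<lambda>t. \<Phi> (l * t))"
  have \<Psi>: "continuous_map (prod_topology euclideanreal M) M (\<lambda>(t, m). \<Psi> t m)"
  proof -
    have "continuous_map (prod_topology euclideanreal M) euclideanreal (\<lambda>x. l * fst x)"
      by (intro continuous_map_real_mult continuous_map_fst) simp_all
    then have "continuous_map (prod_topology euclideanreal M) (prod_topology euclideanreal M) (\<lambda>x. (l * fst x, snd x))"
      by (simp add: continuous_map_pairwise o_def continuous_map_snd)
    from continuous_map_compose[OF this \<Phi>] show ?thesis
      by (simp add: \<Psi>_def o_def case_prod_beta')
  qed
  have P\<Psi>: "P (\<Psi> t m) = P m + (0, t)" if m: "m \<in> topspace M" for t m
  proof -
    have \<Phi>m: "\<Phi> (l * t) m \<in> topspace M"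
      using continuous_map_image_subset_topspace[OF \<Phi>] m by fastforce
    have "dilate_shift l c (param curve (P (\<Phi> (l * t) m))) =
        parabolic_translation (l * t) (dilate_shift l c (param curve (P m)))"
      using F\<Phi>[OF m, of "l * t"] by (simp only: FP[OF m] FP[OF \<Phi>m])
    then have "l * snd (P (\<Phi> (l * t) m)) = l * snd (P m) + l * t"
        "l * y (fst (P (\<Phi> (l * t) m))) = l * y (fst (P m))"
        "z (fst (P (\<Phi> (l * t) m))) = z (fst (P m))"
      by (simp_all add: dilate_shift_param parabolic_translation_def vec_eq_iff forall_3)
    then have eqs: "l * snd (P (\<Phi> (l * t) m)) = l * (snd (P m) + t)"
        "curve (fst (P (\<Phi> (l * t) m))) = curve (fst (P m))"
      using l by (simp_all add: distrib_left)
    have "snd (P (\<Phi> (l * t) m)) = snd (P m) + t" using eqs(1) l by (simp only: mult_cancel_left) simp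
    moreover have "fst (P (\<Phi> (l * t) m)) = fst (P m)" by (rule injD[OF inj eqs(2)])
    ultimately show ?thesis by (simp add: \<Psi>_def prod_eq_iff)
  qed
  have "Hausdorff_space M" "connected_space M" "topspace M \<noteq> {}"
    using surf unfolding immersed_surface_def by blast+
  then obtain J h where J: "open J" "is_interval J" "J \<noteq> {}"
    and h: "homeomorphic_map (top_of_set (J \<times> UNIV)) M h" and Ph: "\<And>s t. s \<in> J \<Longrightarrow> P (h (s, t)) = (s, t)"
    using equivariant_local_homeomorphism[OF _ _ _ cont opn locinj \<Psi> _ _ P\<Psi>] \<Phi>0 \<Phi>add
    by (auto simp: \<Psi>_def distrib_left)
  have "F (h (s, t)) = dilate_shift l c (param curve (s, t))" if "s \<in> J" for s t
  proof -
    have "h (s, t) \<in> topspace M"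
      using homeomorphic_imp_surjective_map[OF h] that by auto
    then show ?thesis using FP Ph[OF that] by metis
  qed
  then show ?thesis using J h by blast
qed

section \<open>Integration and classification\<close>

lemma constant_on_charts:
  fixes f :: "'a \<Rightarrow> real"
  assumes surf: "immersed_surface M A F"
    and f: "\<And>U \<phi> p. (U, \<phi>) \<in> A \<Longrightarrow> p \<in> U \<Longrightarrow> ((f \<circ> \<phi>) has_derivative (\<lambda>v. 0)) (at p)"
  shows "\<exists>c. \<forall>m\<in>topspace M. f m = c"
proof -
  have loc: "\<exists>T. openin M T \<and> m \<in> T \<and> (\<forall>n\<in>T. f n = f m)" if m: "m \<in> topspace M" for m
  proof -
    obtain U \<phi> p where ch: "(U, \<phi>) \<in> A" and p: "p \<in> U" "m = \<phi> p"
      using immersed_surface_covered[OF surf m] .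
    obtain e where e: "e > 0" "ball p e \<subseteq> U"
      using chart_open[OF surf ch] p openE by blast
    have "((f \<circ> \<phi>) has_derivative (\<lambda>v. 0)) (at q within ball p e)" if "q \<in> ball p e" for q
      by (rule has_derivative_at_withinI, rule f[OF ch]) (use e that in blast)
    then have "(f \<circ> \<phi>) q = (f \<circ> \<phi>) p" if "q \<in> ball p e" for q
      using has_derivative_zero_unique[OF convex_ball, of p e "f \<circ> \<phi>" q p] that e(1)
      by (meson centre_in_ball)
    then have "\<forall>n\<in>\<phi> ` ball p e. f n = f m" by (simp add: p(2))
    moreover have "openin M (\<phi> ` ball p e)"
      by (rule chart_open_image[OF surf ch open_ball e(2)])
    moreover have "m \<in> \<phi> ` ball p e" using p(2) e(1) by simp
    ultimately show ?thesis by blast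
  qed
  have conn: "connected_space M" and "topspace M \<noteq> {}" using surf unfolding immersed_surface_def by blast+
  then obtain m0 where m0: "m0 \<in> topspace M" by blast
  define W where "W = {m \<in> topspace M. f m = f m0}"
  have nbhd: "\<exists>T. openin M T \<and> m \<in> T \<and> T \<subseteq> topspace M \<and> (\<forall>n\<in>T. f n = f m)" if "m \<in> topspace M" for m
    using loc[OF that] openin_subset by blast
  have "openin M W"
  proof (subst openin_subopen, rule ballI)
    fix m assume "m \<in> W"
    then have m: "m \<in> topspace M" "f m = f m0" by (auto simp: W_def)
    obtain T where "openin M T" "m \<in> T" "T \<subseteq> topspace M" "\<forall>n\<in>T. f n = f m" using nbhd[OF m(1)] by blast
    then show "\<exists>T. openin M T \<and> m \<in> T \<and> T \<subseteq> W" using m by (intro exI[of _ T]) (auto simp: W_def)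
  qed
  moreover have "openin M (topspace M - W)"
  proof (subst openin_subopen, rule ballI)
    fix m assume "m \<in> topspace M - W"
    then have m: "m \<in> topspace M" "f m \<noteq> f m0" by (auto simp: W_def)
    obtain T where T: "openin M T" "m \<in> T" "T \<subseteq> topspace M" "\<forall>n\<in>T. f n = f m"
      using nbhd[OF m(1)] by blast
    have "n \<notin> W" if "n \<in> T" for n
      using bspec[OF T(4) that] m(2) by (simp add: W_def)
    then show "\<exists>T. openin M T \<and> m \<in> T \<and> T \<subseteq> topspace M - W" using T by blast
  qed
  then have "closedin M W" by (auto simp: closedin_def W_def)
  moreover have "m0 \<in> W" using m0 by (simp add: W_def)
  ultimately have "W = topspace M" using conn by (auto simp: connected_space_clopen_in)
  then show ?thesis unfolding W_def by blast
qed

lemma chart_derivatives: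
  assumes surf: "immersed_surface M A F" and ch: "(U, \<phi>) \<in> A" and p: "p \<in> U"
  shows "((\<lambda>q. F (\<phi> q) $ i) has_derivative (\<lambda>v. frechet_derivative (F \<circ> \<phi>) (at p) v $ i)) (at p)"
    and "((\<lambda>q. ln (F (\<phi> q) $ 2)) has_derivative
           (\<lambda>v. frechet_derivative (F \<circ> \<phi>) (at p) v $ 2 / F (\<phi> p) $ 2)) (at p)"
proof -
  show X: "((\<lambda>q. F (\<phi> q) $ i) has_derivative (\<lambda>v. frechet_derivative (F \<circ> \<phi>) (at p) v $ i)) (at p)" for i
    using has_derivative_vec_nth[OF smooth_on_has_derivative[OF chart_smooth[OF surf ch] p], of i]
    by simp
  have y: "F (\<phi> p) $ 2 > 0" by (rule chart_in_H2R[OF surf ch p])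
  show "((\<lambda>q. ln (F (\<phi> q) $ 2)) has_derivative
      (\<lambda>v. frechet_derivative (F \<circ> \<phi>) (at p) v $ 2 / F (\<phi> p) $ 2)) (at p)"
    by (rule has_derivative_eq_rhs[OF has_derivative_ln[OF y X]]) (simp add: fun_eq_iff divide_inverse)
qed

lemma chart_derivatives_continuous:
  assumes surf: "immersed_surface M A F" and ch: "(U, \<phi>) \<in> A"
  shows "continuous_on U (\<lambda>p. frechet_derivative (F \<circ> \<phi>) (at p) v $ i)"
    and "continuous_on U (\<lambda>p. frechet_derivative (F \<circ> \<phi>) (at p) v $ 2 / F (\<phi> p) $ 2)"
proof -
  show X': "continuous_on U (\<lambda>p. frechet_derivative (F \<circ> \<phi>) (at p) v $ i)" for i
    by (rule bounded_linear.continuous_on[OF bounded_linear_vec_nth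
          smooth_on_continuous_derivative[OF chart_smooth[OF surf ch]]])
  have "continuous_on U (\<lambda>p. F (\<phi> p) $ 2)"
    by (intro continuous_at_imp_continuous_on ballI has_derivative_continuous[OF chart_derivatives(1)[OF surf ch]])
  then show "continuous_on U (\<lambda>p. frechet_derivative (F \<circ> \<phi>) (at p) v $ 2 / F (\<phi> p) $ 2)"
    by (intro continuous_on_divide X') (use chart_in_H2R[OF surf ch] in \<open>auto simp: less_le\<close>)
qed

text \<open>By the system, \<open>d\<kappa> = - 2 \<kappa> dz + \<kappa> du\<close>.\<close>

lemma angle_speed_first_integral:
  assumes surf: "immersed_surface M A F" and ang: "angle_functions A F C S"
  obtains k where "\<And>m. m \<in> topspace M \<Longrightarrow> 2 * C m + S m = k * exp (ln (F m $ 2) - 2 * F m $ 3)"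
proof -
  define f where "f = (\<lambda>m. (2 * C m + S m) * exp (2 * F m $ 3 - ln (F m $ 2)))"
  have "((f \<circ> \<phi>) has_derivative (\<lambda>v. 0)) (at p)" if ch: "(U, \<phi>) \<in> A" and p: "p \<in> U" for U \<phi> p
  proof -
    let ?X' = "frechet_derivative (F \<circ> \<phi>) (at p)"
    let ?k = "2 * C (\<phi> p) + S (\<phi> p)"
    let ?e = "2 * F (\<phi> p) $ 3 - ln (F (\<phi> p) $ 2)"
    have CS: "((\<lambda>q. C (\<phi> q)) has_derivative (\<lambda>v. - ?k * ?X' v $ 3)) (at p)"
      "((\<lambda>q. S (\<phi> q)) has_derivative (\<lambda>v. ?k * (?X' v $ 2 / F (\<phi> p) $ 2))) (at p)"
      using angle_functionsD(3,4)[OF ang ch p] unfolding o_def[of C \<phi>] o_def[of S \<phi>] .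
    have zu: "((\<lambda>q. F (\<phi> q) $ 3) has_derivative (\<lambda>v. ?X' v $ 3)) (at p)"
      "((\<lambda>q. ln (F (\<phi> q) $ 2)) has_derivative (\<lambda>v. ?X' v $ 2 / F (\<phi> p) $ 2)) (at p)"
      by (rule chart_derivatives[OF surf ch p])+
    have "((\<lambda>q. (2 * C (\<phi> q) + S (\<phi> q)) * exp (2 * F (\<phi> q) $ 3 - ln (F (\<phi> q) $ 2))) has_derivative
       (\<lambda>v. ?k * ((2 * ?X' v $ 3 - ?X' v $ 2 / F (\<phi> p) $ 2) * exp ?e) +
        (2 * (- ?k * ?X' v $ 3) + ?k * (?X' v $ 2 / F (\<phi> p) $ 2)) * exp ?e)) (at p)"
      by (intro has_derivative_mult has_derivative_add has_derivative_mult_right has_derivative_diff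
          has_derivative_exp CS zu)
    moreover have "?k * ((2 * ?X' v $ 3 - ?X' v $ 2 / F (\<phi> p) $ 2) * exp ?e) +
        (2 * (- ?k * ?X' v $ 3) + ?k * (?X' v $ 2 / F (\<phi> p) $ 2)) * exp ?e = 0" for v
      by (simp add: algebra_simps)
    ultimately show ?thesis by (simp add: f_def o_def)
  qed
  then have "\<exists>k. \<forall>m\<in>topspace M. f m = k" by (rule constant_on_charts[OF surf])
  then obtain k where k: "\<And>m. m \<in> topspace M \<Longrightarrow> f m = k" by blast
  have "2 * C m + S m = k * exp (ln (F m $ 2) - 2 * F m $ 3)" if "m \<in> topspace M" for m
  proof -
    have "f m * exp (ln (F m $ 2) - 2 * F m $ 3) = 2 * C m + S m"
      by (simp add: f_def mult.assoc exp_add[symmetric])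
    then show ?thesis using k[OF that] by simp
  qed
  then show thesis using that by blast
qed

text \<open>Here \<open>S = - 2 C\<close>, hence \<open>dz = - 2 du\<close>; the arc length is \<open>sqrt 5 * u\<close>.  A dilation of \<open>\<alpha>1\<close>
  amounts to a shift of the parameter and of the height, so that the factor 1 suffices.\<close>

lemma classify_zero_angle_speed:
  fixes M :: "'a topology"
  assumes surf: "immersed_surface M A F" and invar: "parabolic_invariant M F"
    and ang: "angle_functions A F C S" and zero: "\<And>m. m \<in> topspace M \<Longrightarrow> 2 * C m + S m = 0"
  shows "\<exists>c J h. open J \<and> is_interval J \<and> J \<noteq> {} \<and>
      homeomorphic_map (top_of_set (J \<times> UNIV)) M h \<and>
      (\<forall>s\<in>J. \<forall>t. F (h (s, t)) = dilate_shift 1 c (param \<alpha>1 (s, t)))"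
proof -
  define f where "f = (\<lambda>m. F m $ 3 + 2 * ln (F m $ 2))"
  have "((f \<circ> \<phi>) has_derivative (\<lambda>v. 0)) (at p)" if ch: "(U, \<phi>) \<in> A" and p: "p \<in> U" for U \<phi> p
  proof -
    let ?X' = "frechet_derivative (F \<circ> \<phi>) (at p)"
    have S: "S (\<phi> p) = - 2 * C (\<phi> p)" using zero[OF chart_in_topspace[OF surf ch p]] by simp
    then have C: "C (\<phi> p) \<noteq> 0" using angle_functionsD(1)[OF ang ch p] by auto
    have y: "F (\<phi> p) $ 2 > 0" by (rule chart_in_H2R[OF surf ch p])
    have "?X' v $ 3 + 2 * (?X' v $ 2 / F (\<phi> p) $ 2) = 0" for v
    proof -
      have "C (\<phi> p) * (- 2 * ?X' v $ 2) = C (\<phi> p) * (?X' v $ 3 * F (\<phi> p) $ 2)"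
        using angle_functionsD(2)[OF ang ch p, of v] by (simp add: S algebra_simps)
      then have "- 2 * ?X' v $ 2 = ?X' v $ 3 * F (\<phi> p) $ 2"
        using C mult_left_cancel by blast
      then show ?thesis using y by (simp add: field_simps)
    qed
    moreover have "((\<lambda>q. F (\<phi> q) $ 3 + 2 * ln (F (\<phi> q) $ 2)) has_derivative
        (\<lambda>v. ?X' v $ 3 + 2 * (?X' v $ 2 / F (\<phi> p) $ 2))) (at p)"
      by (intro has_derivative_add has_derivative_mult_right chart_derivatives[OF surf ch p])
    ultimately show ?thesis by (simp add: f_def o_def)
  qed
  then have "\<exists>c. \<forall>m\<in>topspace M. f m = c" by (rule constant_on_charts[OF surf])
  then obtain c where c: "\<And>m. m \<in> topspace M \<Longrightarrow> f m = c" by blast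
  define \<sigma> where "\<sigma> = (\<lambda>m. sqrt 5 * ln (F m $ 2))"
  define \<sigma>' where "\<sigma>' = (\<lambda>(U :: (real \<times> real) set) (\<phi> :: real \<times> real \<Rightarrow> 'a) p v. sqrt 5 * (frechet_derivative (F \<circ> \<phi>) (at p) v $ 2 / F (\<phi> p) $ 2))"
  show ?thesis
    unfolding \<alpha>1_eq
  proof (intro exI[of _ c] translator_profile.grim_reaper_from_arc_length[OF profile_\<alpha>1 surf invar])
    show "inj (\<lambda>s. (exp (s / sqrt 5), - 2 * s / sqrt 5))" by (auto intro!: injI)
    show "((\<sigma> \<circ> \<phi>) has_derivative \<sigma>' U \<phi> p) (at p)" if "(U, \<phi>) \<in> A" "p \<in> U" for U \<phi> p
      using has_derivative_mult_right[OF chart_derivatives(2)[OF surf that], of "sqrt 5"]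
      by (simp add: \<sigma>_def \<sigma>'_def o_def[of _ \<phi>])
    show "continuous_on U (\<lambda>p. \<sigma>' U \<phi> p v)" if ch: "(U, \<phi>) \<in> A" for U \<phi> v
      unfolding \<sigma>'_def by (intro continuous_on_mult continuous_on_const chart_derivatives_continuous[OF surf ch])
    fix m assume m: "m \<in> topspace M"
    have "F m \<in> H2R" using m surf unfolding immersed_surface_def by blast
    then have "F m $ 2 > 0" by (simp add: H2R_def)
    moreover have "F m $ 3 = c - 2 * ln (F m $ 2)" using c[OF m] by (simp add: f_def)
    ultimately show "F m = dilate_shift 1 c (param (\<lambda>s. (exp (s / sqrt 5), - 2 * s / sqrt 5)) (\<sigma> m, F m $ 1 / 1))"
      by (simp add: dilate_shift_def param_def \<sigma>_def vec_eq_iff forall_3)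
  qed simp
qed

text \<open>The half-angle tangent and its inverse.  The half-plane \<open>2 C + S > 0\<close> does not contain the point
  \<open>(-1, 0)\<close>, where the parametrization breaks down.\<close>

lemma rational_circle_parameter:
  fixes C S :: real
  assumes "C\<^sup>2 + S\<^sup>2 = 1" "2 * C + S > 0"
  defines "r \<equiv> S / (1 + C)"
  shows "1 + C > 0" "1 + r - r\<^sup>2 = (2 * C + S) / (1 + C)"
    "(1 - r\<^sup>2) / (1 + r\<^sup>2) = C" "2 * r / (1 + r\<^sup>2) = S"
proof -
  have "C \<ge> -1"
  proof -
    have "C\<^sup>2 \<le> 1" using assms(1) by (metis le_add_same_cancel1 zero_le_power2)
    then show ?thesis by (simp add: abs_square_le_1)
  qed
  moreover have "C \<noteq> -1" using assms(1,2) by auto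
  ultimately show pos: "1 + C > 0" by simp
  have S2: "S * S = (1 - C) * (1 + C)" using assms(1) by (simp add: power2_eq_square algebra_simps)
  have r2: "r\<^sup>2 = (1 - C) / (1 + C)"
    using pos S2 by (simp add: r_def power2_eq_square)
  show "1 + r - r\<^sup>2 = (2 * C + S) / (1 + C)"
  proof -
    have "1 + r - r\<^sup>2 = (1 + C) / (1 + C) + S / (1 + C) - (1 - C) / (1 + C)"
      unfolding r2 using pos by (simp add: r_def)
    also have "\<dots> = ((1 + C) + S - (1 - C)) / (1 + C)"
      by (simp only: add_divide_distrib diff_divide_distrib)
    finally show ?thesis by simp
  qed
  have d: "1 + r\<^sup>2 = 2 / (1 + C)" unfolding r2 using pos by (simp add: field_simps)
  show "(1 - r\<^sup>2) / (1 + r\<^sup>2) = C" unfolding d unfolding r2 using pos by (simp add: field_simps)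
  show "2 * r / (1 + r\<^sup>2) = S" unfolding d using pos by (simp add: r_def)
qed

text \<open>The function \<open>\<sigma>\<close> is the parameter at which \<open>\<alpha>2\<close> has the angle of the surface; its differential \<open>\<sigma>'\<close>
  is the arc length form \<open>C du + S dz\<close>.\<close>

lemma classify_positive_angle_speed:
  fixes M :: "'a topology"
  assumes surf: "immersed_surface M A F" and invar: "parabolic_invariant M F"
    and ang: "angle_functions A F C S" and pos: "\<And>m. m \<in> topspace M \<Longrightarrow> 2 * C m + S m > 0"
  shows "\<exists>l c J h. 0 < l \<and> open J \<and> is_interval J \<and> J \<noteq> {} \<and>
      homeomorphic_map (top_of_set (J \<times> UNIV)) M h \<and>
      (\<forall>s\<in>J. \<forall>t. F (h (s, t)) = dilate_shift l c (param \<alpha>2 (s, t)))"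
proof -
  define \<sigma> where "\<sigma> = (\<lambda>m. half_angle_inv (S m / (1 + C m)))"
  define \<sigma>' where "\<sigma>' = (\<lambda>(U :: (real \<times> real) set) (\<phi> :: real \<times> real \<Rightarrow> 'a) p v.
    C (\<phi> p) * (frechet_derivative (F \<circ> \<phi>) (at p) v $ 2 / F (\<phi> p) $ 2)
    + S (\<phi> p) * frechet_derivative (F \<circ> \<phi>) (at p) v $ 3)"
  have point: "C m = cos2 (\<sigma> m)" "S m = sin2 (\<sigma> m)"
    if m: "m \<in> topspace M" and unit: "(C m)\<^sup>2 + (S m)\<^sup>2 = 1" for m
  proof -
    note r = rational_circle_parameter[OF unit pos[OF m]]
    have "half_angle (\<sigma> m) = S m / (1 + C m)"
      unfolding \<sigma>_def by (rule half_angle_half_angle_inv) (use r(1,2) pos[OF m] in simp)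
    then show "C m = cos2 (\<sigma> m)" "S m = sin2 (\<sigma> m)" by (simp_all only: cos2_def sin2_def r(3,4))
  qed
  have \<sigma>: "((\<sigma> \<circ> \<phi>) has_derivative \<sigma>' U \<phi> p) (at p)"
    and dy: "frechet_derivative (F \<circ> \<phi>) (at p) v $ 2 / F (\<phi> p) $ 2 = cos2 (\<sigma> (\<phi> p)) * \<sigma>' U \<phi> p v"
    and dz: "frechet_derivative (F \<circ> \<phi>) (at p) v $ 3 = sin2 (\<sigma> (\<phi> p)) * \<sigma>' U \<phi> p v"
    if ch: "(U, \<phi>) \<in> A" and p: "p \<in> U" for U \<phi> p v
  proof -
    let ?X' = "frechet_derivative (F \<circ> \<phi>) (at p)"
    let ?C = "C (\<phi> p)" and ?S = "S (\<phi> p)" and ?y = "F (\<phi> p) $ 2"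
    let ?k = "2 * ?C + ?S"
    let ?r = "?S / (1 + ?C)"
    have m: "\<phi> p \<in> topspace M" by (rule chart_in_topspace[OF surf ch p])
    have y: "?y > 0" by (rule chart_in_H2R[OF surf ch p])
    have unit: "?C\<^sup>2 + ?S\<^sup>2 = 1" by (rule angle_functionsD(1)[OF ang ch p])
    note k = pos[OF m]
    note r = rational_circle_parameter[OF unit k]
    have X: "((F \<circ> \<phi>) has_derivative ?X') (at p)"
      by (rule smooth_on_has_derivative[OF chart_smooth[OF surf ch] p])
    have fy: "?X' v $ 2 / ?y = ?C * \<sigma>' U \<phi> p v" and fz: "?X' v $ 3 = ?S * \<sigma>' U \<phi> p v" for v
      using first_form_parabolic(1,2)[OF X _ unit, of v] angle_functionsD(2)[OF ang ch p] y
      by (simp_all add: \<sigma>'_def)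
    show "?X' v $ 2 / ?y = cos2 (\<sigma> (\<phi> p)) * \<sigma>' U \<phi> p v" "?X' v $ 3 = sin2 (\<sigma> (\<phi> p)) * \<sigma>' U \<phi> p v"
      using fy[of v] fz[of v] point[OF m unit] by simp_all
    have dC: "((\<lambda>q. C (\<phi> q)) has_derivative (\<lambda>v. - ?k * ?S * \<sigma>' U \<phi> p v)) (at p)"
      using angle_functionsD(3)[OF ang ch p] unfolding o_def[of C \<phi>] fz by (simp only: mult.assoc)
    have dS: "((\<lambda>q. S (\<phi> q)) has_derivative (\<lambda>v. ?k * ?C * \<sigma>' U \<phi> p v)) (at p)"
      using angle_functionsD(4)[OF ang ch p] unfolding o_def[of S \<phi>] fy by (simp only: mult.assoc)
    have "((\<lambda>q. S (\<phi> q) / (1 + C (\<phi> q))) has_derivative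
        (\<lambda>v. - ?S * (inverse (1 + ?C) * (0 + - ?k * ?S * \<sigma>' U \<phi> p v) * inverse (1 + ?C))
          + ?k * ?C * \<sigma>' U \<phi> p v / (1 + ?C))) (at p)"
      by (intro has_derivative_divide dS has_derivative_add has_derivative_const dC) (use r(1) in simp)
    moreover have "- ?S * (inverse (1 + ?C) * (0 + - ?k * ?S * a) * inverse (1 + ?C))
          + ?k * ?C * a / (1 + ?C) = (1 + ?r - ?r\<^sup>2) * a" for a
    proof -
      have "?S * ?S = (1 - ?C) * (1 + ?C)" using unit by (simp add: power2_eq_square algebra_simps)
      then have "- ?S * (inverse (1 + ?C) * (0 + - ?k * ?S * a) * inverse (1 + ?C)) = ?k * a * (1 - ?C) / (1 + ?C)"
      proof -
        let ?d = "1 + ?C"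
        assume SS: "?S * ?S = (1 - ?C) * ?d"
        have "- ?S * (inverse ?d * (0 + - ?k * ?S * a) * inverse ?d) = ?k * a * (?S * ?S) * (inverse ?d * inverse ?d)"
        proof -
          have "- x * (i * (0 + - k * x * a) * i) = k * a * (x * x) * (i * i)" for x i k :: real
            by (simp add: algebra_simps)
          then show ?thesis .
        qed
        also have "\<dots> = ?k * a * (1 - ?C) * (?d * inverse ?d) * inverse ?d"
          by (simp only: SS mult_ac)
        also have "?d * inverse ?d = 1" using r(1) by simp
        finally show ?thesis by (simp only: mult_1_right divide_inverse)
      qed
      then have "- ?S * (inverse (1 + ?C) * (0 + - ?k * ?S * a) * inverse (1 + ?C)) + ?k * ?C * a / (1 + ?C)
         = ?k * a / (1 + ?C)"
        by (simp add: add_divide_distrib[symmetric] algebra_simps)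
      then show ?thesis unfolding r(2) by simp
    qed
    ultimately have dr: "((\<lambda>q. S (\<phi> q) / (1 + C (\<phi> q))) has_derivative (\<lambda>v. (1 + ?r - ?r\<^sup>2) * \<sigma>' U \<phi> p v)) (at p)"
      by simp
    have q: "1 + ?r - ?r\<^sup>2 > 0" using r(1,2) k by simp
    have "(half_angle_inv has_derivative (*) (1 / (1 + ?r - ?r\<^sup>2))) (at ?r)"
      using half_angle_inv_derivative[OF q] by (simp add: has_field_derivative_def)
    from has_derivative_compose[OF dr this]
    have "((\<lambda>q. half_angle_inv (S (\<phi> q) / (1 + C (\<phi> q)))) has_derivative
        (\<lambda>v. 1 / (1 + ?r - ?r\<^sup>2) * ((1 + ?r - ?r\<^sup>2) * \<sigma>' U \<phi> p v))) (at p)" .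
    then show "((\<sigma> \<circ> \<phi>) has_derivative \<sigma>' U \<phi> p) (at p)"
      using q by (simp add: \<sigma>_def o_def)
  qed
  have chain: "((\<lambda>q. f (\<sigma> (\<phi> q))) has_derivative (\<lambda>v. f' (\<sigma> (\<phi> p)) * \<sigma>' U \<phi> p v)) (at p)"
    if "\<And>s. (f has_real_derivative f' s) (at s)" "(U, \<phi>) \<in> A" "p \<in> U" for f f' U \<phi> p
    using has_derivative_compose[OF \<sigma>[OF that(2,3), unfolded o_def] that(1)[unfolded has_field_derivative_def]] .
  \<comment> \<open>\<open>z - z2 \<sigma>\<close> and \<open>ln y - ln (y2 \<sigma>)\<close> are the two constants of integration.\<close>
  have z_const: "(((\<lambda>m. F m $ 3 - z2 (\<sigma> m)) \<circ> \<phi>) has_derivative (\<lambda>v. 0)) (at p)"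
    if ch: "(U, \<phi>) \<in> A" "p \<in> U" for U \<phi> p
    using has_derivative_diff[OF chart_derivatives(1)[OF surf ch, of 3] chain[OF z2_derivative ch]]
    unfolding dz[OF ch] unfolding o_def[of _ \<phi>] by simp
  have "\<exists>c. \<forall>m\<in>topspace M. F m $ 3 - z2 (\<sigma> m) = c"
    by (rule constant_on_charts[OF surf]) (rule z_const)
  then obtain c where c: "\<And>m. m \<in> topspace M \<Longrightarrow> F m $ 3 - z2 (\<sigma> m) = c" by blast
  have ln_y2: "((\<lambda>s. ln (y2 s)) has_real_derivative cos2 s) (at s)" for s
    using DERIV_chain2[OF DERIV_ln_divide[OF y2_pos] y2_derivative, of s] y2_pos[of s] by simp
  have y_const: "(((\<lambda>m. ln (F m $ 2) - ln (y2 (\<sigma> m))) \<circ> \<phi>) has_derivative (\<lambda>v. 0)) (at p)"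
    if ch: "(U, \<phi>) \<in> A" "p \<in> U" for U \<phi> p
    using has_derivative_diff[OF chart_derivatives(2)[OF surf ch] chain[OF ln_y2 ch]]
    unfolding dy[OF ch] unfolding o_def[of _ \<phi>] by simp
  have "\<exists>b. \<forall>m\<in>topspace M. ln (F m $ 2) - ln (y2 (\<sigma> m)) = b"
    by (rule constant_on_charts[OF surf]) (rule y_const)
  then obtain b where b: "\<And>m. m \<in> topspace M \<Longrightarrow> ln (F m $ 2) - ln (y2 (\<sigma> m)) = b" by blast
  have "\<exists>J h. open J \<and> is_interval J \<and> J \<noteq> {} \<and>
      homeomorphic_map (top_of_set (J \<times> UNIV)) M h \<and>
      (\<forall>s\<in>J. \<forall>t. F (h (s, t)) = dilate_shift (exp b) c (param \<alpha>2 (s, t)))"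
    unfolding \<alpha>2_eq
  proof (rule translator_profile.grim_reaper_from_arc_length[OF profile_\<alpha>2 surf invar _ _ _ \<sigma>])
    show "inj (\<lambda>s. (y2 s, z2 s))"
      using embedded_curve_\<alpha>2 unfolding embedded_curve_def \<alpha>2_eq homeomorphism_def
      by (metis (no_types, lifting) UNIV_I injI)
    show "continuous_on U (\<lambda>p. \<sigma>' U \<phi> p v)" if ch: "(U, \<phi>) \<in> A" for U \<phi> v
    proof -
      have "continuous_on U (C \<circ> \<phi>)"
        by (intro continuous_at_imp_continuous_on ballI has_derivative_continuous[OF angle_functionsD(3)[OF ang ch]])
      moreover have "continuous_on U (S \<circ> \<phi>)"
        by (intro continuous_at_imp_continuous_on ballI has_derivative_continuous[OF angle_functionsD(4)[OF ang ch]])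
      ultimately have CS: "continuous_on U (\<lambda>p. C (\<phi> p))" "continuous_on U (\<lambda>p. S (\<phi> p))"
        by (simp_all add: o_def)
      show ?thesis
        unfolding \<sigma>'_def
        by (intro continuous_on_add continuous_on_mult CS chart_derivatives_continuous[OF surf ch])
    qed
    fix m assume m: "m \<in> topspace M"
    have "F m \<in> H2R" using m surf unfolding immersed_surface_def by blast
    then have "F m $ 2 > 0" by (simp add: H2R_def)
    then have "F m $ 2 = exp (b + ln (y2 (\<sigma> m)))" using b[OF m] by (metis add.commute diff_add_cancel exp_ln)
    then have "F m $ 2 = exp b * y2 (\<sigma> m)" by (simp add: exp_add y2_pos)
    moreover have "F m $ 3 = z2 (\<sigma> m) + c" using c[OF m] by simp
    ultimately show "F m = dilate_shift (exp b) c (param (\<lambda>s. (y2 s, z2 s)) (\<sigma> m, F m $ 1 / exp b))"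
      by (simp add: dilate_shift_def param_def vec_eq_iff forall_3)
  qed simp_all
  then show ?thesis by (metis exp_gt_zero)
qed

text \<open>The sign of the first integral decides between the two families.\<close>

theorem parabolic_v_grim_reaper_classification:
  fixes M :: "'a topology"
  assumes "parabolic_v_grim_reaper M A F"
  shows "\<exists>\<alpha>\<in>{\<alpha>1, \<alpha>2}. \<exists>l c J h. 0 < l \<and> open J \<and> is_interval J \<and> J \<noteq> {} \<and>
      homeomorphic_map (top_of_set (J \<times> UNIV)) M h \<and>
      (\<forall>s\<in>J. \<forall>t. F (h (s, t)) = dilate_shift l c (param \<alpha> (s, t)))"
proof -
  obtain N where tr: "v_translator M A F N" and invar: "parabolic_invariant M F"
    using assms by (auto simp: parabolic_v_grim_reaper_def)
  have surf: "immersed_surface M A F" using tr by (simp add: v_translator_def)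
  obtain C S where ang: "angle_functions A F C S"
    using grim_reaper_angle_functions[OF tr invar] by blast
  obtain k where k: "\<And>m. m \<in> topspace M \<Longrightarrow> 2 * C m + S m = k * exp (ln (F m $ 2) - 2 * F m $ 3)"
    using angle_speed_first_integral[OF surf ang] by blast
  consider "k = 0" | "k > 0" | "k < 0" by linarith
  then show ?thesis
  proof cases
    case 1
    then have "\<And>m. m \<in> topspace M \<Longrightarrow> 2 * C m + S m = 0" using k by simp
    from classify_zero_angle_speed[OF surf invar ang this] show ?thesis
      using zero_less_one by blast
  next
    case 2
    then have "\<And>m. m \<in> topspace M \<Longrightarrow> 2 * C m + S m > 0" using k by simp
    from classify_positive_angle_speed[OF surf invar ang this] show ?thesis by blast
  next
    case 3
    have "\<And>m. m \<in> topspace M \<Longrightarrow> 2 * - C m + - S m > 0"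
      using k 3 by (smt (verit) exp_gt_zero mult_neg_pos)
    from classify_positive_angle_speed[OF surf invar angle_functions_uminus[OF ang] this]
    show ?thesis by blast
  qed
qed

theorem theorem4p1:
  shows
    "(\<forall>(M :: 'a topology) A F. parabolic_v_grim_reaper M A F \<longrightarrow>
        (\<exists>\<alpha>\<in>{\<alpha>1, \<alpha>2}. \<exists>l c J h.
           0 < l \<and> open J \<and> is_interval J \<and> J \<noteq> {} \<and>
           homeomorphic_map (top_of_set (J \<times> UNIV)) M h \<and>
           (\<forall>s\<in>J. \<forall>t. F (h (s, t)) = dilate_shift l c (param \<alpha> (s, t))))) \<and>
     parabolic_v_grim_reaper euclidean {(UNIV, id)} (param \<alpha>1) \<and>
     parabolic_v_grim_reaper euclidean {(UNIV, id)} (param \<alpha>2) \<and>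
     (embedded_curve \<alpha>1 \<and> vertical_graph (range \<alpha>1) \<and>
      \<not> bounded (range (\<lambda>s. snd (\<alpha>1 s))) \<and>
      ideal_contact (\<lambda>s. param \<alpha>1 (s, 0)) at_bot (Line 0)) \<and>
     (embedded_curve \<alpha>2 \<and> vertical_bigraph (range \<alpha>2) \<and>
      (\<exists>s0. \<forall>s. z2 s0 \<le> z2 s) \<and> (\<exists>s0. \<forall>s. y2 s \<le> y2 s0) \<and>
      (\<forall>t. ideal_contact (\<lambda>s. param \<alpha>2 (s, t)) at_bot (Line t) \<and>
           ideal_contact (\<lambda>s. param \<alpha>2 (s, t)) at_top (Line t)))"
proof -
  have "parabolic_v_grim_reaper euclidean {(UNIV, id)} (param \<alpha>1)"
    unfolding \<alpha>1_eq by (rule translator_profile.parabolic_v_grim_reaper_param[OF profile_\<alpha>1])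
  moreover have "parabolic_v_grim_reaper euclidean {(UNIV, id)} (param \<alpha>2)"
    unfolding \<alpha>2_eq by (rule translator_profile.parabolic_v_grim_reaper_param[OF profile_\<alpha>2])
  ultimately show ?thesis
    using parabolic_v_grim_reaper_classification embedded_curve_\<alpha>1 vertical_graph_\<alpha>1
      unbounded_height_\<alpha>1 ideal_contact_\<alpha>1 embedded_curve_\<alpha>2 vertical_bigraph_\<alpha>2
      z2_min y2_max ideal_contact_\<alpha>2 by blast
qed

end
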